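(* Let $m_*$ be a probability measure on $\mathbb R^d$ with density $m_*(x)=\exp(-U(x))$ for some $U\in C^2(\mathbb R^d;\mathbb R)$ such that the operator norm of $\nabla^2U(x)$ is bounded by $M>0$ for all $x$, and suppose $m_*$ satisfies a $\rho$-log-Sobolev inequality for some $\rho>0$. Let $(X_t)_{t\geqslant 0}$ solve $\mathrm dX_t=-\nabla U(X_t)\,\mathrm dt+\sqrt2\,\mathrm dB_t$ with $B$ a standard $d$-dimensional Brownian motion and $X_0\sim m_0$ independent of $B$. Then for all $t\geqslant 1$, all $r\geqslant 0$ and all $1$-Lipschitz $f\colon\mathbb R^d\to\mathbb R$, \[ \mathbb P\bigl[f(X_t)-m_*[f]\geqslant r\bigr]\leqslant\int_{\mathbb R^d}\exp\Bigl(\frac{M^2+3}{6}e^{-\rho(t-1)}W_2^2(\delta_x,m_* )\Bigr)m_0(\mathrm dx)\;\exp\Bigl(-\frac{\rho r^2}{4}\Bigr), \] where $m_*[f]\coloneqq\int f\,\mathrm dm_*$.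
   Context: For probability measures $\nu,\mu$ on $\mathbb R^d$ with $\mathrm d\nu/\mathrm d\mu$ bounded and $C^1$ with bounded derivatives, $H(\nu|\mu)\coloneqq\int\log\frac{\mathrm d\nu}{\mathrm d\mu}\,\mathrm d\nu$ and $I(\nu|\mu)\coloneqq\int|\nabla\log\frac{\mathrm d\nu}{\mathrm d\mu}|^2\,\mathrm d\nu$; $\mu$ satisfies a $\rho$-log-Sobolev inequality if $2\rho H(\nu|\mu)\leqslant I(\nu|\mu)$ for all such $\nu$. $W_2$ denotes the quadratic Wasserstein distance. *)

theory Defs
  imports "HOL-Probability.Probability"
begin

definition gibbs :: "('a::euclidean_space \<Rightarrow> real) \<Rightarrow> 'a measure" where
  "gibbs U = density lborel (\<lambda>x. ennreal (exp (- U x)))"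

text \<open>Relative entropy H(nu|mu) and Fisher information I(nu|mu) for nu = h mu,
  where gh is the gradient of h; note grad log h = gh / h.\<close>
definition rel_entropy_dens :: "'a measure \<Rightarrow> ('a \<Rightarrow> real) \<Rightarrow> real" where
  "rel_entropy_dens \<mu> h = (\<integral>x. h x * ln (h x) \<partial>\<mu>)"

definition fisher_info_dens :: "'a measure \<Rightarrow> ('a \<Rightarrow> real) \<Rightarrow> ('a \<Rightarrow> 'a::real_normed_vector) \<Rightarrow> ennreal" where
  "fisher_info_dens \<mu> h gh = (\<integral>\<^sup>+x. ennreal (h x * (norm (gh x) / h x)\<^sup>2) \<partial>\<mu>)"

definition log_sobolev :: "real \<Rightarrow> 'a::euclidean_space measure \<Rightarrow> bool" where
  "log_sobolev \<rho> \<mu> \<longleftrightarrow>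
     (\<forall>h gh. (\<forall>x. 0 \<le> h x) \<and> bounded (range h) \<and>
        (\<forall>x. (h has_derivative (\<lambda>v. gh x \<bullet> v)) (at x)) \<and> continuous_on UNIV gh \<and>
        bounded (range gh) \<and> (\<integral>x. h x \<partial>\<mu>) = 1
        \<longrightarrow> ennreal (2 * \<rho> * rel_entropy_dens \<mu> h) \<le> fisher_info_dens \<mu> h gh)"

definition couplings :: "'a measure \<Rightarrow> 'b measure \<Rightarrow> ('a \<times> 'b) measure set" where
  "couplings \<mu> \<nu> = {\<pi>. prob_space \<pi> \<and> sets \<pi> = sets (\<mu> \<Otimes>\<^sub>M \<nu>) \<and>
      distr \<pi> \<mu> fst = \<mu> \<and> distr \<pi> \<nu> snd = \<nu>}"

definition W2sq :: "'a::metric_space measure \<Rightarrow> 'a measure \<Rightarrow> ennreal" where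
  "W2sq \<mu> \<nu> = (INF \<pi>\<in>couplings \<mu> \<nu>. \<integral>\<^sup>+p. ennreal ((dist (fst p) (snd p))\<^sup>2) \<partial>\<pi>)"

definition gaussian_vec :: "real \<Rightarrow> 'a::euclidean_space measure" where
  "gaussian_vec s = density lborel
     (\<lambda>x. ennreal ((2 * pi * s) powr (- real DIM('a) / 2) * exp (- (norm x)\<^sup>2 / (2 * s))))"

definition std_BM :: "'w measure \<Rightarrow> (real \<Rightarrow> 'w \<Rightarrow> 'a::euclidean_space) \<Rightarrow> bool" where
  "std_BM P B \<longleftrightarrow>
     (\<forall>t. B t \<in> borel_measurable P) \<and>
     (AE \<omega> in P. B 0 \<omega> = 0 \<and> continuous_on {0..} (\<lambda>t. B t \<omega>)) \<and>
     (\<forall>s t. 0 \<le> s \<longrightarrow> s < t \<longrightarrow> distr P borel (\<lambda>\<omega>. B t \<omega> - B s \<omega>) = gaussian_vec (t - s)) \<and>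
     (\<forall>(ts::nat \<Rightarrow> real) n. 0 \<le> ts 0 \<and> (\<forall>i<n. ts i < ts (Suc i)) \<longrightarrow>
        prob_space.indep_vars P (\<lambda>_. borel) (\<lambda>i \<omega>. B (ts (Suc i)) \<omega> - B (ts i) \<omega>) {..<n})"

end

theory Submission
  imports Defs
begin

text \<open>Everything is done on the Euler kernel \<open>Q\<^sub>h\<close> of the diffusion, whose law is an iterated Gaussian
  integral, and the step size tends to zero only at the end, along each path.

  Over the first unit of time, a coupling whose difference shrinks linearly to zero gives the Harnack
  inequality \<open>(Q\<^sup>n F)\<^sup>p(x) \<le> Q\<^sup>n(F\<^sup>p)(y) exp (p/(p-1) (M\<^sup>2+3)/6 |x-y|\<^sup>2)\<close>; integrating it in \<open>y\<close> against
  the invariant measure \<open>m\<close> and using Jensen's inequality bounds \<open>Q\<^sup>n F\<close> pointwise by the \<open>L\<^sup>p\<close> norm of \<open>F\<close>.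
  Over the remaining time \<open>t - 1\<close> the log-Sobolev inequality makes the dynamics contract \<open>L\<^sup>2(m)\<close> into
  \<open>L\<^sup>p(m)\<close> with \<open>p - 1 = exp (\<rho>(t-1))\<close>. Applied to an approximation of the indicator of the deviation event,
  whose \<open>L\<^sup>2\<close> norm is at most \<open>exp (-\<rho>r\<^sup>2/4)\<close> by Herbst's argument, the two steps give the bound.

  No second derivatives of the semigroup are needed: test functions are only Lipschitz, and the variance of a
  function under a Gaussian step dominates the squared gradient of its smoothed version.\<close>

section \<open>The standard Gaussian measure\<close>

text \<open>Both constants of the claim leave strict room, and the discretization lives in it. The
  coupling cost tends to the integral of \<open>(1 + M \<tau>)^2 / 4\<close> over the unit interval;
  \<open>(M^2 + 3) / 6\<close> is what \<open>(a + b)^2 \<le> 2 a^2 + 2 b^2\<close> makes of it.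
  Jensen's inequality in place of the derivative of the \<open>L^q\<close> norm is lossless at
  \<open>q = 2\<close> and gives away up to half of the entropy production for large
  \<open>q\<close>. The exponent still grows like \<open>2 exp (\<rho> s)\<close>, and
  \<open>1 + exp (\<rho> s)\<close> is enough, because the Harnack exponent
  \<open>p / (p - 1)\<close> becomes \<open>1 / (p - 1)\<close> after the \<open>p\<close>-th root.

  The obstacle is that the Euler kernel does not leave \<open>m\<close> invariant. About
  \<open>1 / h\<close> steps accumulate, so each local error must be of smaller order than
  \<open>h\<close>; here it is \<open>h * sqrt h\<close>, with constants depending on a Lipschitz
  constant and a positive lower bound of the test function. The kernel keeps the lower bound, and
  over a bounded time the Lipschitz constant grows by a bounded factor. The lower bound is removed
  together with the smoothing of the indicator, in the last limit.\<close>

definition gauss_dens :: "real \<Rightarrow> 'a::euclidean_space \<Rightarrow> real" where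
  "gauss_dens s x = (2 * pi * s) powr (- real DIM('a) / 2) * exp (- (norm x)\<^sup>2 / (2 * s))"

abbreviation std_gauss :: "'a::euclidean_space measure" where
  "std_gauss \<equiv> gaussian_vec 1"

lemma gaussian_vec_eq_density: "gaussian_vec s = density lborel (\<lambda>x. ennreal (gauss_dens s x))"
  by (simp add: gaussian_vec_def gauss_dens_def)

lemma sets_gaussian_vec [simp, measurable_cong]: "sets (gaussian_vec s) = sets borel"
  and space_gaussian_vec [simp]: "space (gaussian_vec s) = UNIV"
  by (simp_all add: gaussian_vec_def)

lemma gauss_dens_measurable [measurable]: "gauss_dens s \<in> borel_measurable borel"
  unfolding gauss_dens_def by measurable

lemma gauss_dens_nonneg [simp]: "0 \<le> gauss_dens s x"
  by (simp add: gauss_dens_def)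

text \<open>Reduces the total mass to one-dimensional normal densities with standard deviation
  \<open>sqrt s\<close>.\<close>

lemma gauss_dens_eq_prod:
  assumes "s > 0"
  shows "gauss_dens s (x::'a::euclidean_space) = (\<Prod>b\<in>Basis. normal_density 0 (sqrt s) (x \<bullet> b))"
proof -
  have n: "(norm x)\<^sup>2 = (\<Sum>b\<in>Basis. (x \<bullet> b)\<^sup>2)"
    unfolding power2_norm_eq_inner by (subst euclidean_inner) (simp add: power2_eq_square)
  have "(2 * pi * s) powr (- real DIM('a) / 2) = ((2 * pi * s) powr (- 1 / 2)) powr real DIM('a)"
    by (simp add: powr_powr)
  also have "\<dots> = ((2 * pi * s) powr (- 1 / 2)) ^ DIM('a)"
    using assms by (subst powr_realpow) auto
  also have "(2 * pi * s) powr (- 1 / 2) = 1 / sqrt (2 * pi * s)"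
    using assms by (simp add: powr_minus powr_half_sqrt inverse_eq_divide)
  finally have c: "(2 * pi * s) powr (- real DIM('a) / 2) = (1 / sqrt (2 * pi * s)) ^ DIM('a)" .
  have "(\<Prod>b\<in>Basis. normal_density 0 (sqrt s) (x \<bullet> b))
      = (1 / sqrt (2 * pi * s)) ^ DIM('a) * exp (\<Sum>b\<in>Basis. - (x \<bullet> b)\<^sup>2 / (2 * s))"
    unfolding normal_density_def using assms by (simp add: prod_dividef exp_sum power_one_over field_simps)
  also have "(\<Sum>b\<in>Basis. - (x \<bullet> b)\<^sup>2 / (2 * s)) = - (norm x)\<^sup>2 / (2 * s)"
    by (simp add: n sum_divide_distrib sum_negf)
  finally show ?thesis
    unfolding gauss_dens_def c by simp
qed

lemma prob_space_gaussian_vec: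
  assumes "s > 0"
  shows "prob_space (gaussian_vec s :: 'a::euclidean_space measure)"
proof
  have "emeasure (gaussian_vec s :: 'a measure) UNIV
      = (\<integral>\<^sup>+x. (\<Prod>b\<in>(Basis::'a set). ennreal (normal_density 0 (sqrt s) (x \<bullet> b))) \<partial>lborel)"
    unfolding gaussian_vec_eq_density using assms
    by (simp add: emeasure_density gauss_dens_eq_prod prod_ennreal)
  also have "\<dots> = (\<Prod>b\<in>(Basis::'a set). (\<integral>\<^sup>+x. ennreal (normal_density 0 (sqrt s) x) \<partial>lborel))"
    by (rule nn_integral_lborel_prod) auto
  also have "\<dots> = 1"
    using assms by (simp add: nn_integral_eq_integral)
  finally show "emeasure (gaussian_vec s :: 'a measure) (space (gaussian_vec s)) = 1" by simp
qed

interpretation std_gauss: prob_space std_gauss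
  by (rule prob_space_gaussian_vec) simp

lemma std_gauss_UNIV [simp]: "measure std_gauss UNIV = 1"
  using std_gauss.prob_space by simp

section \<open>Affine images and translations of the Gaussian\<close>

lemma distr_std_gauss_affine:
  fixes a :: "'a::euclidean_space"
  assumes "\<sigma> \<noteq> 0"
  shows "distr std_gauss borel (\<lambda>z. a + \<sigma> *\<^sub>R z) = density lborel (\<lambda>y. ennreal (gauss_dens (\<sigma>\<^sup>2) (y - a)))"
proof -
  \<comment> \<open>The Jacobian of the scaling cancels the change of the normalising
    constant.\<close>
  have c: "\<bar>\<sigma>\<bar> ^ DIM('a) * gauss_dens (\<sigma>\<^sup>2) (\<sigma> *\<^sub>R z) = gauss_dens 1 z" for z :: 'a
  proof -
    have "(2 * pi * \<sigma>\<^sup>2) powr (- real DIM('a) / 2) = (2 * pi) powr (- real DIM('a) / 2) * (\<sigma>\<^sup>2) powr (- real DIM('a) / 2)"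
      by (simp add: powr_mult)
    also have "\<sigma>\<^sup>2 = \<bar>\<sigma>\<bar> powr 2" using assms by simp
    also have "(\<bar>\<sigma>\<bar> powr 2) powr (- real DIM('a) / 2) = inverse (\<bar>\<sigma>\<bar> ^ DIM('a))"
      unfolding powr_powr using assms by (simp add: powr_minus powr_realpow del: powr_numeral)
    finally show ?thesis
      using assms by (simp add: gauss_dens_def power_mult_distrib field_simps)
  qed
  have "density lborel (\<lambda>y. ennreal (gauss_dens (\<sigma>\<^sup>2) (y - a)))
      = density (density (distr lborel borel (\<lambda>x. a + \<sigma> *\<^sub>R x)) (\<lambda>_. \<bar>\<sigma>\<bar>^DIM('a)))
         (\<lambda>y. ennreal (gauss_dens (\<sigma>\<^sup>2) (y - a)))"
    using lborel_affine[OF assms, of a] by simp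
  also have "\<dots> = density (distr lborel borel (\<lambda>x. a + \<sigma> *\<^sub>R x))
       (\<lambda>y. ennreal (\<bar>\<sigma>\<bar>^DIM('a) * gauss_dens (\<sigma>\<^sup>2) (y - a)))"
    by (subst density_density_eq) (auto simp: ennreal_mult' ennreal_power)
  also have "\<dots> = distr (density lborel (\<lambda>z. ennreal (\<bar>\<sigma>\<bar>^DIM('a) * gauss_dens (\<sigma>\<^sup>2) (a + \<sigma> *\<^sub>R z - a))))
        borel (\<lambda>x. a + \<sigma> *\<^sub>R x)"
    by (subst density_distr) auto
  also have "\<dots> = distr std_gauss borel (\<lambda>z. a + \<sigma> *\<^sub>R z)"
    by (simp add: c gaussian_vec_eq_density)
  finally show ?thesis ..
qed

lemma gaussian_vec_eq_distr:
  assumes "s > 0"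
  shows "gaussian_vec s = distr std_gauss borel (\<lambda>z. sqrt s *\<^sub>R z)"
  using distr_std_gauss_affine[of "sqrt s" 0, symmetric] assms by (simp add: gaussian_vec_eq_density)

lemma distr_std_gauss_uminus: "distr std_gauss borel uminus = std_gauss"
  using distr_std_gauss_affine[of "-1" 0] by (simp add: gaussian_vec_eq_density)

text \<open>The Cameron-Martin density: the law of a standard Gaussian translated by
  \<open>w\<close>, relative to the untranslated one. Differentiability of smoothed functions and
  the Harnack inequality are both read off from it.\<close>

definition gauss_tilt :: "'a::euclidean_space \<Rightarrow> 'a \<Rightarrow> real" where
  "gauss_tilt w z = exp (z \<bullet> w - (norm w)\<^sup>2 / 2)"

lemma gauss_tilt_measurable [measurable]: "gauss_tilt w \<in> borel_measurable borel"
  unfolding gauss_tilt_def by measurable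

lemma gauss_tilt_pos [simp]: "0 < gauss_tilt w z"
  by (simp add: gauss_tilt_def)

lemma distr_std_gauss_shift:
  "distr std_gauss borel (\<lambda>z. z + w) = density std_gauss (\<lambda>z. ennreal (gauss_tilt w z))"
proof -
  have "gauss_dens 1 (z - w) = gauss_dens 1 z * gauss_tilt w z" for z
  proof -
    have "- (norm (z - w))\<^sup>2 / 2 = - (norm z)\<^sup>2 / 2 + (z \<bullet> w - (norm w)\<^sup>2 / 2)"
      by (simp add: power2_norm_eq_inner inner_diff_left inner_diff_right inner_commute[of w z] field_simps)
    then show ?thesis
      by (simp add: gauss_dens_def gauss_tilt_def exp_add[symmetric])
  qed
  then show ?thesis
    using distr_std_gauss_affine[of 1 w]
    by (simp add: gaussian_vec_eq_density density_density_eq ennreal_mult' add.commute)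
qed

lemma integral_std_gauss_shift:
  fixes G :: "'a::euclidean_space \<Rightarrow> real"
  assumes [measurable]: "G \<in> borel_measurable borel"
  shows "(\<integral>z. G (z + w) \<partial>std_gauss) = (\<integral>z. gauss_tilt w z * G z \<partial>std_gauss)"
    and "integrable std_gauss (\<lambda>z. G (z + w)) \<longleftrightarrow> integrable std_gauss (\<lambda>z. gauss_tilt w z * G z)"
proof -
  have "(\<integral>z. G (z + w) \<partial>std_gauss) = (\<integral>z. G z \<partial>distr std_gauss borel (\<lambda>z. z + w))"
    by (subst integral_distr) auto
  then show "(\<integral>z. G (z + w) \<partial>std_gauss) = (\<integral>z. gauss_tilt w z * G z \<partial>std_gauss)"
    unfolding distr_std_gauss_shift by (subst (asm) integral_density) (auto simp: less_imp_le)
  have "integrable std_gauss (\<lambda>z. G (z + w)) \<longleftrightarrow> integrable (distr std_gauss borel (\<lambda>z. z + w)) G"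
    by (subst integrable_distr_eq) auto
  then show "integrable std_gauss (\<lambda>z. G (z + w)) \<longleftrightarrow> integrable std_gauss (\<lambda>z. gauss_tilt w z * G z)"
    unfolding distr_std_gauss_shift by (subst (asm) integrable_density) (auto simp: less_imp_le)
qed

lemma gauss_tilt_integrable [simp]: "integrable std_gauss (gauss_tilt (w::'a::euclidean_space))"
  and integral_gauss_tilt [simp]: "(\<integral>z. gauss_tilt (w::'a) z \<partial>std_gauss) = 1"
  using integral_std_gauss_shift[of "\<lambda>_. 1" w] std_gauss.prob_space[where 'a='a] by auto

section \<open>Exponential, polynomial and second moments\<close>

lemma std_gauss_mgf:
  fixes w :: "'a::euclidean_space"
  shows "integrable std_gauss (\<lambda>z. exp (z \<bullet> w))"
    and "(\<integral>z. exp (z \<bullet> w) \<partial>std_gauss) = exp ((norm w)\<^sup>2 / 2)"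
proof -
  have e: "exp (z \<bullet> w) = exp ((norm w)\<^sup>2 / 2) * gauss_tilt w z" for z
    by (simp add: gauss_tilt_def exp_add[symmetric])
  show "integrable std_gauss (\<lambda>z. exp (z \<bullet> w))" unfolding e by simp
  show "(\<integral>z. exp (z \<bullet> w) \<partial>std_gauss) = exp ((norm w)\<^sup>2 / 2)" unfolding e by simp
qed

lemma exp_abs_le_sum: "exp \<bar>x\<bar> \<le> exp x + exp (- x)" for x :: real
  by (cases "x \<ge> 0") auto

lemma std_gauss_exp_abs_integrable: "integrable std_gauss (\<lambda>z. exp \<bar>z \<bullet> w\<bar>)"
proof (rule Bochner_Integration.integrable_bound)
  show "integrable std_gauss (\<lambda>z. exp (z \<bullet> w) + exp (z \<bullet> (- w)))"
    by (intro Bochner_Integration.integrable_add std_gauss_mgf)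
qed (auto intro!: AE_I2 order.trans[OF exp_abs_le_sum])

text \<open>A single term of the exponential series; it lets exponential integrability dominate
  every polynomial moment.\<close>

lemma power_le_fact_exp: "x ^ n \<le> fact n * exp x" if "x \<ge> 0" for x :: real
proof -
  have s: "(\<lambda>k. x ^ k /\<^sub>R fact k) sums exp x" by (rule exp_converges)
  have "(\<Sum>k\<in>{n}. x ^ k /\<^sub>R fact k) \<le> exp x"
    using s that by (intro sum_le_suminf[of _ "{n}", THEN order.trans]) (auto simp: sums_iff)
  then show ?thesis by (simp add: field_simps)
qed

lemma std_gauss_norm_power_integrable:
  "integrable (std_gauss :: 'a::euclidean_space measure) (\<lambda>z. norm z ^ n)"
proof -
  have b: "integrable (std_gauss :: 'a measure) (\<lambda>z. \<bar>z \<bullet> b\<bar> ^ n)" for b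
  proof (rule Bochner_Integration.integrable_bound)
    show "integrable (std_gauss :: 'a measure) (\<lambda>z. fact n * exp \<bar>z \<bullet> b\<bar>)"
      by (intro integrable_mult_right std_gauss_exp_abs_integrable)
  qed (auto intro!: AE_I2 power_le_fact_exp)
  have le: "norm z ^ n \<le> (\<Sum>b\<in>Basis. real DIM('a) ^ n * \<bar>z \<bullet> b\<bar> ^ n)" for z :: 'a
  proof -
    have fin: "finite ((\<lambda>b. \<bar>z \<bullet> b\<bar>) ` Basis)" "(\<lambda>b. \<bar>z \<bullet> b\<bar>) ` Basis \<noteq> {}" by auto
    \<comment> \<open>Comparing all coordinates with the largest one avoids expanding the
      \<open>n\<close>-th power of their sum.\<close>
    obtain c :: 'a where c: "c \<in> Basis" "\<And>b. b \<in> Basis \<Longrightarrow> \<bar>z \<bullet> b\<bar> \<le> \<bar>z \<bullet> c\<bar>"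
    proof -
      obtain c :: 'a where "c \<in> Basis" "Max ((\<lambda>b. \<bar>z \<bullet> b\<bar>) ` Basis) = \<bar>z \<bullet> c\<bar>"
        using Max_in[OF fin] by blast
      moreover have "\<bar>z \<bullet> b\<bar> \<le> Max ((\<lambda>b. \<bar>z \<bullet> b\<bar>) ` Basis)" if "b \<in> Basis" for b
        using that by (intro Max_ge[OF fin(1)]) auto
      ultimately show ?thesis using that by auto
    qed
    have "norm z \<le> (\<Sum>b\<in>Basis. \<bar>z \<bullet> b\<bar>)" by (rule norm_le_l1)
    also have "\<dots> \<le> real DIM('a) * \<bar>z \<bullet> c\<bar>" using c(2) by (intro sum_bounded_above) auto
    finally have "norm z ^ n \<le> (real DIM('a) * \<bar>z \<bullet> c\<bar>) ^ n" by (intro power_mono) auto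
    also have "\<dots> = real DIM('a) ^ n * \<bar>z \<bullet> c\<bar> ^ n" by (simp add: power_mult_distrib)
    also have "\<dots> \<le> (\<Sum>b\<in>Basis. real DIM('a) ^ n * \<bar>z \<bullet> b\<bar> ^ n)"
      using c(1) by (intro member_le_sum) auto
    finally show ?thesis .
  qed
  show ?thesis
  proof (rule Bochner_Integration.integrable_bound)
    show "integrable (std_gauss :: 'a measure) (\<lambda>z. \<Sum>b\<in>Basis. real DIM('a) ^ n * \<bar>z \<bullet> b\<bar> ^ n)"
      by (intro Bochner_Integration.integrable_sum integrable_mult_right b)
  qed (auto intro!: AE_I2 order.trans[OF le])
qed

lemma std_gauss_id_integrable [simp]: "integrable (std_gauss :: 'a::euclidean_space measure) (\<lambda>z. z)"
  using std_gauss_norm_power_integrable[where n=1 and 'a='a]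
  by (subst integrable_norm_iff[symmetric]) auto

lemma std_gauss_inner_sq_integrable [simp]:
  fixes w :: "'a::euclidean_space"
  shows "integrable std_gauss (\<lambda>z. (z \<bullet> w)\<^sup>2)"
proof (rule Bochner_Integration.integrable_bound)
  show "integrable std_gauss (\<lambda>z::'a. (norm w)\<^sup>2 * norm z ^ 2)"
    by (intro integrable_mult_right std_gauss_norm_power_integrable)
  show "AE z in std_gauss. norm ((z \<bullet> w)\<^sup>2) \<le> norm ((norm w)\<^sup>2 * norm z ^ 2)"
    by (auto intro!: AE_I2 simp: power_mult_distrib[symmetric] mult.commute abs_le_square_iff[symmetric]
        Cauchy_Schwarz_ineq2)
qed auto

lemma std_gauss_inner_mean [simp]:
  fixes w :: "'a::euclidean_space"
  shows "(\<integral>z. z \<bullet> w \<partial>std_gauss) = 0"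
proof -
  have "(\<integral>z. z \<bullet> w \<partial>std_gauss) = (\<integral>z. z \<bullet> w \<partial>distr (std_gauss :: 'a measure) borel uminus)"
    by (simp add: distr_std_gauss_uminus)
  also have "\<dots> = - (\<integral>z. z \<bullet> w \<partial>std_gauss)"
    by (subst integral_distr) auto
  finally show ?thesis by simp
qed

lemma cosh_ge_quadratic: "1 + x\<^sup>2 / 2 \<le> cosh x" for x :: real
proof -
  have "(\<lambda>n. if even n then x ^ n /\<^sub>R fact n else 0) sums cosh x" by (rule cosh_converges)
  then have "(\<Sum>n\<in>{0,2}. if even n then x ^ n /\<^sub>R fact n else 0) \<le> cosh x"
    by (intro sum_le_suminf[of _ "{0,2}", THEN order.trans]) (auto simp: sums_iff zero_le_even_power)
  then show ?thesis by (simp add: field_simps)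
qed

text \<open>An upper bound suffices later, and the exponential moments give it without evaluating
  another Gaussian integral: \<open>cosh y \<ge> 1 + y^2 / 2\<close> is applied to the direction
  scaled by \<open>sqrt e\<close>, and after division by \<open>e\<close> only the second-order term
  survives as \<open>e\<close> tends to zero.\<close>

lemma std_gauss_inner_variance_le:
  fixes w :: "'a::euclidean_space"
  shows "(\<integral>z. (z \<bullet> w)\<^sup>2 \<partial>std_gauss) \<le> (norm w)\<^sup>2"
proof -
  define V where "V = (\<integral>z. (z \<bullet> w)\<^sup>2 \<partial>std_gauss)"
  have ineq: "V * e \<le> 2 * (exp (e * (norm w)\<^sup>2 / 2) - 1)" if "e > 0" for e :: real
  proof -
    define v where "v = sqrt e *\<^sub>R w"
    have nv: "(norm v)\<^sup>2 = e * (norm w)\<^sup>2" using that by (simp add: v_def power_mult_distrib)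
    have "(\<integral>z. 1 + (z \<bullet> v)\<^sup>2 / 2 \<partial>std_gauss) \<le> (\<integral>z. (exp (z \<bullet> v) + exp (z \<bullet> (- v))) / 2 \<partial>std_gauss)"
    proof (rule integral_mono)
      show "1 + (z \<bullet> v)\<^sup>2 / 2 \<le> (exp (z \<bullet> v) + exp (z \<bullet> (- v))) / 2" for z
        using cosh_ge_quadratic[of "z \<bullet> v"] by (simp add: cosh_def field_simps)
    qed (auto intro!: Bochner_Integration.integrable_add std_gauss_mgf integrable_divide simp del: inner_minus_right)
    also have "\<dots> = exp ((norm v)\<^sup>2 / 2)"
      by (subst integral_divide_zero, subst Bochner_Integration.integral_add)
         (simp_all add: std_gauss_mgf del: inner_minus_right)
    also have "(\<integral>z. 1 + (z \<bullet> v)\<^sup>2 / 2 \<partial>std_gauss) = 1 + e * V / 2"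
      using that by (simp add: v_def power_mult_distrib V_def)
    finally show ?thesis by (simp add: nv field_simps)
  qed
  define c where "c = (norm w)\<^sup>2 / 2"
  have "((\<lambda>e. 2 * ((exp (e * c) - 1) / e)) \<longlongrightarrow> 2 * c) (at_right 0)"
  proof -
    have "((\<lambda>e. exp (e * c)) has_real_derivative c) (at 0)"
      by (auto intro!: derivative_eq_intros)
    then have "((\<lambda>e. (exp (e * c) - 1) / e) \<longlongrightarrow> c) (at 0)"
      by (simp add: has_field_derivative_iff)
    then have "((\<lambda>e. (exp (e * c) - 1) / e) \<longlongrightarrow> c) (at_right 0)"
      by (rule filterlim_mono) (auto simp: at_within_le_at)
    then show ?thesis by (rule tendsto_mult_left)
  qed
  moreover have "eventually (\<lambda>e. V \<le> 2 * ((exp (e * c) - 1) / e)) (at_right 0)"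
    using eventually_at_right_less[of 0]
    by eventually_elim (use ineq in \<open>auto simp: c_def field_simps\<close>)
  ultimately have "V \<le> 2 * c" by (intro tendsto_lowerbound) auto
  then show ?thesis by (simp add: V_def c_def)
qed

section \<open>Gaussian smoothing\<close>

lemma (in prob_space) square_expectation_le:
  fixes f :: "'a \<Rightarrow> real"
  assumes "integrable M f" "integrable M (\<lambda>x. (f x)\<^sup>2)"
  shows "(expectation f)\<^sup>2 \<le> expectation (\<lambda>x. (f x)\<^sup>2)"
  using variance_eq[OF assms] variance_positive[of f] by simp

lemma (in prob_space) integrable_bounded:
  fixes f :: "'a \<Rightarrow> real"
  assumes "f \<in> borel_measurable M" "\<And>x. \<bar>f x\<bar> \<le> C"
  shows "integrable M f"
  using assms by (intro integrable_const_bound[where B=C]) auto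

text \<open>After a translation the increment of a smoothed function falls on the density alone, so
  differentiability comes down to the first-order Taylor remainder of the density in
  \<open>L^2\<close>. Its square expands into explicit moments of the tilt.\<close>

lemma tilt_remainder_second_moment:
  fixes w :: "'a::euclidean_space"
  shows "integrable std_gauss (\<lambda>z. (gauss_tilt w z - 1 - z \<bullet> w)\<^sup>2)"
    and "(\<integral>z. (gauss_tilt w z - 1 - z \<bullet> w)\<^sup>2 \<partial>std_gauss) \<le> exp ((norm w)\<^sup>2) - 1 - (norm w)\<^sup>2"
proof -
  have sq: "(gauss_tilt w z)\<^sup>2 = exp ((norm w)\<^sup>2) * gauss_tilt (2 *\<^sub>R w) z" for z
    by (simp add: gauss_tilt_def exp_double[symmetric] exp_add[symmetric] power_mult_distrib field_simps)
  have i1: "integrable std_gauss (\<lambda>z. gauss_tilt w z * (z \<bullet> w))"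
    using integral_std_gauss_shift(2)[of "\<lambda>z. z \<bullet> w" w] by (simp add: inner_add_left)
  have e1: "(\<integral>z. gauss_tilt w z * (z \<bullet> w) \<partial>std_gauss) = (norm w)\<^sup>2"
    using integral_std_gauss_shift(1)[of "\<lambda>z. z \<bullet> w" w]
    by (simp add: inner_add_left power2_norm_eq_inner)
  have ex: "(gauss_tilt w z - 1 - z \<bullet> w)\<^sup>2
      = exp ((norm w)\<^sup>2) * gauss_tilt (2 *\<^sub>R w) z + 1 + (z \<bullet> w)\<^sup>2 - 2 * gauss_tilt w z
        - 2 * (gauss_tilt w z * (z \<bullet> w)) + 2 * (z \<bullet> w)" for z
    unfolding sq[symmetric] by (simp add: power2_eq_square algebra_simps)
  show "integrable std_gauss (\<lambda>z. (gauss_tilt w z - 1 - z \<bullet> w)\<^sup>2)"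
    unfolding ex using i1 by simp
  have "(\<integral>z. (gauss_tilt w z - 1 - z \<bullet> w)\<^sup>2 \<partial>std_gauss)
      = exp ((norm w)\<^sup>2) + 1 + (\<integral>z. (z \<bullet> w)\<^sup>2 \<partial>std_gauss) - 2 - 2 * (norm w)\<^sup>2"
    unfolding ex using i1 e1 by simp
  then show "(\<integral>z. (gauss_tilt w z - 1 - z \<bullet> w)\<^sup>2 \<partial>std_gauss) \<le> exp ((norm w)\<^sup>2) - 1 - (norm w)\<^sup>2"
    using std_gauss_inner_variance_le[of w] by simp
qed

lemma integral_gauss_translate:
  fixes G :: "'a::euclidean_space \<Rightarrow> real"
  assumes "\<sigma> \<noteq> 0" and [measurable]: "G \<in> borel_measurable borel"
  shows "(\<integral>z. G (x + v + \<sigma> *\<^sub>R z) \<partial>std_gauss)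
      = (\<integral>z. gauss_tilt (v /\<^sub>R \<sigma>) z * G (x + \<sigma> *\<^sub>R z) \<partial>std_gauss)"
  using integral_std_gauss_shift(1)[of "\<lambda>z. G (x + \<sigma> *\<^sub>R z)" "v /\<^sub>R \<sigma>"] assms(1)
  by (simp add: algebra_simps)

lemma gauss_vector_integrable:
  fixes G :: "'a::euclidean_space \<Rightarrow> real"
  assumes [measurable]: "G \<in> borel_measurable borel" and "\<And>x. \<bar>G x\<bar> \<le> C"
  shows "integrable std_gauss (\<lambda>z. G z *\<^sub>R z)"
proof (rule Bochner_Integration.integrable_bound)
  show "integrable std_gauss (\<lambda>z::'a. C * norm z ^ 1)"
    by (intro integrable_mult_right std_gauss_norm_power_integrable)
  have "0 \<le> C" using assms(2)[of 0] by linarith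
  then show "AE z in std_gauss. norm (G z *\<^sub>R z) \<le> norm (C * norm z ^ 1)"
    using assms(2) by (auto intro!: AE_I2 mult_right_mono simp: abs_mult)
qed auto

text \<open>The derivative is moved from \<open>G\<close> to the Gaussian density, so
  \<open>G\<close> need only be bounded and measurable; the remainder is quadratic in
  \<open>v\<close>.\<close>

lemma gauss_smoothing_has_derivative:
  fixes G :: "'a::euclidean_space \<Rightarrow> real"
  assumes "\<sigma> > 0" and [measurable]: "G \<in> borel_measurable borel" and bd: "\<And>x. \<bar>G x\<bar> \<le> C"
  shows "((\<lambda>x. \<integral>z. G (x + \<sigma> *\<^sub>R z) \<partial>std_gauss) has_derivative
      (\<lambda>v. ((\<integral>z. G (x + \<sigma> *\<^sub>R z) *\<^sub>R z \<partial>std_gauss) /\<^sub>R \<sigma>) \<bullet> v)) (at x)"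
proof -
  let ?F = "\<lambda>x. \<integral>z. G (x + \<sigma> *\<^sub>R z) \<partial>std_gauss"
  let ?D = "\<lambda>v. ((\<integral>z. G (x + \<sigma> *\<^sub>R z) *\<^sub>R z \<partial>std_gauss) /\<^sub>R \<sigma>) \<bullet> v"
  have C: "0 \<le> C" using bd[of 0] by linarith
  have rem: "\<bar>?F (x + v) - ?F x - ?D v\<bar> \<le> C / \<sigma>\<^sup>2 * (norm v)\<^sup>2" if v: "norm v \<le> \<sigma>" for v
  proof -
    define w where "w = v /\<^sub>R \<sigma>"
    define R where "R = (\<lambda>z. gauss_tilt w z - 1 - z \<bullet> w)"
    have nw: "norm w = norm v / \<sigma>" "norm w \<le> 1" using assms(1) v by (auto simp: w_def divide_simps)
    have iv: "integrable std_gauss (\<lambda>z. G (x + \<sigma> *\<^sub>R z) *\<^sub>R z)"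
      by (intro gauss_vector_integrable[where C=C] bd) auto
    have ig: "integrable std_gauss (\<lambda>z. G (x + \<sigma> *\<^sub>R z))"
      by (intro std_gauss.integrable_bounded[where C=C] bd) auto
    have it: "integrable std_gauss (\<lambda>z. gauss_tilt w z * G (x + \<sigma> *\<^sub>R z))"
    proof (rule Bochner_Integration.integrable_bound)
      show "integrable std_gauss (\<lambda>z. C * gauss_tilt w z)" by simp
      show "AE z in std_gauss. norm (gauss_tilt w z * G (x + \<sigma> *\<^sub>R z)) \<le> norm (C * gauss_tilt w z)"
        using bd C by (auto intro!: AE_I2 mult_right_mono simp: abs_mult mult.commute abs_of_pos)
    qed auto
    have Dv: "?D v = (\<integral>z. G (x + \<sigma> *\<^sub>R z) * (z \<bullet> w) \<partial>std_gauss)"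
    proof -
      have "?D v = (\<integral>z. G (x + \<sigma> *\<^sub>R z) *\<^sub>R z \<partial>std_gauss) \<bullet> w" by (simp add: w_def)
      also have "\<dots> = (\<integral>z. (G (x + \<sigma> *\<^sub>R z) *\<^sub>R z) \<bullet> w \<partial>std_gauss)"
        using iv by (subst integral_inner_left) auto
      finally show ?thesis by simp
    qed
    have id: "integrable std_gauss (\<lambda>z. G (x + \<sigma> *\<^sub>R z) * (z \<bullet> w))"
      using integrable_inner_left[of w, OF iv] by simp
    have "?F (x + v) - ?F x - ?D v = (\<integral>z. R z * G (x + \<sigma> *\<^sub>R z) \<partial>std_gauss)"
    proof -
      have "?F (x + v) = (\<integral>z. gauss_tilt w z * G (x + \<sigma> *\<^sub>R z) \<partial>std_gauss)"
        unfolding w_def using assms(1) by (intro integral_gauss_translate) auto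
      then show ?thesis
        unfolding Dv R_def using it ig id by (simp add: left_diff_distrib mult.commute[of "_ \<bullet> _"])
    qed
    also have "\<bar>\<dots>\<bar> \<le> (\<integral>z. C * \<bar>R z\<bar> \<partial>std_gauss)"
    proof (rule order.trans[OF integral_abs_bound], rule integral_mono)
      show "integrable std_gauss (\<lambda>z. \<bar>R z * G (x + \<sigma> *\<^sub>R z)\<bar>)"
        unfolding R_def using it ig id by (intro integrable_abs) (simp add: algebra_simps)
      show "integrable std_gauss (\<lambda>z. C * \<bar>R z\<bar>)"
        unfolding R_def by simp
      show "\<bar>R z * G (x + \<sigma> *\<^sub>R z)\<bar> \<le> C * \<bar>R z\<bar>" for z
        using mult_right_mono[OF bd[of "x + \<sigma> *\<^sub>R z"], of "\<bar>R z\<bar>"] by (simp add: abs_mult mult.commute)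
    qed
    also have "\<dots> = C * (\<integral>z. \<bar>R z\<bar> \<partial>std_gauss)" by simp
    \<comment> \<open>Cauchy-Schwarz passes to the second moment. There
      \<open>norm w \<le> 1\<close>, the reason for restricting to
      \<open>norm v \<le> \<sigma>\<close>, permits \<open>exp y - 1 - y \<le> y^2\<close> at
      \<open>y = (norm w)^2\<close>.\<close>
    also have "(\<integral>z. \<bar>R z\<bar> \<partial>std_gauss) \<le> (norm w)\<^sup>2"
    proof (rule power2_le_imp_le)
      have "(\<integral>z. \<bar>R z\<bar> \<partial>std_gauss)\<^sup>2 \<le> (\<integral>z. \<bar>R z\<bar>\<^sup>2 \<partial>std_gauss)"
        using tilt_remainder_second_moment(1)[of w]
        by (intro std_gauss.square_expectation_le) (auto simp: R_def)
      also have "\<dots> \<le> exp ((norm w)\<^sup>2) - 1 - (norm w)\<^sup>2"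
        using tilt_remainder_second_moment(2)[of w] by (simp add: R_def)
      also have "\<dots> \<le> ((norm w)\<^sup>2)\<^sup>2"
        using exp_bound[of "(norm w)\<^sup>2"] nw(2) by (simp add: power_le_one)
      finally show "(\<integral>z. \<bar>R z\<bar> \<partial>std_gauss)\<^sup>2 \<le> ((norm w)\<^sup>2)\<^sup>2" .
    qed auto
    finally show ?thesis using C by (simp add: nw power_divide mult_left_mono)
  qed
  show ?thesis
    unfolding has_derivative_at_alt
  proof safe
    show "bounded_linear ?D" by (rule bounded_linear_inner_right)
    fix e :: real assume e: "e > 0"
    \<comment> \<open>\<open>C + 1\<close> instead of \<open>C\<close> keeps the radius positive
      when \<open>C = 0\<close>.\<close>
    define d where "d = min \<sigma> (e * \<sigma>\<^sup>2 / (C + 1))"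
    have d: "d > 0" using e C assms(1) by (auto simp: d_def intro!: divide_pos_pos)
    have "norm (?F y - ?F x - ?D (y - x)) \<le> e * norm (y - x)" if y: "norm (y - x) < d" for y
    proof -
      have "norm (?F y - ?F x - ?D (y - x)) \<le> C / \<sigma>\<^sup>2 * (norm (y - x))\<^sup>2"
        using rem[of "y - x"] y by (auto simp: d_def)
      also have "\<dots> = (C / \<sigma>\<^sup>2 * norm (y - x)) * norm (y - x)" by (simp add: power2_eq_square)
      also have "\<dots> \<le> e * norm (y - x)"
      proof (rule mult_right_mono)
        have "C / \<sigma>\<^sup>2 * norm (y - x) \<le> C / \<sigma>\<^sup>2 * (e * \<sigma>\<^sup>2 / (C + 1))"
          using y C by (intro mult_left_mono) (auto simp: d_def)
        also have "\<dots> = e * (C / (C + 1))" using assms(1) by simp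
        also have "\<dots> \<le> e * 1" using e C by (intro mult_left_mono) (auto simp: field_simps)
        finally show "C / \<sigma>\<^sup>2 * norm (y - x) \<le> e" by simp
      qed auto
      finally show ?thesis .
    qed
    then show "\<exists>d>0. \<forall>y. norm (y - x) < d \<longrightarrow> norm (?F y - ?F x - ?D (y - x)) \<le> e * norm (y - x)"
      using d by blast
  qed
qed

text \<open>\<open>log_sobolev\<close> speaks only about densities with a continuous gradient. For
  Lipschitz \<open>G\<close> the integral representing the gradient is itself Lipschitz, with
  constant \<open>L\<close> times the first absolute moment of the Gaussian.\<close>

lemma gauss_smoothing_gradient_continuous:
  fixes G :: "'a::euclidean_space \<Rightarrow> real"
  assumes lip: "L-lipschitz_on UNIV G" and bd: "\<And>x. \<bar>G x\<bar> \<le> C"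
  shows "continuous_on UNIV (\<lambda>x. \<integral>z. G (x + \<sigma> *\<^sub>R z) *\<^sub>R z \<partial>std_gauss)"
proof -
  have [measurable]: "G \<in> borel_measurable borel"
    using lipschitz_on_continuous_on[OF lip] by (rule borel_measurable_continuous_onI)
  have L: "0 \<le> L" using lip by (rule lipschitz_on_nonneg)
  define K where "K = L * (\<integral>z. norm (z::'a) \<partial>std_gauss)"
  have i: "integrable std_gauss (\<lambda>z. G (x + \<sigma> *\<^sub>R z) *\<^sub>R z)" for x
    by (intro gauss_vector_integrable[where C=C] bd) auto
  have n: "integrable std_gauss (\<lambda>z::'a. norm z)"
    using std_gauss_norm_power_integrable[where n=1 and 'a='a] by simp
  have "K-lipschitz_on UNIV (\<lambda>x. \<integral>z. G (x + \<sigma> *\<^sub>R z) *\<^sub>R z \<partial>std_gauss)"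
  proof (rule lipschitz_onI)
    show "0 \<le> K" using L by (simp add: K_def)
    fix x y
    have "dist (\<integral>z. G (x + \<sigma> *\<^sub>R z) *\<^sub>R z \<partial>std_gauss) (\<integral>z. G (y + \<sigma> *\<^sub>R z) *\<^sub>R z \<partial>std_gauss)
        = norm (\<integral>z. (G (x + \<sigma> *\<^sub>R z) - G (y + \<sigma> *\<^sub>R z)) *\<^sub>R z \<partial>std_gauss)"
      unfolding dist_norm using i by (subst Bochner_Integration.integral_diff[symmetric]) (auto simp: algebra_simps)
    also have "\<dots> \<le> (\<integral>z. L * dist x y * norm (z::'a) \<partial>std_gauss)"
    proof (rule order.trans, rule Bochner_Integration.integral_norm_bound, rule integral_mono)
      show "integrable std_gauss (\<lambda>z. norm ((G (x + \<sigma> *\<^sub>R z) - G (y + \<sigma> *\<^sub>R z)) *\<^sub>R z))"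
        using i by (intro integrable_norm) (simp add: scaleR_diff_left)
      show "norm ((G (x + \<sigma> *\<^sub>R z) - G (y + \<sigma> *\<^sub>R z)) *\<^sub>R z) \<le> L * dist x y * norm z" for z
        using lipschitz_onD[OF lip, of "x + \<sigma> *\<^sub>R z" "y + \<sigma> *\<^sub>R z"]
        by (auto simp: dist_real_def intro!: mult_right_mono)
    qed (use n in simp)
    also have "\<dots> = K * dist x y" by (simp add: K_def)
    finally show "dist (\<integral>z. G (x + \<sigma> *\<^sub>R z) *\<^sub>R z \<partial>std_gauss) (\<integral>z. G (y + \<sigma> *\<^sub>R z) *\<^sub>R z \<partial>std_gauss)
        \<le> K * dist x y" .
  qed
  then show ?thesis by (rule lipschitz_on_continuous_on)
qed

text \<open>Bessel's inequality for the coordinate functions, which are orthogonal to the constants.\<close>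

lemma gauss_bessel:
  fixes G :: "'a::euclidean_space \<Rightarrow> real"
  assumes [measurable]: "G \<in> borel_measurable borel" and bd: "\<And>x. \<bar>G x\<bar> \<le> C"
  shows "(norm (\<integral>z. G z *\<^sub>R z \<partial>std_gauss))\<^sup>2 \<le> (\<integral>z. (G z)\<^sup>2 \<partial>std_gauss) - (\<integral>z. G z \<partial>std_gauss)\<^sup>2"
proof -
  define v where "v = (\<integral>z. G z *\<^sub>R z \<partial>std_gauss)"
  define g where "g = (\<integral>z. G z \<partial>std_gauss)"
  have C: "0 \<le> C" using bd[of 0] by linarith
  have iG: "integrable std_gauss G" by (intro std_gauss.integrable_bounded[where C=C] bd) auto
  have iG2: "integrable std_gauss (\<lambda>z. (G z)\<^sup>2)"
    using bd C by (intro std_gauss.integrable_bounded[where C="C\<^sup>2"]) (auto simp: abs_le_square_iff[symmetric])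
  have iv: "integrable std_gauss (\<lambda>z. G z *\<^sub>R z)" by (intro gauss_vector_integrable[where C=C] bd) auto
  have iz: "integrable std_gauss (\<lambda>z. G z * (z \<bullet> v))"
    using integrable_inner_left[of v, OF iv] by simp
  have ez: "(\<integral>z. G z * (z \<bullet> v) \<partial>std_gauss) = (norm v)\<^sup>2"
  proof -
    have "(\<integral>z. G z * (z \<bullet> v) \<partial>std_gauss) = (\<integral>z. (G z *\<^sub>R z) \<bullet> v \<partial>std_gauss)" by simp
    also have "\<dots> = v \<bullet> v" unfolding v_def using iv by (subst integral_inner_left) auto
    finally show ?thesis by (simp add: power2_norm_eq_inner)
  qed
  \<comment> \<open>The test direction is the coefficient vector \<open>v\<close> itself, so the
    cross term integrates to \<open>(norm v)^2\<close> and an upper bound for the variance of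
    \<open>z \<bullet> v\<close> is enough.\<close>
  have ex: "((G z - g) - z \<bullet> v)\<^sup>2 = (G z)\<^sup>2 + g\<^sup>2 + (z \<bullet> v)\<^sup>2 - 2 * g * G z - 2 * (G z * (z \<bullet> v)) + 2 * g * (z \<bullet> v)" for z
    by (simp add: power2_eq_square algebra_simps)
  have "0 \<le> (\<integral>z. ((G z - g) - z \<bullet> v)\<^sup>2 \<partial>std_gauss)" by simp
  also have "\<dots> = (\<integral>z. (G z)\<^sup>2 \<partial>std_gauss) + g\<^sup>2 + (\<integral>z. (z \<bullet> v)\<^sup>2 \<partial>std_gauss) - 2 * g * g - 2 * (norm v)\<^sup>2"
    unfolding ex using iG iG2 iz ez by (simp add: g_def[symmetric])
  finally have "(norm v)\<^sup>2 \<le> (\<integral>z. (G z)\<^sup>2 \<partial>std_gauss) - g\<^sup>2"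
    using std_gauss_inner_variance_le[of v] by (simp add: power2_eq_square)
  then show ?thesis by (simp add: v_def g_def)
qed

text \<open>Holder's inequality between \<open>G\<close> and the Cameron-Martin density of the shift
  \<open>(a - b) / \<sigma>\<close>, whose \<open>L^q\<close> norm is explicit. It is carried out
  through Young's inequality with an optimal weight; the lower bound \<open>\<epsilon>\<close> makes
  the integral on the left positive, which that weight needs.\<close>

lemma gauss_harnack:
  fixes G :: "'a::euclidean_space \<Rightarrow> real"
  assumes p: "p > 1" and \<sigma>: "\<sigma> > 0" and e: "\<epsilon> > 0"
    and [measurable]: "G \<in> borel_measurable borel" and bd: "\<And>x. \<epsilon> \<le> G x" "\<And>x. G x \<le> 1"
  shows "(\<integral>z. G (a + \<sigma> *\<^sub>R z) \<partial>std_gauss) powr p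
     \<le> (\<integral>z. G (b + \<sigma> *\<^sub>R z) powr p \<partial>std_gauss) * exp (p / (p - 1) * ((norm (a - b))\<^sup>2 / (2 * \<sigma>\<^sup>2)))"
proof -
  define w where "w = (a - b) /\<^sub>R \<sigma>"
  define q where "q = p / (p - 1)"
  have q: "q > 1" "1 / p + 1 / q = 1" "(p - 1) * q = p" "p > 0"
    using p by (auto simp: q_def field_simps)
  define H where "H = (\<lambda>z. G (b + \<sigma> *\<^sub>R z))"
  have [measurable]: "H \<in> borel_measurable borel" by (simp add: H_def)
  have H: "\<epsilon> \<le> H z" "H z \<le> 1" "0 < H z" for z
    using bd[of "b + \<sigma> *\<^sub>R z"] e by (auto simp: H_def)
  define I where "I = (\<integral>z. gauss_tilt w z * H z \<partial>std_gauss)"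
  \<comment> \<open>The \<open>q\<close>-th moment of the tilt. Since
    \<open>(p - 1) * (q - 1) = 1\<close>, the power \<open>Z powr (p - 1)\<close> has the exponent
    \<open>q * (norm w)^2 / 2\<close>.\<close>
  define Z where "Z = exp (q * (q - 1) * (norm w)\<^sup>2 / 2)"
  define A where "A = (\<integral>z. H z powr p \<partial>std_gauss)"
  have Z: "Z > 0" by (simp add: Z_def)
  have I_eq: "(\<integral>z. G (a + \<sigma> *\<^sub>R z) \<partial>std_gauss) = I"
    using integral_gauss_translate[of \<sigma> G b "a - b"] \<sigma> by (simp add: I_def w_def H_def)
  have "\<epsilon> \<le> (\<integral>z. G (a + \<sigma> *\<^sub>R z) \<partial>std_gauss)"
  proof -
    have "(\<integral>z. \<epsilon> \<partial>(std_gauss::'a measure)) \<le> (\<integral>z. G (a + \<sigma> *\<^sub>R z) \<partial>std_gauss)"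
      using e bd order.trans[OF less_imp_le[OF e] bd(1)] order.trans[OF bd(1) bd(2)]
      by (intro integral_mono std_gauss.integrable_bounded[where C=1]) auto
    then show ?thesis by simp
  qed
  then have I: "I > 0" using I_eq e by simp
  have iI: "integrable std_gauss (\<lambda>z. gauss_tilt w z * H z)"
  proof (rule Bochner_Integration.integrable_bound)
    show "integrable std_gauss (gauss_tilt w)" by simp
    show "AE z in std_gauss. norm (gauss_tilt w z * H z) \<le> norm (gauss_tilt w z)"
      using H by (auto intro!: AE_I2 mult_left_le simp: abs_mult less_imp_le abs_of_pos)
  qed auto
  have iA: "integrable std_gauss (\<lambda>z. H z powr p)"
    using H q by (intro std_gauss.integrable_bounded[where C=1]) (auto intro!: powr_le1 simp: less_imp_le)
  have tq: "gauss_tilt w z powr q = Z * gauss_tilt (q *\<^sub>R w) z" for z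
    by (simp add: gauss_tilt_def Z_def powr_def exp_add[symmetric] power_mult_distrib)
       (simp add: field_simps power2_eq_square)
  \<comment> \<open>The weight that balances Young's inequality: it gives
    \<open>\<kappa> powr q * Z = \<kappa> * I\<close>, so the second term can be absorbed on the
    left.\<close>
  define \<kappa> where "\<kappa> = (I / Z) powr (p - 1)"
  have \<kappa>: "\<kappa> > 0" using I Z by (simp add: \<kappa>_def)
  have \<kappa>q: "\<kappa> powr q = (I / Z) powr p" using q by (simp add: \<kappa>_def powr_powr)
  have "\<kappa> * I = (\<integral>z. H z * (\<kappa> * gauss_tilt w z) \<partial>std_gauss)"
    by (simp add: I_def mult_ac flip: integral_mult_right_zero)
  also have "\<dots> \<le> (\<integral>z. H z powr p / p + \<kappa> powr q * Z * gauss_tilt (q *\<^sub>R w) z / q \<partial>std_gauss)"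
  proof (rule integral_mono)
    show "integrable std_gauss (\<lambda>z. H z * (\<kappa> * gauss_tilt w z))"
      using integrable_mult_right[OF iI, of \<kappa>] by (simp add: mult_ac)
    show "integrable std_gauss (\<lambda>z. H z powr p / p + \<kappa> powr q * Z * gauss_tilt (q *\<^sub>R w) z / q)"
      using iA by simp
    show "H z * (\<kappa> * gauss_tilt w z) \<le> H z powr p / p + \<kappa> powr q * Z * gauss_tilt (q *\<^sub>R w) z / q" for z
      using Youngs_inequality[of p q "H z" "\<kappa> * gauss_tilt w z"] p q H(3)[of z] \<kappa>
      by (simp add: powr_mult tq less_imp_le mult.assoc)
  qed
  also have "\<dots> = A / p + \<kappa> powr q * Z / q"
    using iA by (simp add: A_def)
  also have "\<kappa> powr q * Z = \<kappa> * I"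
    unfolding \<kappa>q using I Z p by (simp add: \<kappa>_def powr_diff)
  finally have "\<kappa> * I * (1 / p + 1 / q) \<le> A / p + \<kappa> * I / q" using q(2) by simp
  then have "\<kappa> * I / p \<le> A / p" by (simp add: algebra_simps)
  then have "\<kappa> * I \<le> A" using q(4) by (simp add: divide_le_cancel)
  then have "(I / Z) powr (p - 1) * I \<le> A" by (simp add: \<kappa>_def)
  then have "I powr p / Z powr (p - 1) \<le> A"
    using I Z by (simp add: powr_divide powr_diff)
  then have "I powr p \<le> A * Z powr (p - 1)" using Z by (simp add: field_simps)
  also have "Z powr (p - 1) = exp (p / (p - 1) * ((norm (a - b))\<^sup>2 / (2 * \<sigma>\<^sup>2)))"
  proof -
    have "(p - 1) * (q - 1) = 1" using q p by (simp add: algebra_simps)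
    then have "(p - 1) * (q * (q - 1) * (norm w)\<^sup>2 / 2) = q * ((norm w)\<^sup>2 / 2)"
      by (simp add: mult.left_commute[of "p - 1"] mult.assoc[symmetric])
    moreover have "(norm w)\<^sup>2 = (norm (a - b))\<^sup>2 / \<sigma>\<^sup>2"
      by (simp add: w_def power_mult_distrib power_inverse divide_inverse mult.commute)
    moreover have "Z powr (p - 1) = exp ((p - 1) * (q * (q - 1) * (norm w)\<^sup>2 / 2))"
      by (simp add: Z_def powr_def)
    ultimately show ?thesis
      by (simp add: q_def mult.commute)
  qed
  finally show ?thesis unfolding I_eq A_def H_def .
qed

section \<open>Consequences of the log-Sobolev inequality\<close>

text \<open>Entropy without normalisation of \<open>w\<close>, so that it applies directly to
  squares and powers of test functions.\<close>

definition Ent :: "'b measure \<Rightarrow> ('b \<Rightarrow> real) \<Rightarrow> real" where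
  "Ent M w = (\<integral>x. w x * ln (w x) \<partial>M) - (\<integral>x. w x \<partial>M) * ln (\<integral>x. w x \<partial>M)"

text \<open>Convexity of \<open>q \<mapsto> ln (\<integral> exp (q v))\<close>, read through the tangent at the larger exponent.\<close>

lemma (in prob_space) log_moment_tangent:
  fixes v :: "'a \<Rightarrow> real"
  assumes [measurable]: "v \<in> borel_measurable M" and bd: "\<And>x. \<bar>v x\<bar> \<le> C" and q: "0 < q" "0 < q'"
  shows "ln (\<integral>x. exp (q' * v x) \<partial>M) / q' \<le> ln (\<integral>x. exp (q * v x) \<partial>M) / q
     + (q' - q) / (q * q') * (Ent M (\<lambda>x. exp (q' * v x)) / (\<integral>x. exp (q' * v x) \<partial>M))"
proof -
  have C: "0 \<le> C" using bd[of undefined] by linarith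
  have iexp: "integrable M (\<lambda>x. exp (c * v x))" for c
  proof (rule integrable_bounded)
    have "c * v x \<le> \<bar>c\<bar> * C" for x
      using mult_mono[of "\<bar>c\<bar>" "\<bar>c\<bar>" "\<bar>v x\<bar>" C] bd[of x] by (simp add: abs_mult[symmetric])
    then show "\<bar>exp (c * v x)\<bar> \<le> exp (\<bar>c\<bar> * C)" for x by simp
  qed simp
  have ivexp: "integrable M (\<lambda>x. v x * exp (q' * v x))"
  proof (rule Bochner_Integration.integrable_bound)
    show "integrable M (\<lambda>x. C * exp (q' * v x))" using iexp by simp
    show "AE x in M. norm (v x * exp (q' * v x)) \<le> norm (C * exp (q' * v x))"
      using bd C by (auto intro!: AE_I2 mult_right_mono simp: abs_mult)
  qed simp
  have pos: "0 < (\<integral>x. exp (c * v x) \<partial>M)" for c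
  proof -
    have "(\<integral>x. exp (- \<bar>c\<bar> * C) \<partial>M) \<le> (\<integral>x. exp (c * v x) \<partial>M)"
    proof (rule integral_mono)
      have "- \<bar>c\<bar> * C \<le> c * v x" for x
        using mult_mono[of "\<bar>c\<bar>" "\<bar>c\<bar>" "\<bar>v x\<bar>" C] bd[of x] abs_ge_minus_self[of "c * v x"]
        by (simp add: abs_mult)
      then show "exp (- \<bar>c\<bar> * C) \<le> exp (c * v x)" for x by simp
    qed (auto simp: iexp)
    then show ?thesis using less_le_trans[OF exp_gt_zero] by (simp add: prob_space)
  qed
  define A' where "A' = (\<integral>x. exp (q' * v x) \<partial>M)"
  define A where "A = (\<integral>x. exp (q * v x) \<partial>M)"
  have A: "0 < A" "0 < A'" using pos by (auto simp: A_def A'_def)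
  \<comment> \<open>The mean of \<open>v\<close> under the law with density proportional to
    \<open>exp (q' v)\<close>. The tangent of the exponential at \<open>(q - q') * \<mu>\<close>
    yields Jensen's inequality for that law.\<close>
  define \<mu> where "\<mu> = (\<integral>x. v x * exp (q' * v x) \<partial>M) / A'"
  have Ent: "Ent M (\<lambda>x. exp (q' * v x)) / A' = q' * \<mu> - ln A'"
    using A ivexp
    by (simp add: Ent_def A'_def[symmetric] \<mu>_def mult.left_commute[of _ q'] mult.commute[of "exp _"] diff_divide_distrib mult.assoc)
  have "exp ((q - q') * \<mu>) * A' = (\<integral>x. exp ((q - q') * \<mu>) * ((1 - (q - q') * \<mu>) * exp (q' * v x)
         + (q - q') * (v x * exp (q' * v x))) \<partial>M)"
  proof -
    have "(\<integral>x. v x * exp (q' * v x) \<partial>M) = A' * \<mu>" using A by (simp add: \<mu>_def)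
    moreover have "(\<integral>x. exp ((q - q') * \<mu>) * ((1 - (q - q') * \<mu>) * exp (q' * v x)
         + (q - q') * (v x * exp (q' * v x))) \<partial>M)
       = exp ((q - q') * \<mu>) * ((1 - (q - q') * \<mu>) * A' + (q - q') * (\<integral>x. v x * exp (q' * v x) \<partial>M))"
      using iexp ivexp by (simp add: A'_def[symmetric])
    ultimately show ?thesis by (simp add: algebra_simps)
  qed
  also have "\<dots> \<le> A"
    unfolding A_def
  proof (rule integral_mono)
    fix x
    have "exp ((q - q') * \<mu>) * ((1 - (q - q') * \<mu>) * exp (q' * v x) + (q - q') * (v x * exp (q' * v x)))
       = exp ((q - q') * \<mu>) * exp (q' * v x) * (1 + (q - q') * (v x - \<mu>))"
      by (simp add: algebra_simps)
    also have "\<dots> \<le> exp ((q - q') * \<mu>) * exp (q' * v x) * exp ((q - q') * (v x - \<mu>))"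
      by (intro mult_left_mono exp_ge_add_one_self) auto
    also have "\<dots> = exp (q * v x)" by (simp add: exp_add[symmetric] algebra_simps)
    finally show "exp ((q - q') * \<mu>) * ((1 - (q - q') * \<mu>) * exp (q' * v x)
        + (q - q') * (v x * exp (q' * v x))) \<le> exp (q * v x)" .
  qed (use iexp ivexp in simp_all)
  finally have "ln (exp ((q - q') * \<mu>) * A') \<le> ln A"
    using A by (subst ln_le_cancel_iff) auto
  then have "(q - q') * \<mu> + ln A' \<le> ln A" using A by (simp add: ln_mult)
  then have "((q - q') * \<mu> + ln A') / q \<le> ln A / q" using q by (intro divide_right_mono) auto
  moreover have "ln A' / q' = ((q - q') * \<mu> + ln A') / q + (q' - q) / (q * q') * (q' * \<mu> - ln A')"
    using q by (simp add: field_simps)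
  ultimately show ?thesis
    unfolding A_def[symmetric] A'_def[symmetric] Ent by linarith
qed

text \<open>Stands in for monotonicity from a nonpositive derivative: \<open>N\<close> equal
  subintervals cost at most \<open>C * (b - a)^2 / N\<close> in total, so \<open>\<psi>\<close>
  never has to be differentiated.\<close>

lemma le_of_quadratic_increments:
  fixes \<psi> :: "real \<Rightarrow> real"
  assumes "a \<le> b" and inc: "\<And>x y. a \<le> x \<Longrightarrow> x \<le> y \<Longrightarrow> y \<le> b \<Longrightarrow> \<psi> y - \<psi> x \<le> C * (y - x)\<^sup>2"
  shows "\<psi> b \<le> \<psi> a"
proof -
  have step: "\<psi> b - \<psi> a \<le> C * (b - a)\<^sup>2 / real (Suc n)" for n
  proof -
    define N where "N = Suc n"
    define d where "d = (b - a) / real N"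
    have N: "real N > 0" by (simp add: N_def)
    have d: "d \<ge> 0" "real N * d = b - a" using assms(1) N by (auto simp: d_def)
    have "\<psi> (a + real k * d) - \<psi> a \<le> real k * (C * d\<^sup>2)" if "k \<le> N" for k
      using that
    proof (induction k)
      case (Suc k)
      have "real (Suc k) * d \<le> real N * d" using Suc.prems d by (intro mult_right_mono) auto
      then have "\<psi> (a + real (Suc k) * d) - \<psi> (a + real k * d) \<le> C * ((a + real (Suc k) * d) - (a + real k * d))\<^sup>2"
        using d by (intro inc) (auto simp: algebra_simps)
      with Suc show ?case by (simp add: algebra_simps)
    qed simp
    from this[of N] have "\<psi> b - \<psi> a \<le> real N * (C * d\<^sup>2)" using d by simp
    also have "\<dots> = C * (b - a)\<^sup>2 / real N" using N by (simp add: d_def power2_eq_square field_simps)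
    finally show ?thesis by (simp add: N_def)
  qed
  have "(\<lambda>n. C * (b - a)\<^sup>2 / real (Suc n)) \<longlonglongrightarrow> 0"
    by (rule LIMSEQ_Suc) (rule lim_const_over_n)
  then have "\<psi> b - \<psi> a \<le> 0"
    by (rule LIMSEQ_le_const) (use step in auto)
  then show ?thesis by simp
qed

text \<open>Difference quotients along the direction \<open>g\<close> itself tend to
  \<open>(norm g)^2\<close> and are at most \<open>L * norm g\<close>.\<close>

lemma norm_gradient_le_lipschitz:
  fixes f :: "'a::euclidean_space \<Rightarrow> real"
  assumes d: "(f has_derivative (\<lambda>v. g \<bullet> v)) (at x)" and lip: "L-lipschitz_on UNIV f"
  shows "norm g \<le> L"
proof -
  have "((\<lambda>t::real. f (x + t *\<^sub>R g)) has_derivative (\<lambda>t. g \<bullet> (t *\<^sub>R g))) (at 0)"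
    by (rule has_derivative_compose[of "\<lambda>t. x + t *\<^sub>R g" "\<lambda>t. t *\<^sub>R g" 0 UNIV f "\<lambda>v. g \<bullet> v"])
       (use d in \<open>auto intro!: derivative_eq_intros\<close>)
  then have "((\<lambda>t::real. f (x + t *\<^sub>R g)) has_real_derivative (norm g)\<^sup>2) (at 0)"
    unfolding has_field_derivative_def
    by (rule has_derivative_eq_rhs) (auto simp: power2_norm_eq_inner mult.commute)
  then have "((\<lambda>t. (f (x + t *\<^sub>R g) - f x) / t) \<longlongrightarrow> (norm g)\<^sup>2) (at 0)"
    by (simp add: has_field_derivative_iff)
  moreover have "(f (x + t *\<^sub>R g) - f x) / t \<le> L * norm g" if "t \<noteq> 0" for t
  proof -
    have "\<bar>f (x + t *\<^sub>R g) - f x\<bar> \<le> \<bar>t\<bar> * (L * norm g)"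
      using lipschitz_onD[OF lip, of "x + t *\<^sub>R g" x] by (simp add: dist_real_def dist_norm mult_ac)
    then have "\<bar>(f (x + t *\<^sub>R g) - f x) / t\<bar> \<le> L * norm g"
      using that by (simp add: abs_divide divide_le_eq mult.commute)
    then show ?thesis by linarith
  qed
  then have "eventually (\<lambda>t. (f (x + t *\<^sub>R g) - f x) / t \<le> L * norm g) (at 0)"
    by (auto simp: eventually_at_filter)
  ultimately have "(norm g)\<^sup>2 \<le> L * norm g"
    by (rule tendsto_upperbound) auto
  then show ?thesis
    using lipschitz_on_nonneg[OF lip] by (cases "g = 0") (auto simp: power2_eq_square)
qed

lemma (in prob_space) chernoff_gaussian:
  fixes f :: "'a \<Rightarrow> real"
  assumes [measurable]: "f \<in> borel_measurable M" and "\<rho> > 0" "r \<ge> 0"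
    and int: "\<And>l. l > 0 \<Longrightarrow> integrable M (\<lambda>x. exp (l * f x))"
    and mgf: "\<And>l. l > 0 \<Longrightarrow> (\<integral>x. exp (l * f x) \<partial>M) \<le> exp (l * a + l\<^sup>2 / (2 * \<rho>))"
  shows "prob {x \<in> space M. r \<le> f x - a} \<le> exp (- \<rho> * r\<^sup>2 / 2)"
proof (cases "r = 0")
  case False
  \<comment> \<open>The minimiser of \<open>l^2 / (2 \<rho>) - l r\<close>; it is positive only for
    \<open>r > 0\<close>, hence the separate case.\<close>
  define l where "l = \<rho> * r"
  have l: "l > 0" using assms False by (simp add: l_def)
  have "prob {x \<in> space M. r \<le> f x - a} = prob {x \<in> space M. exp (l * (a + r)) \<le> exp (l * f x)}"
    using l by (intro arg_cong[where f=prob] Collect_cong) (simp add: le_diff_eq add.commute)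
  also have "\<dots> \<le> (\<integral>x. exp (l * f x) \<partial>M) / exp (l * (a + r))"
    using int[OF l] by (intro integral_Markov_inequality_measure[where A="{}"]) auto
  also have "\<dots> \<le> exp (l * a + l\<^sup>2 / (2 * \<rho>)) / exp (l * (a + r))"
    by (intro divide_right_mono mgf l) simp
  also have "\<dots> = exp (- \<rho> * r\<^sup>2 / 2)"
    using assms by (simp add: exp_diff[symmetric] l_def power2_eq_square field_simps)
  finally show ?thesis .
qed (use prob_le_1 in simp)

text \<open>For negative \<open>y = - x\<close> the claim amounts to
  \<open>1 \<le> (1 - x + x^2) * exp x\<close>, where the quadratic Taylor bound of
  \<open>exp x\<close> from below is enough.\<close>

lemma exp_le_quadratic: "exp y \<le> 1 + y + y\<^sup>2" if "\<bar>y\<bar> \<le> 1" for y :: real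
proof (cases "y \<ge> 0")
  case False
  define x where "x = - y"
  have x: "x > 0" using False by (simp add: x_def)
  have "1 * 1 \<le> (1 - x + x\<^sup>2) * (1 + x + x\<^sup>2 / 2)"
  proof -
    have "(1 - x + x\<^sup>2) * (1 + x + x\<^sup>2 / 2) = 1 + (x\<^sup>2 / 2 + x ^ 3 / 2 + x ^ 4 / 2)"
      by (simp add: power2_eq_square power3_eq_cube power4_eq_xxxx field_simps)
    moreover have "0 \<le> x\<^sup>2 / 2 + x ^ 3 / 2 + x ^ 4 / 2" using x by auto
    ultimately show ?thesis by linarith
  qed
  also have "\<dots> \<le> (1 - x + x\<^sup>2) * exp x"
  proof (rule mult_left_mono)
    show "1 + x + x\<^sup>2 / 2 \<le> exp x" using x by (intro exp_lower_Taylor_quadratic) auto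
    have "x * 1 \<le> 1 + x\<^sup>2" using sum_squares_bound[of x 1] x by simp
    then show "0 \<le> 1 - x + x\<^sup>2" by simp
  qed
  finally have "exp (- x) \<le> 1 - x + x\<^sup>2"
    by (simp add: exp_minus inverse_eq_divide divide_le_eq)
  then show ?thesis by (simp add: x_def)
qed (use that in \<open>auto intro: exp_bound\<close>)

section \<open>Functional form of the inequality, Herbst's argument and concentration\<close>

locale lsi_measure = prob_space m for m :: "'a::euclidean_space measure" +
  fixes \<rho> :: real
  assumes \<rho>: "\<rho> > 0" and lsi: "log_sobolev \<rho> m" and sets_m [measurable_cong]: "sets m = sets borel"
begin

lemma space_m [simp]: "space m = UNIV"
  using sets_eq_imp_space_eq[OF sets_m] by simp

lemma prob_UNIV [simp]: "prob UNIV = 1"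
  using prob_space by simp

text \<open>Comes from the density \<open>K^2 / A\<close> with \<open>A\<close> the integral of
  \<open>K^2\<close>: the Fisher information of a square is four times the Dirichlet energy. The
  lower bound on \<open>K\<close> keeps the logarithm bounded and the quotient in the Fisher
  information genuine; the upper bounds give the bounded density and gradient that
  \<open>log_sobolev\<close> asks for.\<close>

lemma lsi_square:
  assumes der: "\<And>x. (K has_derivative (\<lambda>v. gK x \<bullet> v)) (at x)" and cont: "continuous_on UNIV gK"
    and K: "\<kappa> > 0" "\<And>x. \<kappa> \<le> K x" "\<And>x. K x \<le> C" and gK: "\<And>x. norm (gK x) \<le> D"
  shows "Ent m (\<lambda>x. (K x)\<^sup>2) \<le> 2 / \<rho> * (\<integral>x. (norm (gK x))\<^sup>2 \<partial>m)"
proof -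
  have Kpos: "0 < K x" for x using K(1) K(2)[of x] by linarith
  have C: "0 < C" using Kpos[of 0] K(3)[of 0] by linarith
  have D: "0 \<le> D" using gK[of 0] norm_ge_zero[of "gK 0"] by linarith
  have contK: "continuous_on UNIV K"
    using der by (intro has_derivative_continuous_on[where f'="\<lambda>x v. gK x \<bullet> v"]) auto
  have [measurable]: "K \<in> borel_measurable borel" "gK \<in> borel_measurable borel"
    using contK cont by (auto intro: borel_measurable_continuous_onI)
  have iK: "integrable m (\<lambda>x. (K x)\<^sup>2)"
    using K Kpos by (intro integrable_bounded[where C="C\<^sup>2"]) (auto intro!: power_mono less_imp_le[OF Kpos])
  have lnK: "\<bar>ln ((K x)\<^sup>2)\<bar> \<le> \<bar>ln (\<kappa>\<^sup>2)\<bar> + \<bar>ln (C\<^sup>2)\<bar>" for x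
  proof -
    have "ln (\<kappa>\<^sup>2) \<le> ln ((K x)\<^sup>2)"
      using K(1) K(2)[of x] Kpos[of x] by (intro ln_mono power_mono) auto
    moreover have "ln ((K x)\<^sup>2) \<le> ln (C\<^sup>2)"
      using K(3)[of x] Kpos[of x] C by (intro ln_mono power_mono) auto
    ultimately show ?thesis by linarith
  qed
  have iKl: "integrable m (\<lambda>x. (K x)\<^sup>2 * ln ((K x)\<^sup>2))"
  proof (rule integrable_bounded)
    show "\<bar>(K x)\<^sup>2 * ln ((K x)\<^sup>2)\<bar> \<le> C\<^sup>2 * (\<bar>ln (\<kappa>\<^sup>2)\<bar> + \<bar>ln (C\<^sup>2)\<bar>)" for x
      unfolding abs_mult using K Kpos less_imp_le[OF Kpos] by (intro mult_mono lnK) (auto intro!: power_mono)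
  qed simp
  have igK: "integrable m (\<lambda>x. (norm (gK x))\<^sup>2)"
    using gK by (intro integrable_bounded[where C="D\<^sup>2"]) (auto intro!: power_mono)
  define A where "A = (\<integral>x. (K x)\<^sup>2 \<partial>m)"
  have "(\<integral>x. \<kappa>\<^sup>2 \<partial>m) \<le> A"
    unfolding A_def using K iK by (intro integral_mono power_mono) auto
  then have A: "A > 0" using K(1) by (simp add: prob_space) (meson less_le_trans zero_less_power)
  define h where "h = (\<lambda>x. (K x)\<^sup>2 / A)"
  define gh where "gh = (\<lambda>x. (2 * K x / A) *\<^sub>R gK x)"
  have "ennreal (2 * \<rho> * rel_entropy_dens m h) \<le> fisher_info_dens m h gh"
  proof (rule lsi[unfolded log_sobolev_def, rule_format], intro conjI allI)
    show "0 \<le> h x" for x using A by (simp add: h_def)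
    show "bounded (range h)" unfolding bounded_iff h_def
      using A K less_imp_le[OF Kpos] by (intro exI[of _ "C\<^sup>2 / A"]) (auto simp: abs_divide intro!: divide_right_mono power_mono)
    show "(h has_derivative (\<lambda>v. gh x \<bullet> v)) (at x)" for x
      unfolding h_def gh_def using A
      by (auto intro!: derivative_eq_intros der simp: field_simps)
    show "continuous_on UNIV gh" unfolding gh_def using A by (intro continuous_intros contK cont) auto
    show "bounded (range gh)" unfolding bounded_iff gh_def
    proof (intro exI[of _ "2 * C / A * D"] ballI, clarify)
      fix x
      show "norm ((2 * K x / A) *\<^sub>R gK x) \<le> 2 * C / A * D"
        using A K C less_imp_le[OF Kpos] gK D
        by (auto simp: abs_mult abs_divide intro!: mult_mono divide_right_mono)
    qed
    show "(\<integral>x. h x \<partial>m) = 1" using A by (simp add: h_def A_def[symmetric])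
  qed
  moreover have "rel_entropy_dens m h = Ent m (\<lambda>x. (K x)\<^sup>2) / A"
  proof -
    have "h x * ln (h x) = ((K x)\<^sup>2 * ln ((K x)\<^sup>2)) / A - (K x)\<^sup>2 * (ln A / A)" for x
      using A Kpos[of x] by (simp add: h_def ln_div field_simps)
    then have "rel_entropy_dens m h = (\<integral>x. (K x)\<^sup>2 * ln ((K x)\<^sup>2) \<partial>m) / A - A * (ln A / A)"
      unfolding rel_entropy_dens_def using iK iKl by (simp add: A_def)
    then show ?thesis using A by (simp add: Ent_def A_def[symmetric] field_simps)
  qed
  moreover have "fisher_info_dens m h gh = ennreal (4 / A * (\<integral>x. (norm (gK x))\<^sup>2 \<partial>m))"
  proof -
    have "h x * (norm (gh x) / h x)\<^sup>2 = 4 / A * (norm (gK x))\<^sup>2" for x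
      using A Kpos[of x] by (simp add: h_def gh_def power2_eq_square abs_mult abs_divide field_simps)
    then show ?thesis
      unfolding fisher_info_dens_def using igK A
      by (simp add: nn_integral_eq_integral)
  qed
  ultimately have "2 * \<rho> * (Ent m (\<lambda>x. (K x)\<^sup>2) / A) \<le> 4 / A * (\<integral>x. (norm (gK x))\<^sup>2 \<partial>m)"
    using A by (simp add: ennreal_le_iff)
  then show ?thesis using A \<rho> by (simp add: field_simps)
qed

text \<open>The function \<open>K q\<close>, the logarithm of the exponential moment divided by
  \<open>q\<close>, increases at rate at most \<open>1 / (2 \<rho>)\<close>: the tangent bound
  charges the normalised entropy, which \<open>lsi_square\<close> for \<open>exp (q f / 2)\<close>
  bounds by \<open>q^2 / (2 \<rho>)\<close>. Near zero \<open>K\<close> is close to the mean of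
  \<open>f\<close>.\<close>

lemma herbst_C1:
  assumes der: "\<And>x. (f has_derivative (\<lambda>v. gf x \<bullet> v)) (at x)" and cont: "continuous_on UNIV gf"
    and bd: "\<And>x. \<bar>f x\<bar> \<le> C" and gf: "\<And>x. norm (gf x) \<le> 1" and l: "l > 0"
  shows "(\<integral>x. exp (l * f x) \<partial>m) \<le> exp (l * (\<integral>x. f x \<partial>m) + l\<^sup>2 / (2 * \<rho>))"
proof -
  have C: "0 \<le> C" using bd[of 0] by linarith
  have contf: "continuous_on UNIV f"
    using der by (intro has_derivative_continuous_on[where f'="\<lambda>x v. gf x \<bullet> v"]) auto
  have [measurable]: "f \<in> borel_measurable borel" "gf \<in> borel_measurable borel"
    using contf cont by (auto intro: borel_measurable_continuous_onI)
  have abs: "\<bar>c * f x\<bar> \<le> \<bar>c\<bar> * C" for c x using bd[of x] by (auto simp: abs_mult intro!: mult_left_mono)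
  have ex: "exp (c * f x) \<le> exp (\<bar>c\<bar> * C)" "exp (- \<bar>c\<bar> * C) \<le> exp (c * f x)" for c x
    using abs[of c x] by (auto simp: abs_le_iff)
  have iexp: "integrable m (\<lambda>x. exp (c * f x))" for c
    using ex by (intro integrable_bounded[where C="exp (\<bar>c\<bar> * C)"]) auto
  have pos: "0 < (\<integral>x. exp (c * f x) \<partial>m)" for c
  proof -
    have "(\<integral>x. exp (- \<bar>c\<bar> * C) \<partial>m) \<le> (\<integral>x. exp (c * f x) \<partial>m)"
      using iexp ex by (intro integral_mono) auto
    then show ?thesis using less_le_trans[OF exp_gt_zero] by (simp add: prob_space)
  qed
  define K where "K = (\<lambda>q. ln (\<integral>x. exp (q * f x) \<partial>m) / q)"
  have ent: "Ent m (\<lambda>x. exp (q * f x)) / (\<integral>x. exp (q * f x) \<partial>m) \<le> q\<^sup>2 / (2 * \<rho>)" if "q > 0" for q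
  proof -
    have e: "(exp (q / 2 * f x))\<^sup>2 = exp (q * f x)" for x by (simp add: exp_double[symmetric])
    have "Ent m (\<lambda>x. (exp (q / 2 * f x))\<^sup>2)
       \<le> 2 / \<rho> * (\<integral>x. (norm ((q / 2 * exp (q / 2 * f x)) *\<^sub>R gf x))\<^sup>2 \<partial>m)"
    proof (rule lsi_square)
      show "((\<lambda>x. exp (q / 2 * f x)) has_derivative (\<lambda>v. ((q / 2 * exp (q / 2 * f x)) *\<^sub>R gf x) \<bullet> v)) (at x)" for x
        by (auto intro!: derivative_eq_intros der)
      show "continuous_on UNIV (\<lambda>x. (q / 2 * exp (q / 2 * f x)) *\<^sub>R gf x)"
        by (intro continuous_intros contf cont)
      show "exp (- \<bar>q / 2\<bar> * C) \<le> exp (q / 2 * f x)" "exp (q / 2 * f x) \<le> exp (\<bar>q / 2\<bar> * C)" for x by (rule ex)+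
      show "norm ((q / 2 * exp (q / 2 * f x)) *\<^sub>R gf x) \<le> (q / 2 * exp (\<bar>q / 2\<bar> * C)) * 1" for x
      proof -
        have "norm ((q / 2 * exp (q / 2 * f x)) *\<^sub>R gf x) = (q / 2 * exp (q / 2 * f x)) * norm (gf x)"
          using that by (simp add: abs_mult)
        also have "\<dots> \<le> (q / 2 * exp (\<bar>q / 2\<bar> * C)) * 1"
          using that by (intro mult_mono gf ex mult_left_mono) auto
        finally show ?thesis .
      qed
    qed simp
    also have "\<dots> \<le> 2 / \<rho> * (\<integral>x. q\<^sup>2 / 4 * exp (q * f x) \<partial>m)"
    proof (rule mult_left_mono, rule integral_mono)
      have le: "(norm ((q / 2 * exp (q / 2 * f x)) *\<^sub>R gf x))\<^sup>2 \<le> q\<^sup>2 / 4 * exp (q * f x)" for x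
      proof -
        have "(norm ((q / 2 * exp (q / 2 * f x)) *\<^sub>R gf x))\<^sup>2 = q\<^sup>2 / 4 * exp (q * f x) * (norm (gf x))\<^sup>2"
          by (simp add: power_mult_distrib power_divide e[simplified])
        also have "\<dots> \<le> q\<^sup>2 / 4 * exp (q * f x) * 1"
          using gf[of x] by (intro mult_left_mono) (auto simp: power_le_one)
        finally show ?thesis by simp
      qed
      then show "(norm ((q / 2 * exp (q / 2 * f x)) *\<^sub>R gf x))\<^sup>2 \<le> q\<^sup>2 / 4 * exp (q * f x)" for x .
      show "integrable m (\<lambda>x. q\<^sup>2 / 4 * exp (q * f x))" using iexp by simp
      then show "integrable m (\<lambda>x. (norm ((q / 2 * exp (q / 2 * f x)) *\<^sub>R gf x))\<^sup>2)"
        by (rule Bochner_Integration.integrable_bound) (use le in \<open>auto intro!: AE_I2\<close>)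
      show "0 \<le> 2 / \<rho>" using \<rho> by simp
    qed
    finally have "Ent m (\<lambda>x. exp (q * f x)) \<le> 2 / \<rho> * (q\<^sup>2 / 4 * (\<integral>x. exp (q * f x) \<partial>m))"
      by (simp add: e[simplified])
    then show ?thesis using pos[of q] \<rho> by (simp add: field_simps)
  qed
  \<comment> \<open>Subtracting the expected slope leaves increments of order
    \<open>(y - x)^2\<close>. Their constant blows up at zero, so the lower end \<open>a\<close>
    stays positive until the final limit.\<close>
  have inc: "(K y - y / (2 * \<rho>)) - (K x - x / (2 * \<rho>)) \<le> 1 / (2 * \<rho> * a) * (y - x)\<^sup>2" if "0 < a" "a \<le> x" "x \<le> y" for a x y
  proof -
    have "K y \<le> K x + (y - x) / (x * y) * (Ent m (\<lambda>z. exp (y * f z)) / (\<integral>z. exp (y * f z) \<partial>m))"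
      unfolding K_def using that bd by (intro log_moment_tangent[where C=C]) auto
    also have "\<dots> \<le> K x + (y - x) / (x * y) * (y\<^sup>2 / (2 * \<rho>))"
      using that by (intro add_left_mono mult_left_mono ent) auto
    finally have "(K y - y / (2 * \<rho>)) - (K x - x / (2 * \<rho>)) \<le> (y - x) / (x * y) * (y\<^sup>2 / (2 * \<rho>)) - (y - x) / (2 * \<rho>)"
      by (simp add: diff_divide_distrib)
    also have "\<dots> = (y - x)\<^sup>2 / (2 * \<rho>) / x"
      using that \<rho> by (simp add: field_simps power2_eq_square)
    also have "\<dots> \<le> (y - x)\<^sup>2 / (2 * \<rho>) / a"
      using that \<rho> by (intro divide_left_mono) auto
    finally show ?thesis by (simp add: field_simps)
  qed
  have mono: "K l - l / (2 * \<rho>) \<le> K a - a / (2 * \<rho>)" if "0 < a" "a \<le> l" for a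
    using that by (intro le_of_quadratic_increments[where \<psi>="\<lambda>y. K y - y / (2 * \<rho>)", OF that(2) inc]) auto
  \<comment> \<open>An explicit bound in place of the limit of \<open>K\<close> at zero, from the
    quadratic upper bound of the exponential on \<open>[-1, 1]\<close>.\<close>
  have Ka: "K a \<le> (\<integral>x. f x \<partial>m) + a * C\<^sup>2" if a: "0 < a" "a * C \<le> 1" for a
  proof -
    have "ln (\<integral>x. exp (a * f x) \<partial>m) \<le> (\<integral>x. exp (a * f x) \<partial>m) - 1"
      using pos by (intro ln_le_minus_one)
    also have "\<dots> \<le> (\<integral>x. 1 + a * f x + a\<^sup>2 * C\<^sup>2 \<partial>m) - 1"
    proof (intro diff_right_mono integral_mono)
      show "integrable m (\<lambda>x. exp (a * f x))" by (rule iexp)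
      show "integrable m (\<lambda>x. 1 + a * f x + a\<^sup>2 * C\<^sup>2)"
      proof -
        have "integrable m f" using bd by (intro integrable_bounded[where C=C]) auto
        then show ?thesis by simp
      qed
      fix x
      have y: "\<bar>a * f x\<bar> \<le> 1" using abs[of a x] a by simp
      have "exp (a * f x) \<le> 1 + a * f x + (a * f x)\<^sup>2"
        using y by (rule exp_le_quadratic)
      also have "(a * f x)\<^sup>2 \<le> (a * C)\<^sup>2"
        using abs[of a x] a C by (simp add: abs_le_square_iff[symmetric] abs_mult)
      finally show "exp (a * f x) \<le> 1 + a * f x + a\<^sup>2 * C\<^sup>2" by (simp add: power_mult_distrib)
    qed
    also have "\<dots> = a * ((\<integral>x. f x \<partial>m) + a * C\<^sup>2)"
    proof -
      have "integrable m f" using bd by (intro integrable_bounded[where C=C]) auto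
      then show ?thesis by (simp add: prob_space power2_eq_square algebra_simps)
    qed
    finally show ?thesis using a by (simp add: K_def field_simps)
  qed
  have "((\<lambda>a. (\<integral>x. f x \<partial>m) + a * C\<^sup>2 - a / (2 * \<rho>)) \<longlongrightarrow> (\<integral>x. f x \<partial>m) + 0 * C\<^sup>2 - 0 / (2 * \<rho>)) (at_right 0)"
    using \<rho> by (intro tendsto_intros) auto
  moreover have "eventually (\<lambda>a. K l - l / (2 * \<rho>) \<le> (\<integral>x. f x \<partial>m) + a * C\<^sup>2 - a / (2 * \<rho>)) (at_right 0)"
  proof -
    define b where "b = min l (1 / (C + 1))"
    have "b > 0" using l C by (simp add: b_def)
    then have "eventually (\<lambda>a. a \<in> {0<..<b}) (at_right 0)" by (rule eventually_at_right_real)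
    then show ?thesis
    proof eventually_elim
      case (elim a)
      have "a * C \<le> 1 / (C + 1) * C" using elim C by (intro mult_right_mono) (auto simp: b_def)
      also have "\<dots> \<le> 1" using C by simp
      finally show ?case using mono[of a] Ka[of a] elim by (auto simp: b_def)
    qed
  qed
  ultimately have "K l - l / (2 * \<rho>) \<le> (\<integral>x. f x \<partial>m) + 0 * C\<^sup>2 - 0 / (2 * \<rho>)"
    by (rule tendsto_lowerbound) auto
  then have "ln (\<integral>x. exp (l * f x) \<partial>m) \<le> l * (\<integral>x. f x \<partial>m) + l\<^sup>2 / (2 * \<rho>)"
    using l by (simp add: K_def field_simps power2_eq_square)
  then show ?thesis using pos[of l] by (metis exp_le_cancel_iff exp_ln)
qed

text \<open>Gaussian smoothing keeps the Lipschitz constant and moves the function by at most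
  \<open>\<sigma> * k\<close> uniformly, with \<open>k\<close> the mean norm of the Gaussian, so the
  \<open>C^1\<close> case passes to the limit.\<close>

lemma herbst_bounded:
  assumes lip: "1-lipschitz_on UNIV f" and bd: "\<And>x. \<bar>f x\<bar> \<le> C" and l: "l > 0"
  shows "(\<integral>x. exp (l * f x) \<partial>m) \<le> exp (l * (\<integral>x. f x \<partial>m) + l\<^sup>2 / (2 * \<rho>))"
proof -
  have [measurable]: "f \<in> borel_measurable borel"
    using lipschitz_on_continuous_on[OF lip] by (rule borel_measurable_continuous_onI)
  define k where "k = (\<integral>z. norm (z::'a) \<partial>std_gauss)"
  have nz: "integrable std_gauss (\<lambda>z::'a. norm z)"
    using std_gauss_norm_power_integrable[where n=1 and 'a='a] by simp
  have k: "0 \<le> k" by (simp add: k_def)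
  define F where "F = (\<lambda>\<sigma> x. \<integral>z. f (x + \<sigma> *\<^sub>R z) \<partial>std_gauss)"
  have if': "integrable std_gauss (\<lambda>z. f (x + \<sigma> *\<^sub>R z))" for x \<sigma>
    using bd by (intro std_gauss.integrable_bounded[where C=C]) auto
  have Fbd: "\<bar>F \<sigma> x\<bar> \<le> C" for \<sigma> x
  proof -
    have "\<bar>F \<sigma> x\<bar> \<le> (\<integral>z. \<bar>f (x + \<sigma> *\<^sub>R z)\<bar> \<partial>std_gauss)" unfolding F_def by (rule integral_abs_bound)
    also have "\<dots> \<le> (\<integral>z. C \<partial>(std_gauss::'a measure))"
      using if' bd by (intro integral_mono integrable_abs) auto
    finally show ?thesis by simp
  qed
  have Flip: "1-lipschitz_on UNIV (F \<sigma>)" for \<sigma>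
  proof (rule lipschitz_onI)
    fix x y
    have "\<bar>F \<sigma> x - F \<sigma> y\<bar> = \<bar>\<integral>z. f (x + \<sigma> *\<^sub>R z) - f (y + \<sigma> *\<^sub>R z) \<partial>std_gauss\<bar>"
      unfolding F_def using if' by simp
    also have "\<dots> \<le> (\<integral>z. \<bar>f (x + \<sigma> *\<^sub>R z) - f (y + \<sigma> *\<^sub>R z)\<bar> \<partial>std_gauss)" by (rule integral_abs_bound)
    also have "\<dots> \<le> (\<integral>z. dist x y \<partial>(std_gauss::'a measure))"
    proof (rule integral_mono)
      show "\<bar>f (x + \<sigma> *\<^sub>R z) - f (y + \<sigma> *\<^sub>R z)\<bar> \<le> dist x y" for z
        using lipschitz_onD[OF lip, of "x + \<sigma> *\<^sub>R z" "y + \<sigma> *\<^sub>R z"] by (simp add: dist_real_def)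
    qed (use if' in auto)
    finally show "dist (F \<sigma> x) (F \<sigma> y) \<le> 1 * dist x y"
      by (simp add: dist_real_def)
  qed simp
  have Fd: "\<bar>F \<sigma> x - f x\<bar> \<le> \<sigma> * k" if "\<sigma> > 0" for \<sigma> x
  proof -
    have "\<bar>F \<sigma> x - f x\<bar> = \<bar>\<integral>z. f (x + \<sigma> *\<^sub>R z) - f x \<partial>std_gauss\<bar>"
      unfolding F_def using if' by simp
    also have "\<dots> \<le> (\<integral>z. \<bar>f (x + \<sigma> *\<^sub>R z) - f x\<bar> \<partial>std_gauss)" by (rule integral_abs_bound)
    also have "\<dots> \<le> (\<integral>z. \<sigma> * norm (z::'a) \<partial>std_gauss)"
    proof (rule integral_mono)
      show "\<bar>f (x + \<sigma> *\<^sub>R z) - f x\<bar> \<le> \<sigma> * norm z" for z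
        using lipschitz_onD[OF lip, of "x + \<sigma> *\<^sub>R z" "x"] that by (simp add: dist_real_def dist_norm)
    qed (use if' nz in auto)
    also have "\<dots> = \<sigma> * k" by (simp add: k_def)
    finally show ?thesis .
  qed
  have [measurable]: "F \<sigma> \<in> borel_measurable borel" for \<sigma>
    using lipschitz_on_continuous_on[OF Flip] by (rule borel_measurable_continuous_onI)
  have iF: "integrable m (F \<sigma>)" for \<sigma> using Fbd by (intro integrable_bounded[where C=C]) auto
  have iff: "integrable m f" using bd by (intro integrable_bounded[where C=C]) auto
  have ie: "integrable m (\<lambda>x. exp (l * g x))" if "g \<in> borel_measurable borel" "\<And>x. \<bar>g x\<bar> \<le> C" for g
  proof (rule integrable_bounded)
    have [measurable]: "g \<in> borel_measurable borel" by fact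
    show "(\<lambda>x. exp (l * g x)) \<in> borel_measurable m" by measurable
    show "\<bar>exp (l * g x)\<bar> \<le> exp (l * C)" for x using that(2)[of x] l by (auto simp: abs_le_iff)
  qed
  \<comment> \<open>The factor 2 arises because the smoothing error enters twice: in the exponent
    under the integral and in the mean.\<close>
  have main: "(\<integral>x. exp (l * f x) \<partial>m) \<le> exp (2 * l * \<sigma> * k + (l * (\<integral>x. f x \<partial>m) + l\<^sup>2 / (2 * \<rho>)))"
    if s: "\<sigma> > 0" for \<sigma>
  proof -
    have "(\<integral>x. exp (l * f x) \<partial>m) \<le> (\<integral>x. exp (l * \<sigma> * k) * exp (l * F \<sigma> x) \<partial>m)"
    proof (rule integral_mono)
      show "exp (l * f x) \<le> exp (l * \<sigma> * k) * exp (l * F \<sigma> x)" for x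
      proof -
        have "l * f x \<le> l * (\<sigma> * k + F \<sigma> x)" using Fd[OF s, of x] l by (intro mult_left_mono) auto
        then show ?thesis by (simp add: exp_add[symmetric] algebra_simps)
      qed
    qed (use ie Fbd bd in auto)
    also have "\<dots> = exp (l * \<sigma> * k) * (\<integral>x. exp (l * F \<sigma> x) \<partial>m)" by simp
    also have "(\<integral>x. exp (l * F \<sigma> x) \<partial>m) \<le> exp (l * (\<integral>x. F \<sigma> x \<partial>m) + l\<^sup>2 / (2 * \<rho>))"
    proof (rule herbst_C1[OF _ _ Fbd _ l])
      let ?g = "\<lambda>x. (\<integral>z. f (x + \<sigma> *\<^sub>R z) *\<^sub>R z \<partial>std_gauss) /\<^sub>R \<sigma>"
      show d: "(F \<sigma> has_derivative (\<lambda>v. ?g x \<bullet> v)) (at x)" for x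
        unfolding F_def using s bd by (intro gauss_smoothing_has_derivative[where C=C]) auto
      show "continuous_on UNIV ?g"
        by (intro continuous_intros gauss_smoothing_gradient_continuous[OF lip bd])
      show "norm (?g x) \<le> 1" for x
        by (rule norm_gradient_le_lipschitz[OF d Flip])
    qed
    also have "(\<integral>x. F \<sigma> x \<partial>m) \<le> (\<integral>x. f x + \<sigma> * k \<partial>m)"
    proof (rule integral_mono)
      show "F \<sigma> x \<le> f x + \<sigma> * k" for x using Fd[OF s, of x] by linarith
    qed (use iF iff in auto)
    finally show ?thesis
      using l iff by (simp add: exp_add[symmetric] algebra_simps)
  qed
  have "((\<lambda>\<sigma>. exp (2 * l * \<sigma> * k + (l * (\<integral>x. f x \<partial>m) + l\<^sup>2 / (2 * \<rho>))))
      \<longlongrightarrow> exp (2 * l * 0 * k + (l * (\<integral>x. f x \<partial>m) + l\<^sup>2 / (2 * \<rho>)))) (at_right 0)"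
    by (intro tendsto_intros)
  moreover have "eventually (\<lambda>\<sigma>. (\<integral>x. exp (l * f x) \<partial>m)
      \<le> exp (2 * l * \<sigma> * k + (l * (\<integral>x. f x \<partial>m) + l\<^sup>2 / (2 * \<rho>)))) (at_right 0)"
    using eventually_at_right_less[of 0] by eventually_elim (rule main)
  ultimately have "(\<integral>x. exp (l * f x) \<partial>m) \<le> exp (2 * l * 0 * k + (l * (\<integral>x. f x \<partial>m) + l\<^sup>2 / (2 * \<rho>)))"
    by (rule tendsto_lowerbound) auto
  then show ?thesis by simp
qed

lemma concentration_bounded:
  assumes lip: "1-lipschitz_on UNIV f" and bd: "\<And>x. \<bar>f x\<bar> \<le> C" and r: "r \<ge> 0"
  shows "prob {x. r \<le> f x - (\<integral>x. f x \<partial>m)} \<le> exp (- \<rho> * r\<^sup>2 / 2)"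
proof -
  have [measurable]: "f \<in> borel_measurable borel"
    using lipschitz_on_continuous_on[OF lip] by (rule borel_measurable_continuous_onI)
  have "prob {x \<in> space m. r \<le> f x - (\<integral>x. f x \<partial>m)} \<le> exp (- \<rho> * r\<^sup>2 / 2)"
  proof (rule chernoff_gaussian[OF _ \<rho> r])
    show "integrable m (\<lambda>x. exp (l * f x))" if "l > 0" for l
    proof (rule integrable_bounded)
      show "\<bar>exp (l * f x)\<bar> \<le> exp (l * C)" for x using bd[of x] that by (auto simp: abs_le_iff)
    qed measurable
  qed (use herbst_bounded[OF lip bd] in auto)
  then show ?thesis by simp
qed

text \<open>Herbst's bound for the truncated norms involves their means, which must first be bounded
  uniformly in the truncation. A ball of mass above one half does this: if a mean exceeded the
  radius by too much, concentration of the negated truncation would leave the ball a mass of at most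
  \<open>exp (- 1)\<close>.\<close>

lemma exp_norm_integrable: "integrable m (\<lambda>x. exp (l * norm x))" if l: "l > 0" for l
proof -
  define f where "f = (\<lambda>n x::'a. min (norm x) (real n))"
  have flip: "1-lipschitz_on UNIV (f n)" for n
  proof (rule lipschitz_onI)
    show "dist (f n x) (f n y) \<le> 1 * dist x y" for x y
      using norm_triangle_ineq3[of x y] by (auto simp: f_def dist_real_def dist_norm)
  qed simp
  have fneg: "1-lipschitz_on UNIV (\<lambda>x. - f n x)" for n
    using flip[of n] by (auto simp: lipschitz_on_def dist_real_def)
  have fbd: "\<bar>f n x\<bar> \<le> real n" "\<bar>- f n x\<bar> \<le> real n" for n x by (auto simp: f_def)
  have [measurable]: "f n \<in> borel_measurable borel" for n by (simp add: f_def)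
  obtain k where k: "1 / 2 < prob (cball 0 (real k))"
  proof -
    have "(\<lambda>n. prob (cball 0 (real n))) \<longlonglongrightarrow> prob (\<Union>n. cball (0::'a) (real n))"
      by (rule finite_Lim_measure_incseq) (auto simp: incseq_def)
    also have "(\<Union>n. cball (0::'a) (real n)) = UNIV"
      by (auto simp: real_arch_simple)
    finally have "eventually (\<lambda>n. 1 / 2 < prob (cball (0::'a) (real n))) sequentially"
      by (intro order_tendstoD(1)) auto
    then show ?thesis using that by (auto simp: eventually_sequentially)
  qed
  \<comment> \<open>\<open>sqrt (2 / \<rho>)\<close> is the deviation at which the concentration
    bound equals \<open>exp (- 1)\<close>.\<close>
  define a where "a = real k + sqrt (2 / \<rho>)"
  have fa: "(\<integral>x. f n x \<partial>m) \<le> a" for n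
  proof (rule ccontr)
    assume asm: "\<not> (\<integral>x. f n x \<partial>m) \<le> a"
    define r where "r = (\<integral>x. f n x \<partial>m) - real k"
    have r: "r > sqrt (2 / \<rho>)" using asm by (simp add: r_def a_def)
    have r0: "r \<ge> 0" using r \<rho> by (smt (verit) divide_nonneg_pos real_sqrt_ge_zero)
    have "2 / \<rho> < r\<^sup>2" 
    proof -
      have "sqrt (2 / \<rho>) < sqrt (r\<^sup>2)" using r r0 by simp
      then show ?thesis by (simp only: real_sqrt_less_iff)
    qed
    then have 1: "1 \<le> \<rho> * r\<^sup>2 / 2" using \<rho> by (simp add: field_simps)
    have "cball 0 (real k) \<subseteq> {x. r \<le> - f n x - (\<integral>x. - f n x \<partial>m)}"
      by (auto simp: r_def f_def)
    then have "prob (cball 0 (real k)) \<le> prob {x. r \<le> - f n x - (\<integral>x. - f n x \<partial>m)}"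
      by (intro finite_measure_mono) (auto simp: sets_m)
    also have "\<dots> \<le> exp (- \<rho> * r\<^sup>2 / 2)"
      by (rule concentration_bounded[OF fneg fbd(2) r0])
    also have "\<dots> \<le> exp (- 1)" using 1 by simp
    also have "\<dots> \<le> 1 / 2" using exp_ge_add_one_self[of 1] by (simp add: exp_minus field_simps)
    finally show False using k by simp
  qed
  define E where "E = exp (l * a + l\<^sup>2 / (2 * \<rho>))"
  have ie: "integrable m (\<lambda>x. exp (l * f n x))" for n
  proof (rule integrable_bounded)
    show "\<bar>exp (l * f n x)\<bar> \<le> exp (l * real n)" for x using l by (auto simp: f_def)
  qed measurable
  have bound: "(\<integral>\<^sup>+x. ennreal (exp (l * f n x)) \<partial>m) \<le> ennreal E" for n
  proof -
    have "(\<integral>x. exp (l * f n x) \<partial>m) \<le> exp (l * (\<integral>x. f n x \<partial>m) + l\<^sup>2 / (2 * \<rho>))"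
      by (rule herbst_bounded[OF flip fbd(1) l])
    also have "\<dots> \<le> E" unfolding E_def using fa[of n] l by simp
    finally show ?thesis using ie by (simp add: nn_integral_eq_integral ennreal_leI)
  qed
  have "(\<lambda>n. \<integral>\<^sup>+x. ennreal (exp (l * f n x)) \<partial>m) \<longlonglongrightarrow> (\<integral>\<^sup>+x. ennreal (exp (l * norm x)) \<partial>m)"
  proof (rule nn_integral_LIMSEQ)
    show "incseq (\<lambda>n x. ennreal (exp (l * f n x)))"
      using l by (auto simp: incseq_def le_fun_def f_def intro!: ennreal_leI)
    show "(\<lambda>n. ennreal (exp (l * f n x))) \<longlonglongrightarrow> ennreal (exp (l * norm x))" for x
    proof (rule tendsto_eventually)
      obtain N where "norm x \<le> real N" using real_arch_simple by blast
      then show "\<forall>\<^sub>F n in sequentially. ennreal (exp (l * f n x)) = ennreal (exp (l * norm x))"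
        by (intro eventually_sequentiallyI[of N]) (auto simp: f_def min_def)
    qed
  qed measurable
  then have "(\<integral>\<^sup>+x. ennreal (exp (l * norm x)) \<partial>m) \<le> ennreal E"
    by (rule LIMSEQ_le_const2) (use bound in auto)
  then show ?thesis
    by (intro integrableI_bounded) (auto intro: le_less_trans)
qed

lemma norm_power_integrable: "integrable m (\<lambda>x. norm x ^ n)"
proof (rule Bochner_Integration.integrable_bound)
  show "integrable m (\<lambda>x. fact n * exp (1 * norm x))"
    by (intro integrable_mult_right exp_norm_integrable) simp
qed (auto intro!: AE_I2 power_le_fact_exp)

lemma lipschitz_integrable:
  fixes f :: "'a \<Rightarrow> real"
  assumes lip: "1-lipschitz_on UNIV f"
  shows "integrable m f"
proof (rule Bochner_Integration.integrable_bound)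
  show "integrable m (\<lambda>x. \<bar>f 0\<bar> + norm x ^ 1)"
    by (intro Bochner_Integration.integrable_add norm_power_integrable) simp
  show "f \<in> borel_measurable m"
    using borel_measurable_continuous_onI[OF lipschitz_on_continuous_on[OF lip]] by measurable
  show "AE x in m. norm (f x) \<le> norm (\<bar>f 0\<bar> + norm x ^ 1)"
  proof (rule AE_I2)
    show "norm (f x) \<le> norm (\<bar>f 0\<bar> + norm x ^ 1)" for x
      using lipschitz_onD[OF lip, of x 0] by (simp add: dist_real_def)
  qed
qed

text \<open>Truncating \<open>f\<close> to \<open>[-n, n]\<close> preserves the Lipschitz constant,
  and the exponential moments of the norm dominate all truncations at once.\<close>

lemma concentration:
  assumes lip: "1-lipschitz_on UNIV f" and r: "r \<ge> 0"
  shows "prob {x. r \<le> f x - (\<integral>x. f x \<partial>m)} \<le> exp (- \<rho> * r\<^sup>2 / 2)"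
proof -
  have [measurable]: "f \<in> borel_measurable borel"
    using lipschitz_on_continuous_on[OF lip] by (rule borel_measurable_continuous_onI)
  have fb: "\<bar>f x\<bar> \<le> \<bar>f 0\<bar> + norm x" for x
    using lipschitz_onD[OF lip, of x 0] by (simp add: dist_real_def)
  define g where "g = (\<lambda>n x. max (- real n) (min (real n) (f x)))"
  have [measurable]: "g n \<in> borel_measurable borel" for n by (simp add: g_def)
  have glip: "1-lipschitz_on UNIV (g n)" for n
  proof (rule lipschitz_onI)
    show "dist (g n x) (g n y) \<le> 1 * dist x y" for x y
      using lipschitz_onD[OF lip, of x y] by (auto simp: g_def dist_real_def max_def min_def)
  qed simp
  have gbd: "\<bar>g n x\<bar> \<le> real n" "\<bar>g n x\<bar> \<le> \<bar>f x\<bar>" for n x by (auto simp: g_def)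
  have glim: "(\<lambda>n. g n x) \<longlonglongrightarrow> f x" for x
  proof (rule tendsto_eventually)
    obtain N where "\<bar>f x\<bar> \<le> real N" using real_arch_simple by blast
    then show "\<forall>\<^sub>F n in sequentially. g n x = f x"
      by (intro eventually_sequentiallyI[of N]) (auto simp: g_def min_def max_def)
  qed
  have iexp: "integrable m (\<lambda>x. exp (l * (\<bar>f 0\<bar> + norm x)))" if "l > 0" for l
    using integrable_mult_right[OF exp_norm_integrable[OF that], of "exp (l * \<bar>f 0\<bar>)"]
    by (simp add: exp_add[symmetric] algebra_simps)
  have "prob {x \<in> space m. r \<le> f x - (\<integral>x. f x \<partial>m)} \<le> exp (- \<rho> * r\<^sup>2 / 2)"
  proof (rule chernoff_gaussian[OF _ \<rho> r])
    fix l :: real assume l: "l > 0"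
    have dom: "exp (l * g n x) \<le> exp (l * (\<bar>f 0\<bar> + norm x))" for n x
      using l gbd(2)[of n x] fb[of x] by simp
    show "integrable m (\<lambda>x. exp (l * f x))"
      using iexp[OF l]
    proof (rule Bochner_Integration.integrable_bound)
      show "AE x in m. norm (exp (l * f x)) \<le> norm (exp (l * (\<bar>f 0\<bar> + norm x)))"
      proof (rule AE_I2)
        show "norm (exp (l * f x)) \<le> norm (exp (l * (\<bar>f 0\<bar> + norm x)))" for x
          using fb[of x] l by simp
      qed
    qed measurable
    have "(\<lambda>n. \<integral>x. exp (l * g n x) \<partial>m) \<longlonglongrightarrow> (\<integral>x. exp (l * f x) \<partial>m)"
      by (rule integral_dominated_convergence[where w="\<lambda>x. exp (l * (\<bar>f 0\<bar> + norm x))"])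
         (auto intro!: tendsto_intros glim iexp l AE_I2 dom simp del: exp_le_cancel_iff)
    moreover have "(\<lambda>n. exp (l * (\<integral>x. g n x \<partial>m) + l\<^sup>2 / (2 * \<rho>))) \<longlonglongrightarrow> exp (l * (\<integral>x. f x \<partial>m) + l\<^sup>2 / (2 * \<rho>))"
    proof (intro tendsto_intros)
      show "(\<lambda>n. \<integral>x. g n x \<partial>m) \<longlonglongrightarrow> (\<integral>x. f x \<partial>m)"
        by (rule integral_dominated_convergence[where w="\<lambda>x. \<bar>f x\<bar>"])
           (use gbd(2) in \<open>auto intro!: glim AE_I2 integrable_abs[OF lipschitz_integrable[OF lip]]\<close>)
    qed
    ultimately show "(\<integral>x. exp (l * f x) \<partial>m) \<le> exp (l * (\<integral>x. f x \<partial>m) + l\<^sup>2 / (2 * \<rho>))"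
      by (rule LIMSEQ_le) (use herbst_bounded[OF glip gbd(1) l] in auto)
  qed measurable
  then show ?thesis by simp
qed

end

section \<open>The Euler kernel of the Langevin dynamics\<close>

text \<open>The class of test functions on which all error constants are uniform. The lower bound
  makes logarithms and powers Lipschitz on the range, and the class is stable under powers
  \<open>s \<ge> 1\<close> and under the kernel, with explicit constants.\<close>

definition unit_lip :: "real \<Rightarrow> real \<Rightarrow> ('a::metric_space \<Rightarrow> real) \<Rightarrow> bool" where
  "unit_lip \<epsilon> L u \<longleftrightarrow> (\<forall>x. \<epsilon> \<le> u x \<and> u x \<le> 1) \<and> L-lipschitz_on UNIV u"

lemma unit_lipD:
  assumes "unit_lip \<epsilon> L u"
  shows "\<epsilon> \<le> u x" "u x \<le> 1" "L-lipschitz_on UNIV u" "0 \<le> L" "\<bar>u x - u y\<bar> \<le> L * dist x y"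
    "\<epsilon> \<le> 1"
  using assms lipschitz_on_nonneg[of L UNIV u] lipschitz_onD[of L UNIV u x y] order.trans[of \<epsilon> "u x" 1]
  by (auto simp: unit_lip_def dist_real_def)

lemma unit_lip_abs_le:
  assumes "unit_lip \<epsilon> L u" "0 \<le> \<epsilon>"
  shows "\<bar>u x\<bar> \<le> 1"
  using unit_lipD(1,2)[OF assms(1), of x] assms(2) by linarith

lemma unit_lip_measurable:
  fixes u :: "'a::euclidean_space \<Rightarrow> real"
  assumes "unit_lip \<epsilon> L u"
  shows "u \<in> borel_measurable borel"
  using lipschitz_on_continuous_on[OF unit_lipD(3)[OF assms]] by (rule borel_measurable_continuous_onI)

text \<open>By the mean value theorem, since \<open>z powr (s - 1) \<le> 1\<close> for
  \<open>z\<close> between 0 and 1 and \<open>s \<ge> 1\<close>.\<close>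

lemma unit_lip_powr:
  assumes u: "unit_lip \<epsilon> L u" and e: "\<epsilon> > 0" and s: "s \<ge> 1"
  shows "unit_lip (\<epsilon> powr s) (s * L) (\<lambda>x. u x powr s)"
proof -
  note uD = unit_lipD[OF u]
  have pos: "0 < u x" for x using uD(1)[of x] e by linarith
  have lt: "b powr s - a powr s \<le> s * (b - a)" if "0 < a" "a < b" "b \<le> 1" for a b
  proof -
    have "\<exists>z::real. z > a \<and> z < b \<and> b powr s - a powr s = (b - a) * (s * z powr (s - 1))"
      using that by (intro MVT2) (auto intro!: derivative_eq_intros)
    then obtain z where z: "z > a" "z < b" "b powr s - a powr s = (b - a) * (s * z powr (s - 1))" by blast
    have "z powr (s - 1) \<le> 1" using z that s by (intro powr_le1) auto
    then show ?thesis using z s that by (simp add: mult_left_le)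
  qed
  have ab: "\<bar>a powr s - b powr s\<bar> \<le> s * \<bar>a - b\<bar>" if "0 < a" "a \<le> 1" "0 < b" "b \<le> 1" for a b
  proof (cases a b rule: linorder_cases)
    case less
    then have "a powr s \<le> b powr s" using that s by (intro powr_mono2) auto
    with lt[of a b] less that show ?thesis by simp
  next
    case greater
    then have "b powr s \<le> a powr s" using that s by (intro powr_mono2) auto
    with lt[of b a] greater that show ?thesis by simp
  qed simp
  show ?thesis
    unfolding unit_lip_def
  proof (intro conjI allI)
    show "\<epsilon> powr s \<le> u x powr s" "u x powr s \<le> 1" for x
      using uD(1,2)[of x] pos[of x] e s by (auto intro!: powr_mono2 powr_le1)
    show "(s * L)-lipschitz_on UNIV (\<lambda>x. u x powr s)"
    proof (rule lipschitz_onI)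
      fix x y
      have "\<bar>u x powr s - u y powr s\<bar> \<le> s * \<bar>u x - u y\<bar>" using uD pos by (intro ab) auto
      also have "\<dots> \<le> s * (L * dist x y)" using uD(5)[of x y] s by (intro mult_left_mono) auto
      finally show "dist (u x powr s) (u y powr s) \<le> s * L * dist x y" by (simp add: dist_real_def)
    qed (use uD(4) s in auto)
  qed
qed

lemma sets_gibbs [simp, measurable_cong]: "sets (gibbs U) = sets borel"
  and space_gibbs [simp]: "space (gibbs U) = UNIV"
  by (simp_all add: gibbs_def)

locale langevin =
  fixes U :: "'a::euclidean_space \<Rightarrow> real" and gU :: "'a \<Rightarrow> 'a" and HU :: "'a \<Rightarrow> 'a \<Rightarrow>\<^sub>L 'a"
    and M \<rho> :: real
  assumes M: "M > 0" and \<rho>_pos: "\<rho> > 0"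
    and dU: "\<And>x. (U has_derivative (\<lambda>v. gU x \<bullet> v)) (at x)"
    and dgU: "\<And>x. (gU has_derivative blinfun_apply (HU x)) (at x)"
    and contHU: "continuous_on UNIV HU"
    and HU: "\<And>x. norm (HU x) \<le> M"
    and prob_gibbs: "prob_space (gibbs U)"
    and lsi_gibbs: "log_sobolev \<rho> (gibbs U)"
begin

sublocale lsi_measure "gibbs U" \<rho>
  using prob_gibbs lsi_gibbs \<rho>_pos
  by (simp add: lsi_measure_def lsi_measure_axioms_def)

abbreviation "m \<equiv> gibbs U"

definition euler :: "real \<Rightarrow> 'a \<Rightarrow> 'a \<Rightarrow> 'a" where
  "euler h x z = x - h *\<^sub>R gU x + sqrt (2 * h) *\<^sub>R z"

definition Q :: "real \<Rightarrow> ('a \<Rightarrow> real) \<Rightarrow> 'a \<Rightarrow> real" where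
  "Q h \<phi> x = (\<integral>z. \<phi> (euler h x z) \<partial>std_gauss)"

section \<open>Lipschitz estimates for the drift and the kernel\<close>

lemma gU_lipschitz: "M-lipschitz_on UNIV gU"
  using dgU HU M
  by (intro bounded_derivative_imp_lipschitz[where f'="\<lambda>x. blinfun_apply (HU x)"])
     (auto simp: norm_blinfun.rep_eq[symmetric] has_derivative_at_withinI)

lemma gU_diff: "norm (gU x - gU y) \<le> M * norm (x - y)"
  using lipschitz_onD[OF gU_lipschitz, of x y] by (simp add: dist_norm)

lemma gU_continuous: "continuous_on UNIV gU"
  using gU_lipschitz by (rule lipschitz_on_continuous_on)

lemma gU_measurable [measurable]: "gU \<in> borel_measurable borel"
  using gU_continuous by (rule borel_measurable_continuous_onI)

lemma U_measurable [measurable]: "U \<in> borel_measurable borel"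
  using dU by (intro borel_measurable_continuous_onI has_derivative_continuous_on[where f'="\<lambda>x v. gU x \<bullet> v"]) auto

lemma euler_measurable [measurable (raw)]:
  assumes [measurable]: "f \<in> borel_measurable N" "g \<in> borel_measurable N"
  shows "(\<lambda>w. euler h (f w) (g w)) \<in> borel_measurable N"
  unfolding euler_def by measurable

lemma integrable_euler:
  fixes C :: real
  assumes [measurable]: "\<phi> \<in> borel_measurable borel" and "\<And>x. \<bar>\<phi> x\<bar> \<le> C"
  shows "integrable std_gauss (\<lambda>z. \<phi> (euler h x z))"
  using assms(2) by (intro std_gauss.integrable_bounded[where C=C]) auto

lemma unit_lip_integrable_euler:
  assumes "unit_lip \<epsilon> L u" "0 \<le> \<epsilon>"
  shows "integrable std_gauss (\<lambda>z. u (euler h x z))"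
  using unit_lip_abs_le[OF assms] unit_lip_measurable[OF assms(1)] by (intro integrable_euler[where C=1]) auto

lemma unit_lip_integrable:
  assumes "unit_lip \<epsilon> L u" "0 \<le> \<epsilon>"
  shows "integrable m u"
  using unit_lip_abs_le[OF assms] unit_lip_measurable[OF assms(1)] by (intro integrable_bounded[where C=1]) auto

text \<open>Synchronous coupling: with the same Gaussian for both starting points the noise cancels,
  and only the drift separates the two steps.\<close>

lemma unit_lip_Q:
  assumes u: "unit_lip \<epsilon> L u" and "0 \<le> \<epsilon>" "0 \<le> h"
  shows "unit_lip \<epsilon> (L * (1 + h * M)) (Q h u)"
  unfolding unit_lip_def
proof (intro conjI allI)
  note uD = unit_lipD[OF u]
  note iu = unit_lip_integrable_euler[OF u \<open>0 \<le> \<epsilon>\<close>]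
  have "(\<integral>z. \<epsilon> \<partial>(std_gauss::'a measure)) \<le> Q h u x" for x
    unfolding Q_def using iu uD(1) by (intro integral_mono) auto
  moreover have "Q h u x \<le> (\<integral>z. 1 \<partial>(std_gauss::'a measure))" for x
    unfolding Q_def using iu uD(2) by (intro integral_mono) auto
  ultimately show "\<epsilon> \<le> Q h u x" "Q h u x \<le> 1" for x by (auto simp:)
  show "(L * (1 + h * M))-lipschitz_on UNIV (Q h u)"
  proof (rule lipschitz_onI)
    fix x y
    have "dist (Q h u x) (Q h u y) = \<bar>\<integral>z. u (euler h x z) - u (euler h y z) \<partial>std_gauss\<bar>"
      unfolding Q_def dist_real_def using iu by simp
    also have "\<dots> \<le> (\<integral>z. \<bar>u (euler h x z) - u (euler h y z)\<bar> \<partial>std_gauss)" by (rule integral_abs_bound)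
    also have "\<dots> \<le> (\<integral>z. L * (1 + h * M) * dist x y \<partial>(std_gauss::'a measure))"
    proof (rule integral_mono)
      fix z
      have "norm (euler h x z - euler h y z) = norm ((x - y) - h *\<^sub>R (gU x - gU y))"
        by (simp add: euler_def algebra_simps)
      also have "\<dots> \<le> norm (x - y) + h * norm (gU x - gU y)"
        using norm_triangle_ineq4[of "x - y" "h *\<^sub>R (gU x - gU y)"] \<open>0 \<le> h\<close> by simp
      also have "\<dots> \<le> norm (x - y) + h * (M * norm (x - y))"
        using \<open>0 \<le> h\<close> by (intro add_left_mono mult_left_mono gU_diff)
      finally have "dist (euler h x z) (euler h y z) \<le> (1 + h * M) * dist x y"
        by (simp add: dist_norm algebra_simps)
      then have "L * dist (euler h x z) (euler h y z) \<le> L * ((1 + h * M) * dist x y)"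
        using uD(4) by (rule mult_left_mono)
      then show "\<bar>u (euler h x z) - u (euler h y z)\<bar> \<le> L * (1 + h * M) * dist x y"
        using uD(5)[of "euler h x z" "euler h y z"] by (simp add: mult.assoc)
    qed (use iu in auto)
    finally show "dist (Q h u x) (Q h u y) \<le> L * (1 + h * M) * dist x y"
      by simp
  qed (use uD(4) M \<open>0 \<le> h\<close> in auto)
qed

text \<open>Because \<open>1 + h * M \<le> exp (h * M)\<close>, the constant depends on the elapsed
  time \<open>k * h\<close> alone and stays bounded while the step size shrinks.\<close>

lemma unit_lip_Q_iterate:
  assumes u: "unit_lip \<epsilon> L u" and "0 \<le> \<epsilon>" "0 \<le> h"
  shows "unit_lip \<epsilon> (L * exp (real k * h * M)) ((Q h ^^ k) u)"
proof -
  have "unit_lip \<epsilon> (L * (1 + h * M) ^ k) ((Q h ^^ k) u)"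
  proof (induction k)
    case (Suc k)
    from unit_lip_Q[OF Suc assms(2,3)] show ?case by (simp add: mult.assoc mult.commute[of "1 + h * M"])
  qed (use u in simp)
  moreover have "(1 + h * M) ^ k \<le> exp (h * M) ^ k"
    using assms(3) M by (intro power_mono) auto
  then have "(1 + h * M) ^ k \<le> exp (real k * h * M)"
    by (simp add: exp_of_nat_mult[symmetric] mult.assoc)
  then have "L * (1 + h * M) ^ k \<le> L * exp (real k * h * M)"
    using unit_lipD(4)[OF u] by (rule mult_left_mono)
  ultimately show ?thesis
    by (auto simp: unit_lip_def intro: lipschitz_on_mono)
qed

lemma euler_displacement:
  assumes "0 < h" "h \<le> 1"
  shows "norm (euler h x z - x) \<le> sqrt h * (1 + norm (gU x) + 2 * norm z)"
proof -
  have "norm (euler h x z - x) = norm (sqrt (2 * h) *\<^sub>R z - h *\<^sub>R gU x)" by (simp add: euler_def)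
  also have "\<dots> \<le> sqrt (2 * h) * norm z + h * norm (gU x)"
    using norm_triangle_ineq4[of "sqrt (2 * h) *\<^sub>R z" "h *\<^sub>R gU x"] assms by simp
  also have "\<dots> \<le> sqrt h * (2 * norm z) + sqrt h * norm (gU x)"
  proof (rule add_mono)
    have "sqrt 2 \<le> 2" by (rule real_le_lsqrt) auto
    then show "sqrt (2 * h) * norm z \<le> sqrt h * (2 * norm z)"
      using assms by (auto simp: real_sqrt_mult intro!: mult_right_mono)
    have "h = sqrt h * sqrt h" using assms by simp
    also have "\<dots> \<le> sqrt h * 1" using assms by (intro mult_left_mono) auto
    finally show "h * norm (gU x) \<le> sqrt h * norm (gU x)" by (intro mult_right_mono) auto
  qed
  also have "\<dots> \<le> sqrt h * (1 + norm (gU x) + 2 * norm z)" using assms by (simp add: algebra_simps)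
  finally show ?thesis .
qed

subsection \<open>Approximate invariance\<close>

text \<open>Lebesgue density of the pair formed by a point with law \<open>m\<close> and its Euler
  step. Exact reversibility would be symmetry in the two arguments.\<close>

definition kdens :: "real \<Rightarrow> 'a \<Rightarrow> 'a \<Rightarrow> real" where
  "kdens h x y = exp (- U x) * gauss_dens (2 * h) (y - (x - h *\<^sub>R gU x))"

lemma kdens_measurable [measurable (raw)]:
  assumes [measurable]: "f \<in> borel_measurable N" "g \<in> borel_measurable N"
  shows "(\<lambda>w. kdens h (f w) (g w)) \<in> borel_measurable N"
  unfolding kdens_def by measurable

lemma kdens_nonneg [simp]: "0 \<le> kdens h x y"
  by (simp add: kdens_def)

lemma nn_integral_euler:
  assumes h: "0 < h" and [measurable]: "F \<in> borel_measurable (borel \<Otimes>\<^sub>M borel)"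
  shows "(\<integral>\<^sup>+x. \<integral>\<^sup>+z. F (x, euler h x z) \<partial>std_gauss \<partial>m)
      = (\<integral>\<^sup>+x. \<integral>\<^sup>+y. ennreal (kdens h x y) * F (x, y) \<partial>lborel \<partial>lborel)"
proof -
  have inner: "(\<integral>\<^sup>+z. F (x, euler h x z) \<partial>std_gauss)
      = (\<integral>\<^sup>+y. ennreal (gauss_dens (2 * h) (y - (x - h *\<^sub>R gU x))) * F (x, y) \<partial>lborel)" for x
  proof -
    have "(\<integral>\<^sup>+z. F (x, euler h x z) \<partial>std_gauss)
        = (\<integral>\<^sup>+y. F (x, y) \<partial>distr std_gauss borel (\<lambda>z. (x - h *\<^sub>R gU x) + sqrt (2 * h) *\<^sub>R z))"
      by (subst nn_integral_distr) (auto simp: euler_def)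
    also have "\<dots> = (\<integral>\<^sup>+y. ennreal (gauss_dens (2 * h) (y - (x - h *\<^sub>R gU x))) * F (x, y) \<partial>lborel)"
      using h by (subst distr_std_gauss_affine) (auto simp: nn_integral_density)
    finally show ?thesis .
  qed
  have "(\<integral>\<^sup>+x. \<integral>\<^sup>+z. F (x, euler h x z) \<partial>std_gauss \<partial>m)
     = (\<integral>\<^sup>+x. ennreal (exp (- U x)) * (\<integral>\<^sup>+y. ennreal (gauss_dens (2 * h) (y - (x - h *\<^sub>R gU x))) * F (x, y) \<partial>lborel) \<partial>lborel)"
    unfolding inner gibbs_def by (rule nn_integral_density) measurable
  also have "\<dots> = (\<integral>\<^sup>+x. \<integral>\<^sup>+y. ennreal (kdens h x y) * F (x, y) \<partial>lborel \<partial>lborel)"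
    by (subst nn_integral_cmult[symmetric]) (auto simp: kdens_def ennreal_mult' mult.assoc)
  finally show ?thesis .
qed

text \<open>The logarithm of \<open>kdens h y x / kdens h x y\<close>, as in a Metropolis acceptance
  rate. The terms not carrying \<open>h\<close> are the error of the trapezoidal rule for
  \<open>U\<close> along the segment.\<close>

definition log_ratio :: "real \<Rightarrow> 'a \<Rightarrow> 'a \<Rightarrow> real" where
  "log_ratio h x y = U x - U y + (y - x) \<bullet> (gU x + gU y) / 2 + h / 4 * ((norm (gU x))\<^sup>2 - (norm (gU y))\<^sup>2)"

lemma log_ratio_measurable [measurable (raw)]:
  assumes [measurable]: "f \<in> borel_measurable N" "g \<in> borel_measurable N"
  shows "(\<lambda>w. log_ratio h (f w) (g w)) \<in> borel_measurable N"
  unfolding log_ratio_def by measurable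

lemma kdens_swap:
  assumes "0 < h"
  shows "kdens h y x = kdens h x y * exp (log_ratio h x y)"
proof -
  have "- (norm (x - (y - h *\<^sub>R gU y)))\<^sup>2 / (2 * (2 * h)) =
     - (norm (y - (x - h *\<^sub>R gU x)))\<^sup>2 / (2 * (2 * h)) + (y - x) \<bullet> (gU x + gU y) / 2
       + h / 4 * ((norm (gU x))\<^sup>2 - (norm (gU y))\<^sup>2)"
    using assms unfolding power2_norm_eq_inner
    by (simp add: inner_diff_left inner_diff_right inner_add_left inner_add_right inner_commute field_simps power2_eq_square)
  then show ?thesis
    by (simp add: kdens_def gauss_dens_def log_ratio_def exp_add[symmetric])
qed

text \<open>The mean value theorem yields a point \<open>c\<close> on the segment. The distances of
  \<open>x\<close> and \<open>y\<close> to \<open>c\<close> add up to the length of the segment, so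
  the two Lipschitz errors of the gradient sum to \<open>M * norm (y - x)\<close>.\<close>

lemma U_trapezoid: "\<bar>U x - U y + (y - x) \<bullet> (gU x + gU y) / 2\<bar> \<le> M / 2 * (norm (y - x))\<^sup>2"
proof -
  define \<gamma> where "\<gamma> = (\<lambda>t::real. x + t *\<^sub>R (y - x))"
  have d: "((\<lambda>t. U (\<gamma> t)) has_derivative (\<lambda>s. gU (\<gamma> t) \<bullet> (s *\<^sub>R (y - x)))) (at t)" for t
    unfolding \<gamma>_def
    by (rule has_derivative_compose[of "\<lambda>t. x + t *\<^sub>R (y - x)" "\<lambda>s. s *\<^sub>R (y - x)" t UNIV U "\<lambda>v. gU (\<gamma> t) \<bullet> v", unfolded \<gamma>_def])
       (auto intro!: derivative_eq_intros dU)
  obtain \<xi> where \<xi>: "0 < \<xi>" "\<xi> < 1" "U (\<gamma> 1) - U (\<gamma> 0) = gU (\<gamma> \<xi>) \<bullet> ((1 - 0) *\<^sub>R (y - x))"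
  proof (rule mvt[of 0 1 "\<lambda>t. U (\<gamma> t)" "\<lambda>t s. gU (\<gamma> t) \<bullet> (s *\<^sub>R (y - x))"])
    show "continuous_on {0..1} (\<lambda>t. U (\<gamma> t))"
      using d by (intro has_derivative_continuous_on) (auto intro: has_derivative_at_withinI)
  qed (use d that in auto)
  define c where "c = \<gamma> \<xi>"
  have e: "U y - U x = gU c \<bullet> (y - x)" using \<xi>(3) by (simp add: \<gamma>_def c_def)
  have cx: "norm (gU x - gU c) \<le> M * (\<xi> * norm (y - x))"
    using gU_diff[of x c] \<xi> by (simp add: c_def \<gamma>_def)
  have cy: "norm (gU y - gU c) \<le> M * ((1 - \<xi>) * norm (y - x))"
  proof -
    have "y - c = (1 - \<xi>) *\<^sub>R (y - x)" by (simp add: c_def \<gamma>_def algebra_simps)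
    then show ?thesis using gU_diff[of y c] \<xi> by simp
  qed
  have "U x - U y + (y - x) \<bullet> (gU x + gU y) / 2 = (y - x) \<bullet> ((gU x - gU c) + (gU y - gU c)) / 2"
    using e by (simp add: inner_add_right inner_diff_right inner_commute field_simps)
  also have "\<bar>\<dots>\<bar> \<le> norm (y - x) * (norm (gU x - gU c) + norm (gU y - gU c)) / 2"
  proof -
    have "\<bar>(y - x) \<bullet> ((gU x - gU c) + (gU y - gU c))\<bar> \<le> norm (y - x) * norm ((gU x - gU c) + (gU y - gU c))"
      by (rule Cauchy_Schwarz_ineq2)
    also have "\<dots> \<le> norm (y - x) * (norm (gU x - gU c) + norm (gU y - gU c))"
      by (intro mult_left_mono norm_triangle_ineq) auto
    finally show ?thesis by simp
  qed
  also have "\<dots> \<le> norm (y - x) * (M * (\<xi> * norm (y - x)) + M * ((1 - \<xi>) * norm (y - x))) / 2"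
    by (intro divide_right_mono mult_left_mono add_mono cx cy) auto
  also have "\<dots> = M / 2 * (norm (y - x))\<^sup>2" by (simp add: power2_eq_square algebra_simps)
  finally show ?thesis .
qed

lemma log_ratio_bound:
  assumes "0 < h" "h \<le> 1"
  shows "\<bar>log_ratio h x y\<bar> \<le> (M / 2 + M\<^sup>2 / 4) * (norm (y - x))\<^sup>2 + h * M / 2 * norm (y - x) * norm (gU x)"
proof -
  have "\<bar>(norm (gU x))\<^sup>2 - (norm (gU y))\<^sup>2\<bar> = \<bar>norm (gU x) - norm (gU y)\<bar> * (norm (gU x) + norm (gU y))"
  proof -
    have "(norm (gU x))\<^sup>2 - (norm (gU y))\<^sup>2 = (norm (gU x) - norm (gU y)) * (norm (gU x) + norm (gU y))"
      by (simp add: power2_eq_square algebra_simps)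
    then show ?thesis by (simp add: abs_mult)
  qed
  also have "\<dots> \<le> (M * norm (y - x)) * (2 * norm (gU x) + M * norm (y - x))"
  proof (rule mult_mono)
    show "\<bar>norm (gU x) - norm (gU y)\<bar> \<le> M * norm (y - x)"
      using norm_triangle_ineq3[of "gU x" "gU y"] gU_diff[of x y] by (simp add: norm_minus_commute)
    show "norm (gU x) + norm (gU y) \<le> 2 * norm (gU x) + M * norm (y - x)"
      using norm_triangle_ineq2[of "gU y" "gU x"] gU_diff[of y x] by simp
  qed (use M in auto)
  finally have "h / 4 * \<bar>(norm (gU x))\<^sup>2 - (norm (gU y))\<^sup>2\<bar> \<le> h / 4 * ((M * norm (y - x)) * (2 * norm (gU x) + M * norm (y - x)))"
    using assms by (intro mult_left_mono) auto
  also have "\<dots> = h * (M\<^sup>2 / 4 * (norm (y - x))\<^sup>2) + h * M / 2 * norm (y - x) * norm (gU x)"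
    by (simp add: power2_eq_square algebra_simps)
  also have "\<dots> \<le> 1 * (M\<^sup>2 / 4 * (norm (y - x))\<^sup>2) + h * M / 2 * norm (y - x) * norm (gU x)"
    using assms by (intro add_right_mono mult_right_mono) auto
  finally have "\<bar>h / 4 * ((norm (gU x))\<^sup>2 - (norm (gU y))\<^sup>2)\<bar>
      \<le> M\<^sup>2 / 4 * (norm (y - x))\<^sup>2 + h * M / 2 * norm (y - x) * norm (gU x)"
    using assms by (simp add: abs_mult)
  then show ?thesis
    using U_trapezoid[of x y] unfolding log_ratio_def distrib_right by linarith
qed

text \<open>The displacement is of order \<open>sqrt h\<close> and the log ratio of order
  \<open>h\<close>; their product is the local error that remains summable over about
  \<open>1 / h\<close> steps. The inequality \<open>(a + b)^3 \<le> 4 (a^3 + b^3)\<close> separates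
  position and noise, so that each can be integrated on its own.\<close>

lemma displacement_log_ratio:
  assumes h: "0 < h" "h \<le> 1"
  shows "norm (euler h x z - x) * \<bar>log_ratio h x (euler h x z)\<bar>
     \<le> h * sqrt h * ((M + M\<^sup>2 / 4) * 4 * ((1 + norm (gU x)) ^ 3 + 8 * norm z ^ 3))"
proof -
  define S where "S = 1 + norm (gU x) + 2 * norm z"
  define d where "d = norm (euler h x z - x)"
  have S: "S \<ge> 1" "norm (gU x) \<le> S" by (auto simp: S_def)
  have d: "0 \<le> d" "d \<le> sqrt h * S" using euler_displacement[OF h] by (auto simp: d_def S_def)
  have d2: "d\<^sup>2 \<le> h * S\<^sup>2"
    using power_mono[OF d(2,1), of 2] h by (simp add: power_mult_distrib)
  have "d * \<bar>log_ratio h x (euler h x z)\<bar> \<le> (sqrt h * S) * ((M / 2 + M\<^sup>2 / 4) * d\<^sup>2 + h * M / 2 * d * norm (gU x))"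
    using d log_ratio_bound[OF h, of x "euler h x z"] h M S
    by (intro mult_mono) (auto simp: d_def)
  also have "\<dots> \<le> (sqrt h * S) * ((M / 2 + M\<^sup>2 / 4) * (h * S\<^sup>2) + h * M / 2 * S * S)"
  proof -
    have "sqrt h * S \<le> 1 * S" using h S by (intro mult_right_mono) auto
    then have "d \<le> S" using d by linarith
    then show ?thesis using h S M d d2
      by (intro mult_left_mono add_mono mult_mono) auto
  qed
  also have "\<dots> = h * sqrt h * ((M + M\<^sup>2 / 4) * S ^ 3)"
    by (simp add: power2_eq_square power3_eq_cube algebra_simps)
  also have "\<dots> \<le> h * sqrt h * ((M + M\<^sup>2 / 4) * (4 * ((1 + norm (gU x)) ^ 3 + 8 * norm z ^ 3)))"
  proof -
    define a b where "a = 1 + norm (gU x)" and "b = 2 * norm z"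
    have ab: "0 \<le> a" "0 \<le> b" by (auto simp: a_def b_def)
    have "4 * (a ^ 3 + b ^ 3) - (a + b) ^ 3 = 3 * (a + b) * (a - b)\<^sup>2"
      by (simp add: power3_eq_cube power2_eq_square algebra_simps)
    moreover have "0 \<le> 3 * (a + b) * (a - b)\<^sup>2" using ab by simp
    ultimately have "(a + b) ^ 3 \<le> 4 * (a ^ 3 + b ^ 3)" by linarith
    then have "S ^ 3 \<le> 4 * ((1 + norm (gU x)) ^ 3 + 8 * norm z ^ 3)"
      by (simp add: S_def a_def b_def power_mult_distrib)
    then show ?thesis using h M by (intro mult_left_mono) auto
  qed
  finally show ?thesis unfolding d_def by (simp only: mult.assoc)
qed

lemma gU_power_integrable: "integrable m (\<lambda>x. (1 + norm (gU x)) ^ n)"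
proof (rule Bochner_Integration.integrable_bound)
  define c where "c = 1 + norm (gU 0)"
  show "integrable m (\<lambda>x. 2 ^ n * (c ^ n + M ^ n * norm x ^ n))"
    by (intro integrable_mult_right Bochner_Integration.integrable_add norm_power_integrable) simp
  have "(1 + norm (gU x)) ^ n \<le> 2 ^ n * (c ^ n + M ^ n * norm x ^ n)" for x
  proof -
    have "1 + norm (gU x) \<le> c + M * norm x"
      using gU_diff[of x 0] norm_triangle_ineq2[of "gU x" "gU 0"] by (simp add: c_def)
    also have "\<dots> \<le> 2 * max c (M * norm x)" by linarith
    finally have "(1 + norm (gU x)) ^ n \<le> (2 * max c (M * norm x)) ^ n" by (intro power_mono) auto
    also have "\<dots> = 2 ^ n * max c (M * norm x) ^ n" by (simp add: power_mult_distrib)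
    also have "max c (M * norm x) ^ n \<le> c ^ n + (M * norm x) ^ n"
      using M by (auto simp: max_def c_def add_nonneg_nonneg)
    finally show ?thesis by (simp add: power_mult_distrib)
  qed
  then show "AE x in m. norm ((1 + norm (gU x)) ^ n) \<le> norm (2 ^ n * (c ^ n + M ^ n * norm x ^ n))"
    using M by (auto intro!: AE_I2 simp: c_def abs_of_nonneg add_nonneg_nonneg)
qed measurable

definition inv_const :: real where
  "inv_const = (M + M\<^sup>2 / 4) * 4 * ((\<integral>x. (1 + norm (gU x)) ^ 3 \<partial>m) + 8 * (\<integral>z. norm (z::'a) ^ 3 \<partial>std_gauss))"

lemma inv_const_nonneg: "0 \<le> inv_const"
  unfolding inv_const_def using M by (intro mult_nonneg_nonneg add_nonneg_nonneg) auto

text \<open>The symmetric kernel \<open>min (k(x,y)) (k(y,x))\<close> leaves \<open>m\<close> invariant up to its missing mass,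
  and that missing mass only costs the displacement times the logarithm of the density ratio.\<close>

lemma Q_approx_invariant:
  assumes u: "unit_lip \<epsilon> L u" and e: "0 \<le> \<epsilon>" and h: "0 < h" "h \<le> 1"
  shows "(\<integral>x. Q h u x \<partial>m) \<le> (\<integral>x. u x \<partial>m) + L * inv_const * (h * sqrt h)"
proof -
  note uD = unit_lipD[OF u]
  have [measurable]: "u \<in> borel_measurable borel" by (rule unit_lip_measurable[OF u])
  have u0: "0 \<le> u x" for x using uD(1)[of x] e by linarith
  have L: "0 \<le> L" by (rule uD(4))
  define a where "a = (\<lambda>x y. min (kdens h x y) (kdens h y x))"
  have a: "0 \<le> a x y" "a x y \<le> kdens h x y" "a x y = a y x" for x y by (auto simp: a_def)
  have ka: "kdens h x y - a x y \<le> kdens h x y * \<bar>log_ratio h x y\<bar>" for x y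
  proof (cases "log_ratio h x y \<ge> 0")
    case True
    then have "kdens h x y * 1 \<le> kdens h y x"
      unfolding kdens_swap[OF h(1), of y x] by (intro mult_left_mono) auto
    then show ?thesis by (simp add: a_def)
  next
    case False
    have "kdens h x y * (1 + log_ratio h x y) \<le> kdens h y x"
      unfolding kdens_swap[OF h(1), of y x] by (intro mult_left_mono exp_ge_add_one_self) auto
    moreover have "kdens h x y * log_ratio h x y \<le> 0" using False by (simp add: mult_nonneg_nonpos)
    ultimately show ?thesis using False by (auto simp: a_def algebra_simps min_def)
  qed
  define W where "W = (\<lambda>x z. h * sqrt h * ((M + M\<^sup>2 / 4) * 4 * ((1 + norm (gU x)) ^ 3 + 8 * norm (z::'a) ^ 3)))"
  have W0: "0 \<le> W x z" for x z
    unfolding W_def using h M by (intro mult_nonneg_nonneg add_nonneg_nonneg) auto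
  have "(\<integral>\<^sup>+x. ennreal (Q h u x) \<partial>m) = (\<integral>\<^sup>+x. \<integral>\<^sup>+z. ennreal (u (euler h x z)) \<partial>std_gauss \<partial>m)"
    unfolding Q_def using unit_lip_integrable_euler[OF u e] u0
    by (intro nn_integral_cong nn_integral_eq_integral[symmetric]) auto
  also have "\<dots> = (\<integral>\<^sup>+x. \<integral>\<^sup>+y. ennreal (kdens h x y) * ennreal (u y) \<partial>lborel \<partial>lborel)"
    using nn_integral_euler[OF h(1), of "\<lambda>p. ennreal (u (snd p))"] by simp
  also have "\<dots> \<le> (\<integral>\<^sup>+x. \<integral>\<^sup>+y. ennreal (a x y * u y) + (ennreal ((kdens h x y - a x y) * u x)
        + ennreal (kdens h x y) * ennreal (L * (norm (y - x) * \<bar>log_ratio h x y\<bar>))) \<partial>lborel \<partial>lborel)"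
  proof (intro nn_integral_mono)
    fix x y
    \<comment> \<open>Only the excess \<open>kdens h x y - a x y\<close> sees the difference between
      \<open>u y\<close> and \<open>u x\<close>. The Lipschitz bound on that difference supplies the
      displacement factor that brings the error below order \<open>h\<close>.\<close>
    have "kdens h x y * u y = a x y * u y + (kdens h x y - a x y) * u y" by (simp add: algebra_simps)
    also have "(kdens h x y - a x y) * u y \<le> (kdens h x y - a x y) * (u x + L * norm (y - x))"
      using uD(5)[of y x] a(2)[of x y] by (intro mult_left_mono) (auto simp: dist_norm)
    also have "\<dots> = (kdens h x y - a x y) * u x + (kdens h x y - a x y) * (L * norm (y - x))"
      by (simp add: algebra_simps)
    also have "(kdens h x y - a x y) * (L * norm (y - x)) \<le> (kdens h x y * \<bar>log_ratio h x y\<bar>) * (L * norm (y - x))"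
      using L by (intro mult_right_mono ka) auto
    finally have "kdens h x y * u y \<le> a x y * u y + ((kdens h x y - a x y) * u x
        + kdens h x y * (L * (norm (y - x) * \<bar>log_ratio h x y\<bar>)))"
      by (simp add: mult_ac)
    moreover have "0 \<le> (kdens h x y - a x y) * u x" using a(2)[of x y] u0 by simp
    ultimately show "ennreal (kdens h x y) * ennreal (u y) \<le> ennreal (a x y * u y) + (ennreal ((kdens h x y - a x y) * u x)
        + ennreal (kdens h x y) * ennreal (L * (norm (y - x) * \<bar>log_ratio h x y\<bar>)))"
      using a(1) u0 L by (simp add: ennreal_mult'[symmetric] ennreal_plus[symmetric] ennreal_leI del: ennreal_plus)
  qed
  also have "\<dots> = (\<integral>\<^sup>+x. \<integral>\<^sup>+y. ennreal (a x y * u y) \<partial>lborel \<partial>lborel)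
      + ((\<integral>\<^sup>+x. \<integral>\<^sup>+y. ennreal ((kdens h x y - a x y) * u x) \<partial>lborel \<partial>lborel)
      + (\<integral>\<^sup>+x. \<integral>\<^sup>+y. ennreal (kdens h x y) * ennreal (L * (norm (y - x) * \<bar>log_ratio h x y\<bar>)) \<partial>lborel \<partial>lborel))"
    unfolding a_def by (simp add: nn_integral_add)
  also have "(\<integral>\<^sup>+x. \<integral>\<^sup>+y. ennreal (a x y * u y) \<partial>lborel \<partial>lborel)
      = (\<integral>\<^sup>+y. \<integral>\<^sup>+x. ennreal (a x y * u y) \<partial>lborel \<partial>lborel)"
    unfolding a_def by (rule lborel_pair.Fubini') (simp add: case_prod_beta)
  also have "\<dots> = (\<integral>\<^sup>+x. \<integral>\<^sup>+y. ennreal (a x y * u x) \<partial>lborel \<partial>lborel)"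
    by (simp add: a(3))
  also have "(\<integral>\<^sup>+x. \<integral>\<^sup>+y. ennreal (kdens h x y) * ennreal (L * (norm (y - x) * \<bar>log_ratio h x y\<bar>)) \<partial>lborel \<partial>lborel)
      = (\<integral>\<^sup>+x. \<integral>\<^sup>+z. ennreal (L * (norm (euler h x z - x) * \<bar>log_ratio h x (euler h x z)\<bar>)) \<partial>std_gauss \<partial>m)"
    using nn_integral_euler[OF h(1), of "\<lambda>p. ennreal (L * (norm (snd p - fst p) * \<bar>log_ratio h (fst p) (snd p)\<bar>))"]
    by simp
  also have "\<dots> \<le> (\<integral>\<^sup>+x. \<integral>\<^sup>+z. ennreal (L * W x z) \<partial>std_gauss \<partial>m)"
    unfolding W_def using L by (intro nn_integral_mono ennreal_leI mult_left_mono displacement_log_ratio h)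
  also have "\<dots> = ennreal (L * inv_const * (h * sqrt h))"
  proof -
    define b where "b = L * (h * sqrt h * ((M + M\<^sup>2 / 4) * 4))"
    have b: "0 \<le> b" unfolding b_def using L h M by (intro mult_nonneg_nonneg) auto
    have z3: "integrable std_gauss (\<lambda>z::'a. norm z ^ 3)" by (rule std_gauss_norm_power_integrable)
    have LW: "L * W x z = b * (1 + norm (gU x)) ^ 3 + b * 8 * norm z ^ 3" for x z
      unfolding W_def b_def by (simp add: algebra_simps)
    have i1: "(\<integral>\<^sup>+z. ennreal (L * W x z) \<partial>std_gauss)
       = ennreal (b * (1 + norm (gU x)) ^ 3 + b * 8 * (\<integral>z. norm (z::'a) ^ 3 \<partial>std_gauss))" for x
    proof -
      have "(\<integral>\<^sup>+z. ennreal (L * W x z) \<partial>std_gauss) = ennreal (\<integral>z. L * W x z \<partial>std_gauss)"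
      proof (rule nn_integral_eq_integral)
        show "integrable std_gauss (\<lambda>z. L * W x z)" using z3 by (simp add: LW)
        show "AE z in std_gauss. 0 \<le> L * W x z" using L W0 by simp
      qed
      then show ?thesis using z3 by (simp add: LW)
    qed
    have z3n: "0 \<le> (\<integral>z. norm (z::'a) ^ 3 \<partial>std_gauss)" by simp
    have "(\<integral>\<^sup>+x. \<integral>\<^sup>+z. ennreal (L * W x z) \<partial>std_gauss \<partial>m)
       = ennreal (\<integral>x. b * (1 + norm (gU x)) ^ 3 + b * 8 * (\<integral>z. norm (z::'a) ^ 3 \<partial>std_gauss) \<partial>m)"
      unfolding i1 using gU_power_integrable[of 3] b z3n
      by (intro nn_integral_eq_integral) (auto intro!: AE_I2 add_nonneg_nonneg mult_nonneg_nonneg)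
    also have "(\<integral>x. b * (1 + norm (gU x)) ^ 3 + b * 8 * (\<integral>z. norm (z::'a) ^ 3 \<partial>std_gauss) \<partial>m) = L * inv_const * (h * sqrt h)"
      using gU_power_integrable[of 3] by (simp add: inv_const_def b_def algebra_simps)
    finally show ?thesis .
  qed
  \<comment> \<open>After the swap both the symmetric part and the excess carry \<open>u x\<close>,
    so they recombine to the full kernel, which has mass one in the second variable.\<close>
  also have "(\<integral>\<^sup>+x. \<integral>\<^sup>+y. ennreal (a x y * u x) \<partial>lborel \<partial>lborel)
      + ((\<integral>\<^sup>+x. \<integral>\<^sup>+y. ennreal ((kdens h x y - a x y) * u x) \<partial>lborel \<partial>lborel) + ennreal (L * inv_const * (h * sqrt h)))
     = (\<integral>\<^sup>+x. \<integral>\<^sup>+y. ennreal (a x y * u x) + ennreal ((kdens h x y - a x y) * u x) \<partial>lborel \<partial>lborel) + ennreal (L * inv_const * (h * sqrt h))"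
    unfolding a_def by (simp add: nn_integral_add add.assoc)
  also have "(\<integral>\<^sup>+x. \<integral>\<^sup>+y. ennreal (a x y * u x) + ennreal ((kdens h x y - a x y) * u x) \<partial>lborel \<partial>lborel)
     = (\<integral>\<^sup>+x. \<integral>\<^sup>+y. ennreal (kdens h x y) * ennreal (u x) \<partial>lborel \<partial>lborel)"
  proof (intro nn_integral_cong)
    fix x y
    have "a x y * u x + (kdens h x y - a x y) * u x = kdens h x y * u x" by (simp add: algebra_simps)
    then show "ennreal (a x y * u x) + ennreal ((kdens h x y - a x y) * u x) = ennreal (kdens h x y) * ennreal (u x)"
      using a(1,2)[of x y] u0 by (simp add: ennreal_mult'[symmetric] ennreal_plus[symmetric] del: ennreal_plus)
  qed
  also have "\<dots> = (\<integral>\<^sup>+x. \<integral>\<^sup>+z. ennreal (u x) \<partial>(std_gauss::'a measure) \<partial>m)"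
    using nn_integral_euler[OF h(1), of "\<lambda>p. ennreal (u (fst p))"] by simp
  also have "\<dots> = (\<integral>\<^sup>+x. ennreal (u x) \<partial>m)"
    by (simp add: std_gauss.emeasure_space_1[simplified])
  finally have "(\<integral>\<^sup>+x. ennreal (Q h u x) \<partial>m) \<le> (\<integral>\<^sup>+x. ennreal (u x) \<partial>m) + ennreal (L * inv_const * (h * sqrt h))"
    by (simp add: add_mono)
  moreover have "integrable m (Q h u)" "\<And>x. 0 \<le> Q h u x"
    using unit_lip_integrable[OF unit_lip_Q[OF u e] e] h unit_lipD(1)[OF unit_lip_Q[OF u e]] e
    by (auto intro: order.trans)
  moreover have "integrable m u" by (rule unit_lip_integrable[OF u e])
  ultimately show ?thesis
    using u0 L inv_const_nonneg h
    by (simp add: nn_integral_eq_integral ennreal_plus[symmetric] integral_nonneg_AE del: ennreal_plus)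
qed

end

subsection \<open>Hypercontractivity of the Euler kernel\<close>

lemma x_ln_x_lipschitz:
  assumes "0 < \<kappa>" "\<kappa> \<le> a" "a \<le> 1" "\<kappa> \<le> b" "b \<le> (1::real)"
  shows "\<bar>a * ln a - b * ln b\<bar> \<le> (1 + \<bar>ln \<kappa>\<bar>) * \<bar>a - b\<bar>"
proof -
  have lt: "\<bar>b * ln b - a * ln a\<bar> \<le> (1 + \<bar>ln \<kappa>\<bar>) * \<bar>b - a\<bar>" if "\<kappa> \<le> a" "a < b" "b \<le> 1" for a b
  proof -
    have "\<exists>z. z > a \<and> z < b \<and> b * ln b - a * ln a = (b - a) * (ln z + 1)"
      using that assms(1) by (intro MVT2) (auto intro!: derivative_eq_intros)
    then obtain z where z: "z > a" "z < b" "b * ln b - a * ln a = (b - a) * (ln z + 1)" by blast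
    have "ln \<kappa> \<le> ln z" "ln z \<le> 0" using z that assms(1) by auto
    then have "\<bar>ln z + 1\<bar> \<le> 1 + \<bar>ln \<kappa>\<bar>" by linarith
    then have "\<bar>b - a\<bar> * \<bar>ln z + 1\<bar> \<le> \<bar>b - a\<bar> * (1 + \<bar>ln \<kappa>\<bar>)" by (intro mult_left_mono) auto
    then show ?thesis by (simp add: z(3) abs_mult mult.commute)
  qed
  show ?thesis
    using lt[of a b] lt[of b a] assms by (cases a b rule: linorder_cases) (auto simp: abs_minus_commute)
qed

text \<open>The log-Sobolev inequality will control the entropy of a smoothed function, while the
  growth of the exponent needs that of the original one; the exchange costs the \<open>L^1\<close>
  distance. The lower bound \<open>\<kappa>\<close> makes \<open>x * ln x\<close> Lipschitz, which
  is used once under the integral and once for the total masses, hence the factor 2.\<close>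

lemma (in prob_space) Ent_continuity:
  fixes w1 w2 :: "'a \<Rightarrow> real"
  assumes [measurable]: "w1 \<in> borel_measurable M" "w2 \<in> borel_measurable M"
    and k: "0 < \<kappa>" and w1: "\<And>x. \<kappa> \<le> w1 x" "\<And>x. w1 x \<le> 1" and w2: "\<And>x. \<kappa> \<le> w2 x" "\<And>x. w2 x \<le> 1"
  shows "Ent M w2 \<le> Ent M w1 + 2 * (1 + \<bar>ln \<kappa>\<bar>) * (\<integral>x. \<bar>w1 x - w2 x\<bar> \<partial>M)"
proof -
  define l where "l = 1 + \<bar>ln \<kappa>\<bar>"
  have i: "integrable M w" "integrable M (\<lambda>x. w x * ln (w x))" "\<kappa> \<le> (\<integral>x. w x \<partial>M)" "(\<integral>x. w x \<partial>M) \<le> 1"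
    if [measurable]: "w \<in> borel_measurable M" and w: "\<And>x. \<kappa> \<le> w x" "\<And>x. w x \<le> 1" for w
  proof -
    have abs: "\<bar>w x\<bar> \<le> 1" for x using w[of x] k by auto
    then show 1: "integrable M w" by (intro integrable_bounded) auto
    show "integrable M (\<lambda>x. w x * ln (w x))"
    proof (rule integrable_bounded)
      show "\<bar>w x * ln (w x)\<bar> \<le> l * 1" for x
      proof -
        have "\<bar>w x * ln (w x) - 1 * ln 1\<bar> \<le> l * \<bar>w x - 1\<bar>"
          unfolding l_def using k w(1)[of x] w(2)[of x] order.trans[OF w(1)[of x] w(2)[of x]]
          by (intro x_ln_x_lipschitz) linarith+
        also have "\<dots> \<le> l * 1"
        proof (rule mult_left_mono)
          show "\<bar>w x - 1\<bar> \<le> 1" using w(1)[of x] w(2)[of x] k by linarith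
        qed (simp add: l_def)
        finally show ?thesis by simp
      qed
    qed simp
    have "(\<integral>x. \<kappa> \<partial>M) \<le> (\<integral>x. w x \<partial>M)" using 1 w by (intro integral_mono) auto
    then show "\<kappa> \<le> (\<integral>x. w x \<partial>M)" by (simp add: prob_space)
    have "(\<integral>x. w x \<partial>M) \<le> (\<integral>x. 1 \<partial>M)" using 1 w by (intro integral_mono) auto
    then show "(\<integral>x. w x \<partial>M) \<le> 1" by (simp add: prob_space)
  qed
  note i1 = i[OF assms(1) w1] and i2 = i[OF assms(2) w2]
  define d where "d = (\<integral>x. \<bar>w1 x - w2 x\<bar> \<partial>M)"
  have "(\<integral>x. w2 x * ln (w2 x) \<partial>M) - (\<integral>x. w1 x * ln (w1 x) \<partial>M) = (\<integral>x. w2 x * ln (w2 x) - w1 x * ln (w1 x) \<partial>M)"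
    using i1 i2 by simp
  also have "\<dots> \<le> (\<integral>x. l * \<bar>w1 x - w2 x\<bar> \<partial>M)"
  proof (rule integral_mono)
    show "w2 x * ln (w2 x) - w1 x * ln (w1 x) \<le> l * \<bar>w1 x - w2 x\<bar>" for x
      using x_ln_x_lipschitz[OF k w1(1)[of x] w1(2)[of x] w2(1)[of x] w2(2)[of x]] by (simp add: l_def)
  qed (use i1 i2 in auto)
  also have "\<dots> = l * d" by (simp add: d_def)
  finally have a: "(\<integral>x. w2 x * ln (w2 x) \<partial>M) - (\<integral>x. w1 x * ln (w1 x) \<partial>M) \<le> l * d" .
  have "\<bar>(\<integral>x. w1 x \<partial>M) - (\<integral>x. w2 x \<partial>M)\<bar> = \<bar>\<integral>x. w1 x - w2 x \<partial>M\<bar>" using i1 i2 by simp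
  also have "\<dots> \<le> d" unfolding d_def by (rule integral_abs_bound)
  finally have "l * \<bar>(\<integral>x. w1 x \<partial>M) - (\<integral>x. w2 x \<partial>M)\<bar> \<le> l * d" by (intro mult_left_mono) (auto simp: l_def)
  moreover have "\<bar>(\<integral>x. w1 x \<partial>M) * ln (\<integral>x. w1 x \<partial>M) - (\<integral>x. w2 x \<partial>M) * ln (\<integral>x. w2 x \<partial>M)\<bar>
      \<le> l * \<bar>(\<integral>x. w1 x \<partial>M) - (\<integral>x. w2 x \<partial>M)\<bar>"
    unfolding l_def using i1 i2 by (intro x_ln_x_lipschitz k)
  ultimately show ?thesis using a unfolding Ent_def d_def[symmetric] l_def[symmetric] by linarith
qed

context langevin
begin

text \<open>The chain rule through the drift map \<open>T\<close>, whose derivative has norm at most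
  \<open>1 + h * M\<close>, reduces everything to Gaussian smoothing with variance
  \<open>2 * h\<close>. The bracket on the right is the variance of \<open>G\<close> under one Euler
  step, which enters through \<open>gauss_bessel\<close>.\<close>

lemma Q_gradient:
  assumes G: "unit_lip \<epsilon> L G" and e: "0 \<le> \<epsilon>" and h: "0 < h"
  obtains gQ where "\<And>x. (Q h G has_derivative (\<lambda>v. gQ x \<bullet> v)) (at x)" "continuous_on UNIV gQ"
    "\<And>x. (norm (gQ x))\<^sup>2 \<le> (1 + h * M)\<^sup>2 / (2 * h) * (Q h (\<lambda>y. (G y)\<^sup>2) x - (Q h G x)\<^sup>2)"
proof
  define \<sigma> where "\<sigma> = sqrt (2 * h)"
  have \<sigma>: "\<sigma> > 0" "\<sigma>\<^sup>2 = 2 * h" using h by (auto simp: \<sigma>_def)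
  define T where "T = (\<lambda>x. x - h *\<^sub>R gU x)"
  have eul: "euler h x z = T x + \<sigma> *\<^sub>R z" for x z by (simp add: euler_def T_def \<sigma>_def)
  have [measurable]: "G \<in> borel_measurable borel" by (rule unit_lip_measurable[OF G])
  have bd: "\<bar>G x\<bar> \<le> 1" for x by (rule unit_lip_abs_le[OF G e])
  define D where "D = (\<lambda>y. (\<integral>z. G (y + \<sigma> *\<^sub>R z) *\<^sub>R z \<partial>std_gauss) /\<^sub>R \<sigma>)"
  \<comment> \<open>The adjoint of the derivative of \<open>T\<close> applied to
    \<open>D (T x)\<close>, written in coordinates.\<close>
  define gQ where "gQ = (\<lambda>x. \<Sum>b\<in>Basis. (D (T x) \<bullet> (b - h *\<^sub>R blinfun_apply (HU x) b)) *\<^sub>R b)"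
  have gQ: "gQ x \<bullet> v = D (T x) \<bullet> (v - h *\<^sub>R blinfun_apply (HU x) v)" for x v
  proof -
    have lin: "linear (\<lambda>v. D (T x) \<bullet> (v - h *\<^sub>R blinfun_apply (HU x) v))"
      by (intro linearI) (auto simp: algebra_simps blinfun.add_right blinfun.scaleR_right)
    have "D (T x) \<bullet> (v - h *\<^sub>R blinfun_apply (HU x) v)
        = (\<Sum>b\<in>Basis. (v \<bullet> b) * (D (T x) \<bullet> (b - h *\<^sub>R blinfun_apply (HU x) b)))"
      using linear_sum[OF lin, of "\<lambda>b. (v \<bullet> b) *\<^sub>R b" Basis] linear_scale[OF lin]
      by (simp add: euclidean_representation)
    also have "\<dots> = gQ x \<bullet> v"
      unfolding gQ_def inner_sum_left by (intro sum.cong) (auto simp: inner_commute)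
    finally show ?thesis ..
  qed
  have dT: "(T has_derivative (\<lambda>v. v - h *\<^sub>R blinfun_apply (HU x) v)) (at x)" for x
    unfolding T_def by (auto intro!: derivative_eq_intros dgU)
  have QG: "Q h G = (\<lambda>x. \<integral>z. G (T x + \<sigma> *\<^sub>R z) \<partial>std_gauss)"
    by (simp add: Q_def eul fun_eq_iff)
  show "(Q h G has_derivative (\<lambda>v. gQ x \<bullet> v)) (at x)" for x
  proof -
    have "((\<lambda>y. \<integral>z. G (y + \<sigma> *\<^sub>R z) \<partial>std_gauss) has_derivative (\<lambda>v. D (T x) \<bullet> v)) (at (T x))"
      unfolding D_def using \<sigma> bd by (intro gauss_smoothing_has_derivative[where C=1]) auto
    from has_derivative_compose[OF dT this] show ?thesis unfolding QG gQ .
  qed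
  have contT: "continuous_on UNIV T"
    unfolding T_def by (intro continuous_intros gU_continuous)
  have contD: "continuous_on UNIV D"
    unfolding D_def by (intro continuous_intros gauss_smoothing_gradient_continuous[OF unit_lipD(3)[OF G] bd])
  show "continuous_on UNIV gQ"
    unfolding gQ_def
    by (intro continuous_intros contHU continuous_on_compose2[OF contD contT]) auto
  show "(norm (gQ x))\<^sup>2 \<le> (1 + h * M)\<^sup>2 / (2 * h) * (Q h (\<lambda>y. (G y)\<^sup>2) x - (Q h G x)\<^sup>2)" for x
  proof -
    \<comment> \<open>Pairing with \<open>gQ x\<close> itself needs only the norm of the derivative
      of \<open>T\<close>, without passing to its adjoint.\<close>
    have "(norm (gQ x))\<^sup>2 = D (T x) \<bullet> (gQ x - h *\<^sub>R blinfun_apply (HU x) (gQ x))"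
      unfolding gQ[symmetric] by (simp add: power2_norm_eq_inner)
    also have "\<dots> \<le> norm (D (T x)) * norm (gQ x - h *\<^sub>R blinfun_apply (HU x) (gQ x))"
      by (rule norm_cauchy_schwarz)
    also have "\<dots> \<le> norm (D (T x)) * ((1 + h * M) * norm (gQ x))"
    proof (rule mult_left_mono)
      have "norm (blinfun_apply (HU x) (gQ x)) \<le> M * norm (gQ x)"
        by (rule order.trans[OF norm_blinfun]) (auto intro!: mult_right_mono HU)
      then have "h * norm (blinfun_apply (HU x) (gQ x)) \<le> h * (M * norm (gQ x))"
        using h by (intro mult_left_mono) auto
      then show "norm (gQ x - h *\<^sub>R blinfun_apply (HU x) (gQ x)) \<le> (1 + h * M) * norm (gQ x)"
        using norm_triangle_ineq4[of "gQ x" "h *\<^sub>R blinfun_apply (HU x) (gQ x)"] h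
        unfolding distrib_right norm_scaleR mult.assoc by linarith
    qed auto
    finally have "norm (gQ x) \<le> norm (D (T x)) * (1 + h * M)"
    proof (cases "gQ x = 0")
      case False
      assume "(norm (gQ x))\<^sup>2 \<le> norm (D (T x)) * ((1 + h * M) * norm (gQ x))"
      then have "norm (gQ x) * norm (gQ x) \<le> (norm (D (T x)) * (1 + h * M)) * norm (gQ x)"
        by (simp only: power2_eq_square mult.assoc)
      then show ?thesis using False by (simp only: mult_le_cancel_right) auto
    qed (use h M in simp)
    then have "(norm (gQ x))\<^sup>2 \<le> (norm (D (T x)))\<^sup>2 * (1 + h * M)\<^sup>2"
      using power_mono[of "norm (gQ x)" "norm (D (T x)) * (1 + h * M)" 2] by (simp only: power_mult_distrib norm_ge_zero)
    also have "(norm (D (T x)))\<^sup>2 \<le> (Q h (\<lambda>y. (G y)\<^sup>2) x - (Q h G x)\<^sup>2) / (2 * h)"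
    proof -
      have "(norm (D (T x)))\<^sup>2 = (norm (\<integral>z. G (T x + \<sigma> *\<^sub>R z) *\<^sub>R z \<partial>std_gauss))\<^sup>2 / (2 * h)"
      proof -
        have n: "norm (D (T x)) = norm (\<integral>z. G (T x + \<sigma> *\<^sub>R z) *\<^sub>R z \<partial>std_gauss) / \<sigma>"
          using \<sigma>(1) by (simp add: D_def divide_inverse)
        show ?thesis unfolding n power_divide \<sigma>(2) ..
      qed
      also have "\<dots> \<le> ((\<integral>z. (G (T x + \<sigma> *\<^sub>R z))\<^sup>2 \<partial>std_gauss) - (\<integral>z. G (T x + \<sigma> *\<^sub>R z) \<partial>std_gauss)\<^sup>2) / (2 * h)"
        using h bd by (intro divide_right_mono gauss_bessel[where C=1]) auto
      finally show ?thesis by (simp add: Q_def eul)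
    qed
    finally show ?thesis by (simp add: mult.commute mult_right_mono)
  qed
qed

definition disp_const :: real where
  "disp_const = (\<integral>x. 1 + norm (gU x) \<partial>m) + 2 * (\<integral>z. norm (z::'a) \<partial>std_gauss)"

lemma disp_const_nonneg: "0 \<le> disp_const"
  unfolding disp_const_def by (intro add_nonneg_nonneg) auto

text \<open>Supplies the \<open>L^1\<close> distance that \<open>Ent_continuity\<close> asks for.
  Order \<open>sqrt h\<close> is enough, since the entropy is multiplied by a factor of order
  \<open>h\<close>.\<close>

lemma Q_displacement:
  assumes u: "unit_lip \<epsilon> L u" and e: "0 \<le> \<epsilon>" and h: "0 < h" "h \<le> 1"
  shows "(\<integral>x. \<bar>Q h u x - u x\<bar> \<partial>m) \<le> L * sqrt h * disp_const"
proof -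
  define k where "k = (\<integral>z. norm (z::'a) \<partial>std_gauss)"
  have nz: "integrable std_gauss (\<lambda>z::'a. norm z)"
    using std_gauss_norm_power_integrable[where n=1 and 'a='a] by simp
  note uD = unit_lipD[OF u]
  note iu = unit_lip_integrable_euler[OF u e]
  have pt: "\<bar>Q h u x - u x\<bar> \<le> L * sqrt h * (1 + norm (gU x) + 2 * k)" for x
  proof -
    have "\<bar>Q h u x - u x\<bar> = \<bar>\<integral>z. u (euler h x z) - u x \<partial>std_gauss\<bar>"
      unfolding Q_def using iu by simp
    also have "\<dots> \<le> (\<integral>z. \<bar>u (euler h x z) - u x\<bar> \<partial>std_gauss)" by (rule integral_abs_bound)
    also have "\<dots> \<le> (\<integral>z. L * (sqrt h * (1 + norm (gU x) + 2 * norm (z::'a))) \<partial>std_gauss)"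
    proof (rule integral_mono)
      show "\<bar>u (euler h x z) - u x\<bar> \<le> L * (sqrt h * (1 + norm (gU x) + 2 * norm z))" for z
        using uD(5)[of "euler h x z" x] mult_left_mono[OF euler_displacement[OF h, of x z] uD(4)]
        by (simp add: dist_norm)
    qed (use iu nz in auto)
    also have "\<dots> = L * sqrt h * (1 + norm (gU x) + 2 * k)"
      using nz by (simp add: k_def mult.assoc)
    finally show ?thesis .
  qed
  have g1: "integrable m (\<lambda>x. 1 + norm (gU x))" using gU_power_integrable[of 1] by simp
  have "(\<integral>x. \<bar>Q h u x - u x\<bar> \<partial>m) \<le> (\<integral>x. L * sqrt h * (1 + norm (gU x) + 2 * k) \<partial>m)"
  proof (rule integral_mono)
    show "integrable m (\<lambda>x. \<bar>Q h u x - u x\<bar>)"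
      using unit_lip_integrable[OF u e] unit_lip_integrable[OF unit_lip_Q[OF u e] e] h by auto
    show "integrable m (\<lambda>x. L * sqrt h * (1 + norm (gU x) + 2 * k))"
      by (rule integrable_mult_right, rule Bochner_Integration.integrable_add[OF g1]) simp
  qed (rule pt)
  also have "\<dots> = L * sqrt h * disp_const"
  proof -
    have "(\<integral>x. (1 + norm (gU x)) + 2 * k \<partial>m) = (\<integral>x. 1 + norm (gU x) \<partial>m) + (\<integral>x. 2 * k \<partial>m)"
      using g1 by (rule Bochner_Integration.integral_add) simp
    then show ?thesis by (simp add: disp_const_def k_def)
  qed
  finally show ?thesis .
qed

lemma Q_powr_le:
  assumes u: "unit_lip \<epsilon> L u" and e: "0 < \<epsilon>" and s: "1 \<le> s"
  shows "Q h u x powr s \<le> Q h (\<lambda>y. u y powr s) x"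
  unfolding Q_def
proof (rule std_gauss.jensens_inequality[where I="{0<..}"])
  show "integrable std_gauss (\<lambda>z. u (euler h x z))"
    using e by (intro unit_lip_integrable_euler[OF u]) auto
  show "integrable std_gauss (\<lambda>z. u (euler h x z) powr s)"
    by (rule unit_lip_integrable_euler[OF unit_lip_powr[OF u e s]]) simp
  show "convex_on {0<..} (\<lambda>x. x powr s)" using s by (rule powr_convex)
  show "AE z in std_gauss. u (euler h x z) \<in> {0<..}"
    using unit_lipD(1)[OF u] e by (auto intro!: AE_I2 intro: less_le_trans)
qed auto

text \<open>The first summand pays for the failure of invariance, the second for exchanging the
  entropy of a function with that of its smoothed version. Every exponent \<open>q \<le> p\<close>
  is covered by the same constant.\<close>

definition hyper_const :: "real \<Rightarrow> real \<Rightarrow> real \<Rightarrow> real" where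
  "hyper_const \<epsilon> L p = p * L * inv_const + \<rho> * (2 * (1 + p * \<bar>ln \<epsilon>\<bar>)) * (p * L * disp_const)"

lemma hyper_const_nonneg: "0 \<le> L \<Longrightarrow> 0 \<le> p \<Longrightarrow> 0 \<le> hyper_const \<epsilon> L p"
  unfolding hyper_const_def using inv_const_nonneg disp_const_nonneg \<rho>
  by (intro add_nonneg_nonneg mult_nonneg_nonneg) auto

text \<open>For \<open>q \<ge> 2\<close>, Jensen gives \<open>(Q u)\<^sup>q \<le> (Q u\<^sup>q\<^sup>/\<^sup>2)\<^sup>2\<close>, so the loss in the \<open>q\<close>-norm dominates the
  variance of \<open>u\<^sup>q\<^sup>/\<^sup>2\<close> under the kernel; by Bessel's inequality that variance dominates the Dirichlet
  energy of the smoothed function, to which the log-Sobolev inequality applies.\<close>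

lemma hyper_step:
  assumes u: "unit_lip \<epsilon> L u" and e: "0 < \<epsilon>" and q: "2 \<le> q" "q \<le> p" and h: "0 < h" "h \<le> 1"
    and \<eta>: "0 \<le> \<eta>" "\<eta> \<le> \<rho> * h / (1 + h * M)\<^sup>2"
  shows "(\<integral>x. Q h u x powr q \<partial>m)
     \<le> (\<integral>x. u x powr q \<partial>m) - \<eta> * Ent m (\<lambda>x. u x powr q) + hyper_const \<epsilon> L p * (h * sqrt h)"
proof -
  note uD = unit_lipD[OF u]
  have pos: "0 < u x" for x using uD(1)[of x] e by linarith
  define G where "G = (\<lambda>x. u x powr (q / 2))"
  have G: "unit_lip (\<epsilon> powr (q / 2)) (q / 2 * L) G"
    unfolding G_def using q by (intro unit_lip_powr u e) auto
  have Gsq: "(G x)\<^sup>2 = u x powr q" for x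
    using pos[of x] by (simp add: G_def power2_eq_square powr_add[symmetric])
  have G2: "unit_lip (\<epsilon> powr q) (q * L) (\<lambda>x. (G x)\<^sup>2)"
    unfolding Gsq using q by (intro unit_lip_powr u e) auto
  define \<kappa> where "\<kappa> = \<epsilon> powr (q / 2)"
  have \<kappa>: "0 < \<kappa>" "\<kappa>\<^sup>2 = \<epsilon> powr q" using e by (auto simp: \<kappa>_def power2_eq_square powr_add[symmetric])
  have QG: "unit_lip \<kappa> (q / 2 * L * (1 + h * M)) (Q h G)"
    unfolding \<kappa>_def using h by (intro unit_lip_Q G) auto
  note QGD = unit_lipD[OF QG] and GD = unit_lipD[OF G[folded \<kappa>_def]]
  have [measurable]: "Q h G \<in> borel_measurable borel" "G \<in> borel_measurable borel" "Q h u \<in> borel_measurable borel"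
      "u \<in> borel_measurable borel"
    using unit_lip_measurable[OF QG] unit_lip_measurable[OF G] unit_lip_measurable[OF u]
      unit_lip_measurable[OF unit_lip_Q[OF u, of h]] e h by auto
  define V where "V = (\<lambda>x. Q h (\<lambda>y. (G y)\<^sup>2) x - (Q h G x)\<^sup>2)"
  have QGpos: "0 < Q h G x" for x using QGD(1)[of x] \<kappa> by linarith
  have iQG2: "integrable m (\<lambda>x. (Q h G x)\<^sup>2)"
    using QGD(2) less_imp_le[OF QGpos] by (intro integrable_bounded[where C=1]) (auto simp: power_le_one)
  have QG2': "unit_lip (\<epsilon> powr q) (q * L * (1 + h * M)) (Q h (\<lambda>y. (G y)\<^sup>2))"
    using h by (intro unit_lip_Q G2) auto
  have iQ2: "integrable m (Q h (\<lambda>y. (G y)\<^sup>2))"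
    by (rule unit_lip_integrable[OF QG2']) simp
  obtain gQ where gQ: "\<And>x. (Q h G has_derivative (\<lambda>v. gQ x \<bullet> v)) (at x)" "continuous_on UNIV gQ"
    "\<And>x. (norm (gQ x))\<^sup>2 \<le> (1 + h * M)\<^sup>2 / (2 * h) * V x"
    using Q_gradient[OF G _ h(1)] unfolding V_def by auto
  have [measurable]: "gQ \<in> borel_measurable borel" using gQ(2) by (rule borel_measurable_continuous_onI)
  have gQb: "norm (gQ x) \<le> q / 2 * L * (1 + h * M)" for x
    by (rule norm_gradient_le_lipschitz[OF gQ(1) QGD(3)])
  have igQ: "integrable m (\<lambda>x. (norm (gQ x))\<^sup>2)"
    using gQb by (intro integrable_bounded[where C="(q / 2 * L * (1 + h * M))\<^sup>2"]) (auto intro!: power_mono)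
  have V0: "0 \<le> V x" for x
  proof -
    have "0 \<le> (1 + h * M)\<^sup>2 / (2 * h) * V x" using order.trans[OF zero_le_power2 gQ(3)[of x]] .
    moreover have "0 < (1 + h * M)\<^sup>2 / (2 * h)" using h M by (auto intro!: divide_pos_pos zero_less_power add_pos_pos)
    ultimately show ?thesis unfolding zero_le_mult_iff by linarith
  qed
  have "Ent m (\<lambda>x. (Q h G x)\<^sup>2) \<le> 2 / \<rho> * (\<integral>x. (norm (gQ x))\<^sup>2 \<partial>m)"
    by (rule lsi_square[OF gQ(1,2) \<kappa>(1) QGD(1,2) gQb])
  also have "\<dots> \<le> 2 / \<rho> * (\<integral>x. (1 + h * M)\<^sup>2 / (2 * h) * V x \<partial>m)"
    using \<rho> igQ iQ2 iQG2 gQ(3) by (intro mult_left_mono integral_mono) (auto simp: V_def)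
  also have "\<dots> = (1 + h * M)\<^sup>2 / (\<rho> * h) * (\<integral>x. V x \<partial>m)" by simp
  finally have ent: "Ent m (\<lambda>x. (Q h G x)\<^sup>2) \<le> (1 + h * M)\<^sup>2 / (\<rho> * h) * (\<integral>x. V x \<partial>m)" .
  have pm: "0 < (1 + h * M)\<^sup>2" using h M by (intro zero_less_power add_pos_pos) auto
  \<comment> \<open>The ceiling imposed on \<open>\<eta>\<close> is the reciprocal of the constant
    in \<open>ent\<close>.\<close>
  have entV: "\<eta> * Ent m (\<lambda>x. (Q h G x)\<^sup>2) \<le> (\<integral>x. V x \<partial>m)"
  proof -
    have VI: "0 \<le> (\<integral>x. V x \<partial>m)" using V0 by simp
    have "\<eta> * Ent m (\<lambda>x. (Q h G x)\<^sup>2) \<le> \<eta> * ((1 + h * M)\<^sup>2 / (\<rho> * h) * (\<integral>x. V x \<partial>m))"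
      using \<eta> ent by (intro mult_left_mono) auto
    also have "\<dots> \<le> (\<rho> * h / (1 + h * M)\<^sup>2) * ((1 + h * M)\<^sup>2 / (\<rho> * h) * (\<integral>x. V x \<partial>m))"
      using \<eta> VI \<rho> h by (intro mult_right_mono) auto
    also have "\<dots> = (\<integral>x. V x \<partial>m)" using pm \<rho> h by simp
    finally show ?thesis .
  qed
  have dist: "(\<integral>x. \<bar>(Q h G x)\<^sup>2 - (G x)\<^sup>2\<bar> \<partial>m) \<le> q * L * sqrt h * disp_const"
  proof -
    have iG: "integrable m G" "integrable m (Q h G)" "integrable m (\<lambda>x. (G x)\<^sup>2)"
      using unit_lip_integrable[OF G] unit_lip_integrable[OF QG] unit_lip_integrable[OF G2] \<kappa> by auto
    have "(\<integral>x. \<bar>(Q h G x)\<^sup>2 - (G x)\<^sup>2\<bar> \<partial>m) \<le> (\<integral>x. 2 * \<bar>Q h G x - G x\<bar> \<partial>m)"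
    proof (rule integral_mono)
      fix x
      have "\<bar>(Q h G x)\<^sup>2 - (G x)\<^sup>2\<bar> = (Q h G x + G x) * \<bar>Q h G x - G x\<bar>"
      proof -
        have "(Q h G x)\<^sup>2 - (G x)\<^sup>2 = (Q h G x + G x) * (Q h G x - G x)"
          by (simp add: power2_eq_square algebra_simps)
        moreover have "0 \<le> Q h G x + G x" using QGD(1)[of x] GD(1)[of x] \<kappa> by linarith
        ultimately show ?thesis by (simp add: abs_mult)
      qed
      also have "\<dots> \<le> 2 * \<bar>Q h G x - G x\<bar>" using QGD(2)[of x] GD(2)[of x] by (intro mult_right_mono) auto
      finally show "\<bar>(Q h G x)\<^sup>2 - (G x)\<^sup>2\<bar> \<le> 2 * \<bar>Q h G x - G x\<bar>" .
    qed (use iG iQG2 in auto)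
    also have "\<dots> = 2 * (\<integral>x. \<bar>Q h G x - G x\<bar> \<partial>m)" by simp
    also have "\<dots> \<le> 2 * (q / 2 * L * sqrt h * disp_const)"
      by (intro mult_left_mono Q_displacement[OF G _ h]) auto
    finally show ?thesis by (simp add: mult.assoc)
  qed
  define l where "l = 2 * (1 + p * \<bar>ln \<epsilon>\<bar>)"
  \<comment> \<open>The inequality controls the entropy after smoothing, the statement has it
    before. The exchange is of order \<open>sqrt h\<close>, and the factor
    \<open>\<eta> \<le> \<rho> * h\<close> turns it into \<open>h * sqrt h\<close>.\<close>
  have "Ent m (\<lambda>x. (G x)\<^sup>2) \<le> Ent m (\<lambda>x. (Q h G x)\<^sup>2) + 2 * (1 + \<bar>ln (\<epsilon> powr q)\<bar>) * (\<integral>x. \<bar>(Q h G x)\<^sup>2 - (G x)\<^sup>2\<bar> \<partial>m)"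
  proof (rule Ent_continuity)
    show "\<epsilon> powr q \<le> (Q h G x)\<^sup>2" "(Q h G x)\<^sup>2 \<le> 1" for x
      unfolding \<kappa>(2)[symmetric] using QGD(1,2)[of x] \<kappa>(1) QGpos[of x] by (auto intro!: power_mono simp: power_le_one)
    show "\<epsilon> powr q \<le> (G x)\<^sup>2" "(G x)\<^sup>2 \<le> 1" for x using unit_lipD(1,2)[OF G2] by auto
  qed (use e in auto)
  also have "\<dots> \<le> Ent m (\<lambda>x. (Q h G x)\<^sup>2) + l * (p * L * sqrt h * disp_const)"
  proof (intro add_left_mono mult_mono)
    have "\<bar>ln (\<epsilon> powr q)\<bar> = q * \<bar>ln \<epsilon>\<bar>" using e q by (simp add: ln_powr abs_mult)
    then show "2 * (1 + \<bar>ln (\<epsilon> powr q)\<bar>) \<le> l" unfolding l_def using q by (auto intro!: mult_right_mono)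
    have "q * L * sqrt h * disp_const \<le> p * L * sqrt h * disp_const"
      using q uD(4) h disp_const_nonneg by (intro mult_right_mono) auto
    then show "(\<integral>x. \<bar>(Q h G x)\<^sup>2 - (G x)\<^sup>2\<bar> \<partial>m) \<le> p * L * sqrt h * disp_const" using dist by linarith
    show "0 \<le> l" unfolding l_def using q by simp
  qed simp
  finally have "\<eta> * Ent m (\<lambda>x. (G x)\<^sup>2) \<le> \<eta> * (Ent m (\<lambda>x. (Q h G x)\<^sup>2) + l * (p * L * sqrt h * disp_const))"
    using \<eta> by (intro mult_left_mono)
  also have "\<dots> \<le> (\<integral>x. V x \<partial>m) + (\<rho> * h) * (l * (p * L * sqrt h * disp_const))"
    unfolding distrib_left
  proof (intro add_mono entV mult_right_mono)
    have "1 \<le> (1 + h * M)\<^sup>2" using h M by (simp add: one_le_power)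
    then have "\<rho> * h / (1 + h * M)\<^sup>2 \<le> \<rho> * h" using \<rho> h by (simp add: divide_le_eq mult_left_le)
    then show "\<eta> \<le> \<rho> * h" using \<eta> by linarith
    show "0 \<le> l * (p * L * sqrt h * disp_const)"
      unfolding l_def using q uD(4) h disp_const_nonneg by (intro mult_nonneg_nonneg add_nonneg_nonneg) auto
  qed
  finally have E: "\<eta> * Ent m (\<lambda>x. (G x)\<^sup>2) \<le> (\<integral>x. V x \<partial>m) + \<rho> * l * (p * L * disp_const) * (h * sqrt h)"
    by (simp add: mult_ac)
  have "(\<integral>x. Q h u x powr q \<partial>m) \<le> (\<integral>x. (Q h G x)\<^sup>2 \<partial>m)"
  proof (rule integral_mono)
    have Qu: "unit_lip \<epsilon> (L * (1 + h * M)) (Q h u)" using e h by (intro unit_lip_Q u) auto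
    show "integrable m (\<lambda>x. Q h u x powr q)"
      using q by (intro unit_lip_integrable[OF unit_lip_powr[OF Qu e]]) auto
    fix x
    have "Q h u x powr q = (Q h u x powr (q / 2))\<^sup>2"
      by (simp add: power2_eq_square powr_add[symmetric])
    also have "\<dots> \<le> (Q h G x)\<^sup>2"
      unfolding G_def using q by (intro power_mono Q_powr_le[OF u e]) auto
    finally show "Q h u x powr q \<le> (Q h G x)\<^sup>2" .
  qed (rule iQG2)
  also have "\<dots> = (\<integral>x. Q h (\<lambda>y. (G y)\<^sup>2) x \<partial>m) - (\<integral>x. V x \<partial>m)"
    unfolding V_def using iQ2 iQG2 by simp
  also have "(\<integral>x. Q h (\<lambda>y. (G y)\<^sup>2) x \<partial>m) \<le> (\<integral>x. (G x)\<^sup>2 \<partial>m) + q * L * inv_const * (h * sqrt h)"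
    by (intro Q_approx_invariant[OF G2 _ h]) simp
  also have "q * L * inv_const * (h * sqrt h) \<le> p * L * inv_const * (h * sqrt h)"
    using q uD(4) inv_const_nonneg h by (intro mult_right_mono) auto
  finally have "(\<integral>x. Q h u x powr q \<partial>m) \<le> (\<integral>x. (G x)\<^sup>2 \<partial>m) + p * L * inv_const * (h * sqrt h) - (\<integral>x. V x \<partial>m)"
    by simp
  with E have "(\<integral>x. Q h u x powr q \<partial>m) \<le> (\<integral>x. (G x)\<^sup>2 \<partial>m) - \<eta> * Ent m (\<lambda>x. (G x)\<^sup>2)
      + (p * L * inv_const * (h * sqrt h) + \<rho> * l * (p * L * disp_const) * (h * sqrt h))"
    by linarith
  then show ?thesis unfolding Gsq hyper_const_def l_def by (simp add: distrib_right)
qed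

lemma powr_integral_lower:
  assumes u: "unit_lip \<epsilon> L u" and e: "0 < \<epsilon>" and q: "1 \<le> q"
  shows "\<epsilon> powr q \<le> (\<integral>x. u x powr q \<partial>m)"
proof -
  have uq: "unit_lip (\<epsilon> powr q) (q * L) (\<lambda>x. u x powr q)" by (rule unit_lip_powr[OF u e q])
  have "(\<integral>x. \<epsilon> powr q \<partial>m) \<le> (\<integral>x. u x powr q \<partial>m)"
    using unit_lip_integrable[OF uq] unit_lipD(1)[OF uq] by (intro integral_mono) auto
  then show ?thesis by simp
qed

text \<open>The kernel step is taken at the higher exponent \<open>q' = q * (1 + \<eta>)\<close>. It
  gains \<open>\<eta> / q'\<close> times the normalised entropy, and the tangent bound charges
  \<open>(q' - q) / (q * q')\<close> times the same entropy for raising the exponent. The two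
  coefficients coincide, so only the discretization error remains; \<open>\<epsilon> powr p\<close>
  bounds the normalising integral from below.\<close>

lemma hyper_log_step:
  assumes u: "unit_lip \<epsilon> L u" and e: "0 < \<epsilon>" and q: "2 \<le> q" "q * (1 + \<eta>) \<le> p" and h: "0 < h" "h \<le> 1"
    and \<eta>: "0 \<le> \<eta>" "\<eta> \<le> \<rho> * h / (1 + h * M)\<^sup>2"
  shows "ln (\<integral>x. Q h u x powr (q * (1 + \<eta>)) \<partial>m) / (q * (1 + \<eta>))
     \<le> ln (\<integral>x. u x powr q \<partial>m) / q + hyper_const \<epsilon> L p / \<epsilon> powr p * (h * sqrt h)"
proof -
  note uD = unit_lipD[OF u]
  have pos: "0 < u x" for x using uD(1)[of x] e by linarith
  have [measurable]: "u \<in> borel_measurable borel" by (rule unit_lip_measurable[OF u])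
  define q' where "q' = q * (1 + \<eta>)"
  have q': "2 \<le> q'" "q \<le> q'" "q' \<le> p" using q \<eta> unfolding q'_def by (auto simp: algebra_simps add_increasing2)
  define A' where "A' = (\<integral>x. u x powr q' \<partial>m)"
  define E where "E = Ent m (\<lambda>x. u x powr q')"
  define I where "I = (\<integral>x. Q h u x powr q' \<partial>m)"
  define K where "K = hyper_const \<epsilon> L p * (h * sqrt h)"
  have K0: "0 \<le> K" unfolding K_def using hyper_const_nonneg[of L p] uD(4) q' h by auto
  have eA: "\<epsilon> powr p \<le> A'"
  proof -
    have "\<epsilon> powr p \<le> \<epsilon> powr q'" using q' e uD(6) by (intro powr_mono') auto
    also have "\<dots> \<le> A'" unfolding A'_def using q' by (intro powr_integral_lower[OF u e]) auto
    finally show ?thesis .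
  qed
  have ep: "0 < \<epsilon> powr p" using e by simp
  have A': "0 < A'" using ep eA by linarith
  have "0 < I"
  proof -
    have Qu: "unit_lip \<epsilon> (L * (1 + h * M)) (Q h u)" using e h by (intro unit_lip_Q u) auto
    have "0 < \<epsilon> powr q'" using e by simp
    also have "\<dots> \<le> I" unfolding I_def using q' by (intro powr_integral_lower[OF Qu e]) auto
    finally show ?thesis .
  qed
  have I: "I \<le> A' - \<eta> * E + K"
    unfolding I_def A'_def E_def K_def by (rule hyper_step[OF u e q'(1,3) h \<eta>])
  have "ln I \<le> ln A' + (I - A') / A'"
    using ln_le_minus_one[of "I / A'"] \<open>0 < I\<close> A' by (simp add: ln_div diff_divide_distrib)
  also have "(I - A') / A' \<le> (- \<eta> * E + K) / A'" using I A' by (intro divide_right_mono) auto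
  finally have lnI: "ln I \<le> ln A' - \<eta> * (E / A') + K / A'" by (simp add: add_divide_distrib diff_divide_distrib)
  have tang: "ln A' / q' \<le> ln (\<integral>x. u x powr q \<partial>m) / q + (q' - q) / (q * q') * (E / A')"
  proof -
    have pw: "exp (c * ln (u x)) = u x powr c" for c x using pos[of x] by (simp add: powr_def)
    have "\<bar>ln (u x)\<bar> \<le> \<bar>ln \<epsilon>\<bar>" for x
    proof -
      have "ln \<epsilon> \<le> ln (u x)" "ln (u x) \<le> 0" using e uD(1,2)[of x] pos[of x] by auto
      then show ?thesis by linarith
    qed
    then show ?thesis
      using log_moment_tangent[of "\<lambda>x. ln (u x)" "\<bar>ln \<epsilon>\<bar>" q q'] q q' unfolding pw A'_def E_def by auto
  qed
  have c: "(q' - q) / (q * q') = \<eta> / q'"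
  proof -
    have "q' - q = q * \<eta>" by (simp add: q'_def algebra_simps)
    then show ?thesis using q by simp
  qed
  have "ln I / q' \<le> (ln A' - \<eta> * (E / A') + K / A') / q'" using lnI q' by (intro divide_right_mono) auto
  also have "\<dots> = ln A' / q' - \<eta> / q' * (E / A') + K / A' / q'" by (simp add: diff_divide_distrib add_divide_distrib)
  also have "\<dots> \<le> ln (\<integral>x. u x powr q \<partial>m) / q + K / A' / q'" using tang unfolding c by linarith
  also have "K / A' / q' \<le> K / \<epsilon> powr p"
  proof -
    have "K / A' / q' \<le> K / A' / 1" using K0 A' q' by (intro divide_left_mono) auto
    also have "\<dots> \<le> K / \<epsilon> powr p" using K0 mult_pos_pos[OF A' ep] eA by (simp add: divide_left_mono)
    finally show ?thesis .
  qed
  finally show ?thesis unfolding I_def q'_def K_def by simp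
qed

text \<open>Exponents grow geometrically, so that every step has the same relative growth
  \<open>exp \<alpha> - 1\<close>. The error is charged at the final exponent and the final
  Lipschitz constant, which dominate all earlier ones.\<close>

lemma hyper_iterate:
  assumes u: "unit_lip \<epsilon> L u" and e: "0 < \<epsilon>" and h: "0 < h" "h \<le> 1"
    and \<alpha>: "0 \<le> \<alpha>" "exp \<alpha> - 1 \<le> \<rho> * h / (1 + h * M)\<^sup>2" and k: "k \<le> n"
  shows "ln (\<integral>x. (Q h ^^ k) u x powr (2 * exp (real k * \<alpha>)) \<partial>m) / (2 * exp (real k * \<alpha>))
     \<le> ln (\<integral>x. u x powr 2 \<partial>m) / 2
       + real k * (hyper_const \<epsilon> (L * exp (real n * h * M)) (2 * exp (real n * \<alpha>)) / \<epsilon> powr (2 * exp (real n * \<alpha>)) * (h * sqrt h))"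
  using k
proof (induction k)
  case (Suc k)
  define L' where "L' = L * exp (real n * h * M)"
  define p where "p = 2 * exp (real n * \<alpha>)"
  define q where "q = 2 * exp (real k * \<alpha>)"
  have L: "0 \<le> L" by (rule unit_lipD(4)[OF u])
  have uk: "unit_lip \<epsilon> L' ((Q h ^^ k) u)"
  proof -
    have "L * exp (real k * h * M) \<le> L'"
      unfolding L'_def using Suc.prems h M L by (intro mult_left_mono) (auto intro!: mult_right_mono)
    then show ?thesis
      using unit_lip_Q_iterate[OF u _ , of h k] e h by (auto simp: unit_lip_def intro: lipschitz_on_mono)
  qed
  have q: "2 \<le> q" "q * (1 + (exp \<alpha> - 1)) = 2 * exp (real (Suc k) * \<alpha>)"
    using \<alpha> by (auto simp: q_def exp_add[symmetric] algebra_simps)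
  have "real (Suc k) * \<alpha> \<le> real n * \<alpha>" using Suc.prems \<alpha> by (intro mult_right_mono) auto
  then have "q * (1 + (exp \<alpha> - 1)) \<le> p" unfolding q(2) p_def by simp
  from hyper_log_step[OF uk e q(1) this h _ \<alpha>(2)] \<alpha>(1)
  have "ln (\<integral>x. Q h ((Q h ^^ k) u) x powr (2 * exp (real (Suc k) * \<alpha>)) \<partial>m) / (2 * exp (real (Suc k) * \<alpha>))
     \<le> ln (\<integral>x. (Q h ^^ k) u x powr q \<partial>m) / q + hyper_const \<epsilon> L' p / \<epsilon> powr p * (h * sqrt h)"
    unfolding q(2) by simp
  also have "ln (\<integral>x. (Q h ^^ k) u x powr q \<partial>m) / q
     \<le> ln (\<integral>x. u x powr 2 \<partial>m) / 2 + real k * (hyper_const \<epsilon> L' p / \<epsilon> powr p * (h * sqrt h))"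
    using Suc unfolding L'_def p_def q_def by simp
  finally show ?case unfolding L'_def[symmetric] p_def[symmetric] by (simp add: algebra_simps add_divide_distrib)
qed simp

end

subsection \<open>Harnack inequality for the Euler kernel\<close>

context langevin
begin

text \<open>A Riemann sum, with right end points, of \<open>(1 + M \<tau>)^2 / 4\<close>: with time
  \<open>\<tau>\<close> left the coupled chains differ by \<open>\<tau> v\<close>, so the
  translation per unit time is at most \<open>(1 + M \<tau>) * norm v\<close>. The 4 comes from the
  Gaussian cost with \<open>2 * \<sigma>^2 = 4 * h\<close>.\<close>

definition harnack_const :: "real \<Rightarrow> nat \<Rightarrow> real" where
  "harnack_const h j = (\<Sum>i<j. h / 4 * (1 + M * (real (Suc i) * h))\<^sup>2)"

text \<open>The chain from \<open>x\<close> is coupled to the one from \<open>x + j h v\<close> with a difference that shrinks linearly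
  to zero; each step pays for the mismatch of the drifts by a Gaussian translation.\<close>

lemma Q_harnack:
  assumes \<Phi>: "unit_lip \<epsilon> L \<Phi>" and e: "0 < \<epsilon>" and p: "1 < p" and h: "0 < h"
  shows "(Q h ^^ j) \<Phi> x powr p
     \<le> (Q h ^^ j) (\<lambda>y. \<Phi> y powr p) (x + (real j * h) *\<^sub>R v) * exp (p / (p - 1) * (harnack_const h j * (norm v)\<^sup>2))"
proof (induction j arbitrary: x)
  case 0
  then show ?case by (simp add: harnack_const_def)
next
  case (Suc j)
  define F where "F = (Q h ^^ j) \<Phi>"
  define R where "R = (Q h ^^ j) (\<lambda>y. \<Phi> y powr p)"
  define c where "c = p / (p - 1) * (harnack_const h j * (norm v)\<^sup>2)"
  define w where "w = (real j * h) *\<^sub>R v"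
  define \<sigma> where "\<sigma> = sqrt (2 * h)"
  have \<sigma>: "\<sigma> > 0" "\<sigma>\<^sup>2 = 2 * h" using h by (auto simp: \<sigma>_def)
  define T where "T = (\<lambda>x. x - h *\<^sub>R gU x)"
  have eul: "euler h x z = T x + \<sigma> *\<^sub>R z" for x z by (simp add: euler_def T_def \<sigma>_def)
  have F: "unit_lip \<epsilon> (L * exp (real j * h * M)) F"
    unfolding F_def using e h by (intro unit_lip_Q_iterate \<Phi>) auto
  have R: "unit_lip (\<epsilon> powr p) (p * L * exp (real j * h * M)) R"
    unfolding R_def using e h p by (intro unit_lip_Q_iterate unit_lip_powr \<Phi>) auto
  have [measurable]: "F \<in> borel_measurable borel" "R \<in> borel_measurable borel"
    using unit_lip_measurable[OF F] unit_lip_measurable[OF R] by auto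
  \<comment> \<open>The \<open>p\<close>-th root of the kernel on the right of the induction
    hypothesis, moved by the difference \<open>w\<close> that remains after this step.
    \<open>gauss_harnack\<close> raises it to the power \<open>p\<close> again and so reproduces
    \<open>R\<close>.\<close>
  define G where "G = (\<lambda>y. R (y + w) powr (1 / p))"
  have [measurable]: "G \<in> borel_measurable borel" unfolding G_def by measurable
  have Rpos: "0 < R y" for y using unit_lipD(1)[OF R, of y] e by (smt (verit) powr_gt_zero)
  have Gp: "G y powr p = R (y + w)" for y using Rpos[of "y + w"] p by (simp add: G_def powr_powr)
  have G: "\<epsilon> \<le> G y" "G y \<le> 1" for y
  proof -
    have "(\<epsilon> powr p) powr (1 / p) \<le> G y"
      unfolding G_def using unit_lipD(1)[OF R, of "y + w"] p by (intro powr_mono2) auto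
    then show "\<epsilon> \<le> G y" using e p by (simp add: powr_powr)
    show "G y \<le> 1" unfolding G_def using unit_lipD(2)[OF R, of "y + w"] Rpos[of "y + w"] p by (intro powr_le1) auto
  qed
  have FG: "F y \<le> G y * exp (c / p)" for y
  proof -
    have Fp: "0 < F y" using unit_lipD(1)[OF F, of y] e by linarith
    have "F y powr p \<le> R (y + w) * exp c"
      using Suc[of y] by (simp add: F_def R_def w_def c_def)
    then have "(F y powr p) powr (1 / p) \<le> (R (y + w) * exp c) powr (1 / p)"
      using p by (intro powr_mono2) auto
    then show ?thesis
      using Fp p Rpos[of "y + w"] by (simp add: powr_powr powr_mult G_def exp_powr_real)
  qed
  define a where "a = T x"
  define y where "y = x + (real (Suc j) * h) *\<^sub>R v"
  \<comment> \<open>Once the target difference \<open>w\<close> is subtracted from the step of the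
    chain started at \<open>y\<close>, the two steps differ only in their means;
    \<open>a - b\<close> is the translation that the Gaussian has to absorb.\<close>
  define b where "b = T y - w"
  have iF: "integrable std_gauss (\<lambda>z. F (a + \<sigma> *\<^sub>R z))"
    using unit_lip_integrable_euler[OF F, of h x] e by (simp add: eul a_def)
  have iG: "integrable std_gauss (\<lambda>z. G (a + \<sigma> *\<^sub>R z))"
  proof (rule std_gauss.integrable_bounded)
    show "\<bar>G (a + \<sigma> *\<^sub>R z)\<bar> \<le> 1" for z using G[of "a + \<sigma> *\<^sub>R z"] e by linarith
  qed measurable
  have QF: "Q h F x = (\<integral>z. F (a + \<sigma> *\<^sub>R z) \<partial>std_gauss)" by (simp add: Q_def eul a_def)
  have QF0: "0 \<le> Q h F x" using unit_lipD(1)[OF unit_lip_Q[OF F, of h], of x] e h by auto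
  have IG0: "0 \<le> (\<integral>z. G (a + \<sigma> *\<^sub>R z) \<partial>std_gauss)" by (simp add: G_def)
  have "Q h F x \<le> (\<integral>z. G (a + \<sigma> *\<^sub>R z) * exp (c / p) \<partial>std_gauss)"
    unfolding QF using iF iG FG by (intro integral_mono) auto
  also have "\<dots> = (\<integral>z. G (a + \<sigma> *\<^sub>R z) \<partial>std_gauss) * exp (c / p)" by simp
  finally have "Q h F x powr p \<le> ((\<integral>z. G (a + \<sigma> *\<^sub>R z) \<partial>std_gauss) * exp (c / p)) powr p"
    using QF0 p by (intro powr_mono2) auto
  also have "\<dots> = (\<integral>z. G (a + \<sigma> *\<^sub>R z) \<partial>std_gauss) powr p * exp c"
    using IG0 p by (simp add: powr_mult exp_powr_real)
  also have "\<dots> \<le> ((\<integral>z. G (b + \<sigma> *\<^sub>R z) powr p \<partial>std_gauss) * exp (p / (p - 1) * ((norm (a - b))\<^sup>2 / (2 * \<sigma>\<^sup>2)))) * exp c"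
    by (intro mult_right_mono gauss_harnack[OF p \<sigma>(1) e _ G]) auto
  also have "(\<integral>z. G (b + \<sigma> *\<^sub>R z) powr p \<partial>std_gauss) = Q h R y"
    unfolding Gp Q_def eul b_def by (simp add: algebra_simps)
  also have "Q h R y * exp (p / (p - 1) * ((norm (a - b))\<^sup>2 / (2 * \<sigma>\<^sup>2))) * exp c
     = Q h R y * exp (p / (p - 1) * ((norm (a - b))\<^sup>2 / (2 * \<sigma>\<^sup>2)) + c)"
    by (simp add: exp_add mult.assoc)
  also have "\<dots> \<le> Q h R y * exp (p / (p - 1) * (harnack_const h (Suc j) * (norm v)\<^sup>2))"
  proof (rule mult_left_mono)
    \<comment> \<open>The drift mismatch is at most \<open>M\<close> times the current difference
      \<open>Suc j * h * norm v\<close>, and the prescribed shrinkage adds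
      \<open>h * norm v\<close>.\<close>
    define k where "k = 1 + M * (real (Suc j) * h)"
    have k: "0 \<le> k" using h M by (simp add: k_def)
    have ab: "a - b = h *\<^sub>R (gU y - gU x) - h *\<^sub>R v"
      by (simp add: a_def b_def T_def y_def w_def algebra_simps)
    have "norm (a - b) \<le> h * norm (gU y - gU x) + h * norm v"
      unfolding ab using norm_triangle_ineq4[of "h *\<^sub>R (gU y - gU x)" "h *\<^sub>R v"] h by simp
    also have "\<dots> \<le> h * (M * norm (y - x)) + h * norm v"
      using h by (intro add_right_mono mult_left_mono gU_diff) auto
    also have "norm (y - x) = (real (Suc j) * h) * norm v" using h by (simp add: y_def)
    finally have "norm (a - b) \<le> h * (k * norm v)" unfolding k_def by (simp add: algebra_simps)
    then have "(norm (a - b))\<^sup>2 \<le> (h * (k * norm v))\<^sup>2" by (rule power_mono) simp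
    then have "(norm (a - b))\<^sup>2 / (2 * \<sigma>\<^sup>2) \<le> (h * (k * norm v))\<^sup>2 / (2 * \<sigma>\<^sup>2)"
      by (rule divide_right_mono) simp
    also have "\<dots> = h / 4 * k\<^sup>2 * (norm v)\<^sup>2"
      unfolding \<sigma>(2) using h by (simp add: power2_eq_square)
    finally have "p / (p - 1) * ((norm (a - b))\<^sup>2 / (2 * \<sigma>\<^sup>2)) \<le> p / (p - 1) * (h / 4 * k\<^sup>2 * (norm v)\<^sup>2)"
      using p by (intro mult_left_mono) auto
    then have "p / (p - 1) * ((norm (a - b))\<^sup>2 / (2 * \<sigma>\<^sup>2)) + c
       \<le> p / (p - 1) * (h / 4 * k\<^sup>2 * (norm v)\<^sup>2) + p / (p - 1) * (harnack_const h j * (norm v)\<^sup>2)"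
      by (simp add: c_def)
    also have "\<dots> = p / (p - 1) * (harnack_const h (Suc j) * (norm v)\<^sup>2)"
      by (simp only: harnack_const_def k_def sum.lessThan_Suc distrib_right distrib_left add.commute)
    finally show "exp (p / (p - 1) * ((norm (a - b))\<^sup>2 / (2 * \<sigma>\<^sup>2)) + c)
       \<le> exp (p / (p - 1) * (harnack_const h (Suc j) * (norm v)\<^sup>2))" by simp
    show "0 \<le> Q h R y" unfolding Q_def using less_imp_le[OF Rpos] by simp
  qed
  finally show ?case unfolding F_def R_def y_def by simp
qed

lemma harnack_const_eq:
  "harnack_const h j = h / 4 * (real j + M * h * (real j * (real j + 1)) + M\<^sup>2 * h\<^sup>2 * (real j * (real j + 1) * (2 * real j + 1)) / 6)"
  by (induction j) (simp_all add: harnack_const_def field_simps power2_eq_square)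

text \<open>The limit is \<open>1/4 + M/4 + M^2/12\<close>, and it falls short of
  \<open>(M^2 + 3) / 6\<close> by \<open>((M - 3/2)^2 + 3/4) / 12\<close>. This strict gap is what
  lets the bound hold for all large finite \<open>n\<close>.\<close>

lemma harnack_const_le: "\<forall>\<^sub>F n in sequentially. harnack_const (1 / real n) n \<le> (M\<^sup>2 + 3) / 6"
proof -
  have lim: "(\<lambda>n. 1 / 4 * (1 + M * (1 + 1 / real n) + M\<^sup>2 * ((1 + 1 / real n) * (2 + 1 / real n)) / 6))
     \<longlonglongrightarrow> 1 / 4 * (1 + M * (1 + 0) + M\<^sup>2 * ((1 + 0) * (2 + 0)) / 6)"
    by (intro tendsto_intros lim_1_over_n) auto
  have "0 < (M - 3 / 2)\<^sup>2 + 3 / 4" by (intro add_nonneg_pos) auto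
  then have "M < M\<^sup>2 / 3 + 1" by (simp add: power2_eq_square algebra_simps)
  then have "1 / 4 * (1 + M * (1 + 0) + M\<^sup>2 * ((1 + 0) * (2 + 0)) / 6) < (M\<^sup>2 + 3) / 6"
    by (simp add: field_simps)
  from order_tendstoD(2)[OF lim this]
  have "\<forall>\<^sub>F n in sequentially. 1 / 4 * (1 + M * (1 + 1 / real n) + M\<^sup>2 * ((1 + 1 / real n) * (2 + 1 / real n)) / 6) < (M\<^sup>2 + 3) / 6" .
  then show ?thesis
    using eventually_gt_at_top[of 0]
  proof eventually_elim
    case (elim n)
    have "harnack_const (1 / real n) n
       = 1 / 4 * (1 + M * (1 + 1 / real n) + M\<^sup>2 * ((1 + 1 / real n) * (2 + 1 / real n)) / 6)"
      unfolding harnack_const_eq using elim(2) by (simp add: field_simps power2_eq_square)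
    then show ?case using elim(1) by linarith
  qed
qed

section \<open>From the Harnack inequality to a pointwise bound\<close>

lemma Q_iterate_approx_invariant:
  assumes u: "unit_lip \<epsilon> L u" and e: "0 \<le> \<epsilon>" and h: "0 < h" "h \<le> 1" and "k \<le> n"
  shows "(\<integral>x. (Q h ^^ k) u x \<partial>m) \<le> (\<integral>x. u x \<partial>m) + real k * (L * exp (real n * h * M) * inv_const * (h * sqrt h))"
  using assms(5)
proof (induction k)
  case (Suc k)
  have L: "0 \<le> L" by (rule unit_lipD(4)[OF u])
  have "(\<integral>x. Q h ((Q h ^^ k) u) x \<partial>m) \<le> (\<integral>x. (Q h ^^ k) u x \<partial>m) + L * exp (real k * h * M) * inv_const * (h * sqrt h)"
    using h by (intro Q_approx_invariant[OF unit_lip_Q_iterate[OF u e] e h]) auto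
  also have "L * exp (real k * h * M) * inv_const * (h * sqrt h) \<le> L * exp (real n * h * M) * inv_const * (h * sqrt h)"
    using Suc.prems h M L inv_const_nonneg by (intro mult_right_mono mult_left_mono) (auto intro!: mult_right_mono)
  also have "(\<integral>x. (Q h ^^ k) u x \<partial>m) \<le> (\<integral>x. u x \<partial>m) + real k * (L * exp (real n * h * M) * inv_const * (h * sqrt h))"
    using Suc by simp
  finally show ?case by (simp add: algebra_simps)
qed simp

lemma dist_sq_integrable: "integrable m (\<lambda>y. (dist x y)\<^sup>2)"
proof (rule Bochner_Integration.integrable_bound)
  show "integrable m (\<lambda>y. 2 * (norm x)\<^sup>2 + 2 * norm y ^ 2)"
    by (intro Bochner_Integration.integrable_add integrable_mult_right norm_power_integrable) simp
  have "(dist x y)\<^sup>2 \<le> 2 * (norm x)\<^sup>2 + 2 * norm y ^ 2" for y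
  proof -
    have "(dist x y)\<^sup>2 \<le> (norm x + norm y)\<^sup>2"
      by (intro power_mono) (auto simp: dist_norm norm_triangle_ineq4)
    also have "\<dots> \<le> 2 * (norm x)\<^sup>2 + 2 * norm y ^ 2"
      using sum_squares_bound[of "norm x" "norm y"] by (simp add: power2_sum)
    finally show ?thesis .
  qed
  then show "AE y in m. norm ((dist x y)\<^sup>2) \<le> norm (2 * (norm x)\<^sup>2 + 2 * norm y ^ 2)"
    by (auto intro!: AE_I2 simp: abs_of_nonneg add_nonneg_nonneg)
qed measurable

text \<open>The Gaussian factor is moved to the left before integrating over the end point
  \<open>y\<close>. Jensen's inequality for the convex exponential then puts the average into the
  exponent, so the mean squared distance appears rather than an exponential moment of it.\<close>

lemma Q_pointwise_bound:
  assumes \<Phi>: "unit_lip \<epsilon> L \<Phi>" and e: "0 < \<epsilon>" and p: "1 < p" and n: "0 < n"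
    and H: "harnack_const (1 / real n) n \<le> c"
  shows "(Q (1 / real n) ^^ n) \<Phi> x powr p
     \<le> ((\<integral>y. \<Phi> y powr p \<partial>m) + p * L * exp M * inv_const * sqrt (1 / real n)) * exp (p / (p - 1) * (c * (\<integral>y. (dist x y)\<^sup>2 \<partial>m)))"
proof -
  define h where "h = 1 / real n"
  have h: "0 < h" "h \<le> 1" "real n * h = 1" using n by (auto simp: h_def)
  define A where "A = (Q h ^^ n) \<Phi> x powr p"
  define b where "b = p / (p - 1) * c"
  define R where "R = (Q h ^^ n) (\<lambda>y. \<Phi> y powr p)"
  have \<Phi>p: "unit_lip (\<epsilon> powr p) (p * L) (\<lambda>y. \<Phi> y powr p)" using p by (intro unit_lip_powr \<Phi> e) auto
  have R: "unit_lip (\<epsilon> powr p) (p * L * exp (real n * h * M)) R"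
    unfolding R_def using e h by (intro unit_lip_Q_iterate \<Phi>p) auto
  have Rn: "0 \<le> R y" for y using unit_lipD(1)[OF R, of y] by (smt (verit) powr_ge_zero)
  have c: "0 \<le> c" using H unfolding harnack_const_def by (smt (verit) divide_nonneg_nonneg mult_nonneg_nonneg of_nat_0_le_iff sum_nonneg zero_le_power2)
  have b: "0 \<le> b" unfolding b_def using c p by simp
  have le: "A * exp (- (b * (dist x y)\<^sup>2)) \<le> R y" for y
  proof -
    \<comment> \<open>With \<open>v = y - x\<close> and \<open>n * h = 1\<close> the coupling leads
      from \<open>x\<close> to the arbitrary point \<open>y\<close> in exactly one unit of
      time.\<close>
    have "A \<le> R (x + (real n * h) *\<^sub>R (y - x)) * exp (p / (p - 1) * (harnack_const h n * (norm (y - x))\<^sup>2))"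
      unfolding A_def R_def by (rule Q_harnack[OF \<Phi> e p h(1)])
    also have "\<dots> \<le> R y * exp (b * (dist x y)\<^sup>2)"
    proof -
      have "harnack_const h n * (norm (y - x))\<^sup>2 \<le> c * (norm (y - x))\<^sup>2"
        using H by (intro mult_right_mono) (auto simp: h_def)
      then have "p / (p - 1) * (harnack_const h n * (norm (y - x))\<^sup>2) \<le> p / (p - 1) * (c * (norm (y - x))\<^sup>2)"
        using p by (intro mult_left_mono) auto
      then show ?thesis
        using Rn[of y] h(3) by (auto simp: b_def dist_norm norm_minus_commute mult.assoc intro!: mult_left_mono)
    qed
    finally show ?thesis by (simp add: exp_minus field_simps)
  qed
  have iD: "integrable m (\<lambda>y. - (b * (dist x y)\<^sup>2))" using dist_sq_integrable by simp
  have iE: "integrable m (\<lambda>y. exp (- (b * (dist x y)\<^sup>2)))"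
  proof (rule integrable_bounded)
    show "\<bar>exp (- (b * (dist x y)\<^sup>2))\<bar> \<le> 1" for y using b by simp
  qed measurable
  have "exp (\<integral>y. - (b * (dist x y)\<^sup>2) \<partial>m) \<le> (\<integral>y. exp (- (b * (dist x y)\<^sup>2)) \<partial>m)"
    by (rule jensens_inequality[where I=UNIV]) (use iD iE exp_convex in auto)
  then have "A * exp (\<integral>y. - (b * (dist x y)\<^sup>2) \<partial>m) \<le> A * (\<integral>y. exp (- (b * (dist x y)\<^sup>2)) \<partial>m)"
    by (rule mult_left_mono) (simp add: A_def)
  also have "\<dots> = (\<integral>y. A * exp (- (b * (dist x y)\<^sup>2)) \<partial>m)" by simp
  also have "\<dots> \<le> (\<integral>y. R y \<partial>m)"
    using iE le unit_lip_integrable[OF R] by (intro integral_mono) auto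
  also have "\<dots> \<le> (\<integral>y. \<Phi> y powr p \<partial>m) + real n * (p * L * exp (real n * h * M) * inv_const * (h * sqrt h))"
    unfolding R_def by (rule Q_iterate_approx_invariant[OF \<Phi>p _ h(1,2)]) auto
  \<comment> \<open>Local errors of order \<open>h * sqrt h\<close> over the total time
    \<open>n * h = 1\<close> sum to order \<open>sqrt h\<close>.\<close>
  also have "real n * (p * L * exp (real n * h * M) * inv_const * (h * sqrt h)) = (real n * h) * (p * L * exp (real n * h * M) * inv_const * sqrt h)"
    by (simp only: mult_ac)
  also have "\<dots> = p * L * exp M * inv_const * sqrt h" by (simp add: h(3))
  finally have "A * exp (- (b * (\<integral>y. (dist x y)\<^sup>2 \<partial>m))) \<le> (\<integral>y. \<Phi> y powr p \<partial>m) + p * L * exp M * inv_const * sqrt h"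
    by simp
  then have "A \<le> ((\<integral>y. \<Phi> y powr p \<partial>m) + p * L * exp M * inv_const * sqrt h) * exp (b * (\<integral>y. (dist x y)\<^sup>2 \<partial>m))"
    by (simp add: exp_minus field_simps)
  then show ?thesis unfolding A_def b_def h_def by (simp add: mult.assoc)
qed

lemma semigroup_bound:
  assumes \<phi>: "unit_lip \<epsilon> L \<phi>" and e: "0 < \<epsilon>" and s: "0 < s"
  obtains K where "K \<longlonglongrightarrow> sqrt (\<integral>x. (\<phi> x)\<^sup>2 \<partial>m)" "\<And>n. 0 \<le> K n"
    "\<forall>\<^sub>F n in sequentially. \<forall>x. (Q (1 / real n) ^^ n) ((Q (s / real n) ^^ n) \<phi>) x
       \<le> exp ((M\<^sup>2 + 3) / 6 * exp (- \<rho> * s) * (\<integral>y. (dist x y)\<^sup>2 \<partial>m)) * K n"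
proof -
  \<comment> \<open>Chosen so that \<open>1 / (p - 1) = exp (- \<rho> * s)\<close>, the decay factor
    of the claim.\<close>
  define p where "p = 1 + exp (\<rho> * s)"
  have p: "1 < p" "p - 1 = exp (\<rho> * s)" "2 \<le> p" using \<rho> s by (auto simp: p_def)
  \<comment> \<open>Total logarithmic growth of the exponent from 2 to \<open>p\<close>. It is
    strictly below \<open>\<rho> * s\<close> because \<open>s > 0\<close>, and the gap absorbs both
    \<open>(1 + h * M)^2\<close> and the difference between \<open>exp (\<beta> / n) - 1\<close> and
    \<open>\<beta> / n\<close>.\<close>
  define \<beta> where "\<beta> = ln (p / 2)"
  have \<beta>: "0 \<le> \<beta>" "2 * exp \<beta> = p" using p by (auto simp: \<beta>_def)
  have \<beta>s: "\<beta> < \<rho> * s"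
  proof -
    have "1 < exp (\<rho> * s)" using \<rho> s by simp
    then have "p / 2 < exp (\<rho> * s)" by (simp add: p_def)
    then have "ln (p / 2) < ln (exp (\<rho> * s))" using p by (subst ln_less_cancel_iff) auto
    then show ?thesis by (simp add: \<beta>_def)
  qed
  define L' where "L' = L * exp (s * M)"
  define B where "B = hyper_const \<epsilon> L' p / \<epsilon> powr p"
  define I2 where "I2 = (\<integral>x. \<phi> x powr 2 \<partial>m)"
  have pos: "0 < \<phi> x" for x using unit_lipD(1)[OF \<phi>, of x] e by linarith
  have I2: "0 < I2" unfolding I2_def
    using powr_integral_lower[OF \<phi> e, of 2] e by (smt (verit) powr_gt_zero)
  \<comment> \<open>The bound on the \<open>p\<close>-th moment after the hypercontractive phase
    plus the invariance error of the Harnack phase, under a \<open>p\<close>-th root. Both errors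
    vanish, and the \<open>p\<close>-th root of \<open>I2 powr (p / 2)\<close> is the
    \<open>L^2\<close> norm.\<close>
  define K where "K = (\<lambda>n. (exp (p * (ln I2 / 2 + B * (s * sqrt (s / real n)))) + p * L' * exp M * inv_const * sqrt (1 / real n)) powr (1 / p))"
  have L: "0 \<le> L" "0 \<le> L'" using unit_lipD(4)[OF \<phi>] by (auto simp: L'_def)
  have inv: "(\<lambda>n. 1 / real n) \<longlonglongrightarrow> 0" by (rule lim_1_over_n)
  have invs: "(\<lambda>n. s / real n) \<longlonglongrightarrow> 0" by (rule lim_const_over_n)
  have "K \<longlonglongrightarrow> (exp (p * (ln I2 / 2 + B * (s * sqrt 0))) + p * L' * exp M * inv_const * sqrt 0) powr (1 / p)"
    unfolding K_def by (intro tendsto_intros inv invs) auto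
  also have "(exp (p * (ln I2 / 2 + B * (s * sqrt 0))) + p * L' * exp M * inv_const * sqrt 0) powr (1 / p) = sqrt (\<integral>x. (\<phi> x)\<^sup>2 \<partial>m)"
  proof -
    have "(exp (p * (ln I2 / 2))) powr (1 / p) = exp (ln I2 / 2)"
      using p by (simp add: exp_powr_real)
    also have "\<dots> = sqrt I2" using I2 by (simp add: powr_half_sqrt[symmetric] powr_def)
    also have "sqrt I2 = sqrt (\<integral>x. (\<phi> x)\<^sup>2 \<partial>m)" unfolding I2_def using less_imp_le[OF pos] by simp
    finally show ?thesis by simp
  qed
  finally have Klim: "K \<longlonglongrightarrow> sqrt (\<integral>x. (\<phi> x)\<^sup>2 \<partial>m)" .
  have rate: "\<forall>\<^sub>F n in sequentially. exp (\<beta> / real n) - 1 \<le> \<rho> * (s / real n) / (1 + (s / real n) * M)\<^sup>2"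
  proof -
    have l1: "(\<lambda>n. \<rho> * s / (1 + (s / real n) * M)\<^sup>2) \<longlonglongrightarrow> \<rho> * s / (1 + 0 * M)\<^sup>2"
      by (intro tendsto_intros invs) auto
    have l2: "(\<lambda>n. \<beta> + \<beta>\<^sup>2 / real n) \<longlonglongrightarrow> \<beta> + 0"
      by (intro tendsto_intros lim_const_over_n)
    define c where "c = (\<beta> + \<rho> * s) / 2"
    have "\<forall>\<^sub>F n in sequentially. c < \<rho> * s / (1 + (s / real n) * M)\<^sup>2"
      using \<beta>s by (intro order_tendstoD(1)[OF l1]) (auto simp: c_def)
    moreover have "\<forall>\<^sub>F n in sequentially. \<beta> + \<beta>\<^sup>2 / real n < c"
      using \<beta>s by (intro order_tendstoD(2)[OF l2]) (auto simp: c_def)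
    moreover have "\<forall>\<^sub>F n in sequentially. \<beta> / real n < 1"
      by (intro order_tendstoD(2)[OF lim_const_over_n[of \<beta>]]) auto
    ultimately show ?thesis
      using eventually_gt_at_top[of 0]
    proof eventually_elim
      case (elim n)
      have "exp (\<beta> / real n) - 1 \<le> \<beta> / real n + (\<beta> / real n)\<^sup>2"
        using exp_bound[of "\<beta> / real n"] elim \<beta> by simp
      also have "\<dots> = (\<beta> + \<beta>\<^sup>2 / real n) / real n" by (simp add: power2_eq_square add_divide_distrib)
      also have "\<dots> \<le> (\<rho> * s / (1 + (s / real n) * M)\<^sup>2) / real n"
        using elim by (intro divide_right_mono) auto
      finally show ?case by (simp add: field_simps)
    qed
  qed
  have "\<forall>\<^sub>F n in sequentially. s / real n < 1"
    by (intro order_tendstoD(2)[OF invs]) auto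
  then have main: "\<forall>\<^sub>F n in sequentially. \<forall>x. (Q (1 / real n) ^^ n) ((Q (s / real n) ^^ n) \<phi>) x
       \<le> exp ((M\<^sup>2 + 3) / 6 * exp (- \<rho> * s) * (\<integral>y. (dist x y)\<^sup>2 \<partial>m)) * K n"
    using rate harnack_const_le eventually_gt_at_top[of 0]
  proof eventually_elim
    case (elim n)
    define h where "h = s / real n"
    have h: "0 < h" "h \<le> 1" "real n * h = s" using elim s by (auto simp: h_def)
    define \<Phi> where "\<Phi> = (Q h ^^ n) \<phi>"
    have \<Phi>: "unit_lip \<epsilon> L' \<Phi>"
      using unit_lip_Q_iterate[OF \<phi>, of h n] e h unfolding \<Phi>_def L'_def by simp
    have np: "2 * exp (real n * (\<beta> / real n)) = p" using elim \<beta> by simp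
    have nB: "real n * (B * (h * sqrt h)) = B * (s * sqrt (s / real n))"
    proof -
      have "real n * (B * (h * sqrt h)) = B * ((real n * h) * sqrt h)" by (simp only: mult_ac)
      then show ?thesis by (simp only: h(3)) (simp only: h_def)
    qed
    have hyp: "ln (\<integral>x. \<Phi> x powr p \<partial>m) / p \<le> ln I2 / 2 + B * (s * sqrt (s / real n))"
      using hyper_iterate[OF \<phi> e h(1,2), of "\<beta> / real n" n n] elim \<beta>(1) unfolding np nB[symmetric]
      by (simp only: h_def[symmetric] h(3) \<Phi>_def[symmetric] I2_def[symmetric] L'_def[symmetric] B_def[symmetric] order.refl) simp
    have Ip: "0 < (\<integral>x. \<Phi> x powr p \<partial>m)"
      using powr_integral_lower[OF \<Phi> e, of p] e p by (smt (verit) powr_gt_zero)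
    have "ln (\<integral>x. \<Phi> x powr p \<partial>m) \<le> p * (ln I2 / 2 + B * (s * sqrt (s / real n)))"
      using hyp p by (simp add: divide_le_eq mult.commute)
    then have Ile: "(\<integral>x. \<Phi> x powr p \<partial>m) \<le> exp (p * (ln I2 / 2 + B * (s * sqrt (s / real n))))"
      using Ip by (metis exp_le_cancel_iff exp_ln)
    show ?case
    proof
      fix x
      define D where "D = (\<integral>y. (dist x y)\<^sup>2 \<partial>m)"
      define F where "F = (Q (1 / real n) ^^ n) \<Phi> x"
      define S where "S = exp (p * (ln I2 / 2 + B * (s * sqrt (s / real n)))) + p * L' * exp M * inv_const * sqrt (1 / real n)"
      have S: "0 < S" unfolding S_def using p L inv_const_nonneg by (intro add_pos_nonneg) auto
      have F0: "0 < F"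
        using unit_lipD(1)[OF unit_lip_Q_iterate[OF \<Phi>, of "1 / real n" n], of x] e unfolding F_def by simp
      have "F powr p \<le> ((\<integral>y. \<Phi> y powr p \<partial>m) + p * L' * exp M * inv_const * sqrt (1 / real n)) * exp (p / (p - 1) * ((M\<^sup>2 + 3) / 6 * D))"
        unfolding F_def D_def by (rule Q_pointwise_bound[OF \<Phi> e p(1)]) (use elim in auto)
      also have "\<dots> \<le> S * exp (p / (p - 1) * ((M\<^sup>2 + 3) / 6 * D))"
        unfolding S_def using Ile by (intro mult_right_mono add_right_mono) auto
      finally have "(F powr p) powr (1 / p) \<le> (S * exp (p / (p - 1) * ((M\<^sup>2 + 3) / 6 * D))) powr (1 / p)"
        using p by (intro powr_mono2) auto
      then have "F \<le> S powr (1 / p) * exp (1 / (p - 1) * ((M\<^sup>2 + 3) / 6 * D))"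
        using F0 S p by (simp add: powr_powr powr_mult exp_powr_real)
      also have "1 / (p - 1) * ((M\<^sup>2 + 3) / 6 * D) = (M\<^sup>2 + 3) / 6 * exp (- \<rho> * s) * D"
        unfolding p(2) by (simp add: exp_minus field_simps)
      finally have "F \<le> exp ((M\<^sup>2 + 3) / 6 * exp (- \<rho> * s) * D) * K n"
        unfolding K_def S_def by (simp only: mult.commute)
      then show "(Q (1 / real n) ^^ n) ((Q (s / real n) ^^ n) \<phi>) x
         \<le> exp ((M\<^sup>2 + 3) / 6 * exp (- \<rho> * s) * (\<integral>y. (dist x y)\<^sup>2 \<partial>m)) * K n"
        by (simp only: F_def D_def \<Phi>_def h_def)
    qed
  qed
  show ?thesis using that[OF Klim _ main] by (simp add: K_def)
qed

end

section \<open>Euler approximation of the diffusion\<close>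

context langevin
begin

text \<open>The increments \<open>d\<close> stand for Brownian increments, not standard normals,
  hence \<open>sqrt 2\<close> without \<open>sqrt h\<close>. In this form the recursion can be run
  along a fixed path.\<close>

primrec chain :: "(nat \<Rightarrow> real) \<Rightarrow> 'a \<Rightarrow> (nat \<Rightarrow> 'a) \<Rightarrow> nat \<Rightarrow> 'a" where
  "chain h x0 d 0 = x0"
| "chain h x0 d (Suc k) = chain h x0 d k - h k *\<^sub>R gU (chain h x0 d k) + sqrt 2 *\<^sub>R d k"

text \<open>Unrolled from the last step: the most recent noise is integrated out first.\<close>

primrec kern :: "(nat \<Rightarrow> real) \<Rightarrow> nat \<Rightarrow> ('a \<Rightarrow> real) \<Rightarrow> 'a \<Rightarrow> real" where
  "kern h 0 \<phi> = \<phi>"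
| "kern h (Suc k) \<phi> = kern h k (Q (h k) \<phi>)"

lemma chain_measurable:
  assumes [measurable]: "x0 \<in> borel_measurable N" and d: "\<And>i. i < k \<Longrightarrow> (\<lambda>w. d w i) \<in> borel_measurable N"
  shows "(\<lambda>w. chain h (x0 w) (d w) k) \<in> borel_measurable N"
  using d
proof (induction k)
  case (Suc k)
  have [measurable]: "(\<lambda>w. chain h (x0 w) (d w) k) \<in> borel_measurable N" "(\<lambda>w. d w k) \<in> borel_measurable N"
    using Suc by auto
  show ?case by simp
qed simp

text \<open>The noise is additive, so it cancels in the difference between the exact path and the
  Euler chain. What remains is a discrete Gronwall argument on a single path, driven by the modulus
  of continuity \<open>w\<close> of that path, without stochastic calculus.\<close>

lemma chain_error:
  fixes x b :: "real \<Rightarrow> 'a"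
  assumes cont: "continuous_on {0..T} x"
    and eq: "\<And>s. 0 \<le> s \<Longrightarrow> s \<le> T \<Longrightarrow> x s = x 0 - integral {0..s} (\<lambda>u. gU (x u)) + sqrt 2 *\<^sub>R b s"
    and \<tau>: "\<tau> 0 = 0" "\<And>k. \<tau> k \<le> \<tau> (Suc k)" "\<And>k. \<tau> (Suc k) - \<tau> k \<le> \<delta>"
    and w: "\<And>s s'. s \<in> {0..T} \<Longrightarrow> s' \<in> {0..T} \<Longrightarrow> \<bar>s - s'\<bar> \<le> \<delta> \<Longrightarrow> norm (x s - x s') \<le> w"
    and k: "\<tau> k \<le> T"
  shows "norm (x (\<tau> k) - chain (\<lambda>k. \<tau> (Suc k) - \<tau> k) (x 0) (\<lambda>k. b (\<tau> (Suc k)) - b (\<tau> k)) k) \<le> w * (exp (M * \<tau> k) - 1)"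
  using k
proof (induction k)
  case 0
  then show ?case by (simp add: \<tau>)
next
  case (Suc k)
  define y where "y = chain (\<lambda>k. \<tau> (Suc k) - \<tau> k) (x 0) (\<lambda>k. b (\<tau> (Suc k)) - b (\<tau> k)) k"
  define h where "h = \<tau> (Suc k) - \<tau> k"
  have h: "0 \<le> h" "h \<le> \<delta>" "\<tau> (Suc k) = \<tau> k + h" using \<tau> by (auto simp: h_def)
  have \<tau>0: "0 \<le> \<tau> k" for k
  proof (induction k)
    case (Suc k)
    then show ?case using \<tau>(2)[of k] by linarith
  qed (simp add: \<tau>)
  have T: "0 \<le> \<tau> k" "\<tau> k \<le> \<tau> (Suc k)" "\<tau> (Suc k) \<le> T" "\<tau> k \<le> T" using \<tau>0 \<tau>(2)[of k] Suc.prems by auto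
  have IH: "norm (x (\<tau> k) - y) \<le> w * (exp (M * \<tau> k) - 1)" using Suc T unfolding y_def by auto
  have contg: "continuous_on {0..T} (\<lambda>u. gU (x u))"
    by (rule continuous_on_compose2[OF gU_continuous cont]) auto
  have w0: "0 \<le> w" using w[of "\<tau> k" "\<tau> k"] T h by auto
  have comb: "integral {0..\<tau> k} (\<lambda>u. gU (x u)) + integral {\<tau> k..\<tau> (Suc k)} (\<lambda>u. gU (x u)) = integral {0..\<tau> (Suc k)} (\<lambda>u. gU (x u))"
    using T by (intro Henstock_Kurzweil_Integration.integral_combine integrable_continuous_interval continuous_on_subset[OF contg]) auto
  have contk: "continuous_on {\<tau> k..\<tau> (Suc k)} (\<lambda>u. gU (x u))"
    using T by (intro continuous_on_subset[OF contg]) auto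
  have split: "integral {\<tau> k..\<tau> (Suc k)} (\<lambda>u. gU (x u) - gU y) = integral {\<tau> k..\<tau> (Suc k)} (\<lambda>u. gU (x u)) - h *\<^sub>R gU y"
    using T(2) by (subst Henstock_Kurzweil_Integration.integral_diff) (auto intro!: integrable_continuous_interval contk simp: h_def)
  have "x (\<tau> (Suc k)) - chain (\<lambda>k. \<tau> (Suc k) - \<tau> k) (x 0) (\<lambda>k. b (\<tau> (Suc k)) - b (\<tau> k)) (Suc k)
      = (x (\<tau> k) - y) - integral {\<tau> k..\<tau> (Suc k)} (\<lambda>u. gU (x u) - gU y)"
  proof -
    have e1: "x (\<tau> (Suc k)) = x 0 - (integral {0..\<tau> k} (\<lambda>u. gU (x u)) + integral {\<tau> k..\<tau> (Suc k)} (\<lambda>u. gU (x u))) + sqrt 2 *\<^sub>R b (\<tau> (Suc k))"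
      unfolding comb using T by (intro eq) auto
    have e2: "x (\<tau> k) = x 0 - integral {0..\<tau> k} (\<lambda>u. gU (x u)) + sqrt 2 *\<^sub>R b (\<tau> k)"
      using T by (intro eq) auto
    show ?thesis
      unfolding split chain.simps y_def[symmetric] h_def[symmetric] e1 e2 by (simp add: scaleR_diff_right)
  qed
  also have "norm \<dots> \<le> norm (x (\<tau> k) - y) + norm (integral {\<tau> k..\<tau> (Suc k)} (\<lambda>u. gU (x u) - gU y))"
    by (rule norm_triangle_ineq4)
  also have "\<dots> \<le> norm (x (\<tau> k) - y) + M * (w + norm (x (\<tau> k) - y)) * (\<tau> (Suc k) - \<tau> k)"
  proof (rule add_left_mono, rule integral_bound)
    show "continuous_on {\<tau> k..\<tau> (Suc k)} (\<lambda>u. gU (x u) - gU y)" by (intro continuous_intros contk)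
    show "\<And>u. u \<in> {\<tau> k..\<tau> (Suc k)} \<Longrightarrow> norm (gU (x u) - gU y) \<le> M * (w + norm (x (\<tau> k) - y))"
    proof -
      fix u assume u: "u \<in> {\<tau> k..\<tau> (Suc k)}"
      have "norm (x u - y) \<le> norm (x u - x (\<tau> k)) + norm (x (\<tau> k) - y)"
        using norm_triangle_ineq[of "x u - x (\<tau> k)" "x (\<tau> k) - y"] by simp
      also have "norm (x u - x (\<tau> k)) \<le> w" using u T h by (intro w) auto
      finally have "M * norm (x u - y) \<le> M * (w + norm (x (\<tau> k) - y))" using M by (intro mult_left_mono) auto
      then show "norm (gU (x u) - gU y) \<le> M * (w + norm (x (\<tau> k) - y))" using gU_diff[of "x u" y] by linarith
    qed
  qed (use T in auto)
  also have "\<tau> (Suc k) - \<tau> k = h" by (simp add: h_def)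
  also have "norm (x (\<tau> k) - y) + M * (w + norm (x (\<tau> k) - y)) * h = (1 + M * h) * norm (x (\<tau> k) - y) + M * h * w"
    by (simp add: algebra_simps)
  also have "\<dots> \<le> (1 + M * h) * (w * (exp (M * \<tau> k) - 1)) + M * h * w"
    using M h IH by (intro add_right_mono mult_left_mono) auto
  also have "\<dots> = w * ((1 + M * h) * exp (M * \<tau> k) - 1)" by (simp add: algebra_simps)
  also have "\<dots> \<le> w * (exp (M * h) * exp (M * \<tau> k) - 1)"
    using w0 by (intro mult_left_mono diff_right_mono mult_right_mono exp_ge_add_one_self) auto
  also have "exp (M * h) * exp (M * \<tau> k) = exp (M * \<tau> (Suc k))" by (simp add: h(3) exp_add[symmetric] algebra_simps)
  finally show ?case .
qed

text \<open>The two phases have separate constant step lengths, so time 1 is a grid point for every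
  \<open>s\<close>. The grid continues beyond \<open>1 + s\<close>, and for \<open>s > 0\<close> all
  its increments are positive.\<close>

definition nodes :: "real \<Rightarrow> nat \<Rightarrow> nat \<Rightarrow> real" where
  "nodes s n k = (if k \<le> n then real k / real n else 1 + s * (real k - real n) / real n)"

lemma nodes_step: "nodes s n (Suc k) - nodes s n k = (if k < n then 1 / real n else s / real n)" if "0 < n"
proof (cases k n rule: linorder_cases)
  case less
  then show ?thesis using that by (simp add: nodes_def add_divide_distrib)
next
  case equal
  then show ?thesis using that by (simp add: nodes_def)
next
  case greater
  then show ?thesis using that by (simp add: nodes_def diff_divide_distrib[symmetric] algebra_simps)
qed

lemma nodes_0: "nodes s n 0 = 0" by (simp add: nodes_def)

lemma nodes_end: "0 < n \<Longrightarrow> nodes s n (n + n) = 1 + s"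
  by (simp add: nodes_def)

lemma chain_converges:
  fixes x b :: "real \<Rightarrow> 'a"
  assumes s: "0 < s" and cont: "continuous_on {0..} x"
    and eq: "\<And>t. 0 \<le> t \<Longrightarrow> x t = x 0 - integral {0..t} (\<lambda>u. gU (x u)) + sqrt 2 *\<^sub>R b t"
  shows "(\<lambda>n. chain (\<lambda>k. nodes s n (Suc k) - nodes s n k) (x 0) (\<lambda>k. b (nodes s n (Suc k)) - b (nodes s n k)) (n + n))
     \<longlonglongrightarrow> x (1 + s)"
proof (rule LIMSEQ_I)
  fix e :: real assume e: "0 < e"
  define T where "T = 1 + s"
  \<comment> \<open>Gronwall's factor at time \<open>T\<close> is \<open>exp (M * T) - 1\<close>, so
    this modulus keeps the error below \<open>e\<close>.\<close>
  define w where "w = e / exp (M * T)"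
  have w: "0 < w" using e by (simp add: w_def)
  have contT: "continuous_on {0..T} x" using cont by (rule continuous_on_subset) auto
  then have "uniformly_continuous_on {0..T} x" by (rule compact_uniformly_continuous) auto
  then obtain \<delta> where \<delta>: "0 < \<delta>" "\<And>s s'. s \<in> {0..T} \<Longrightarrow> s' \<in> {0..T} \<Longrightarrow> dist s' s < \<delta> \<Longrightarrow> dist (x s') (x s) < w"
    using w unfolding uniformly_continuous_on_def by metis
  have "\<forall>\<^sub>F n in sequentially. max 1 s / real n < \<delta> / 2"
    using \<delta>(1) by (intro order_tendstoD(2)[OF lim_const_over_n]) auto
  then have "\<forall>\<^sub>F n in sequentially. norm (chain (\<lambda>k. nodes s n (Suc k) - nodes s n k) (x 0)
        (\<lambda>k. b (nodes s n (Suc k)) - b (nodes s n k)) (n + n) - x T) < e"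
    using eventually_gt_at_top[of 0]
  proof eventually_elim
    case (elim n)
    \<comment> \<open>Half of \<open>\<delta>\<close>, since uniform continuity was stated for
      distances strictly below \<open>\<delta>\<close>.\<close>
    have st: "nodes s n (Suc k) - nodes s n k \<le> \<delta> / 2" for k
    proof -
      have "nodes s n (Suc k) - nodes s n k \<le> max 1 s / real n"
        unfolding nodes_step[OF elim(2)] using elim(2) by (auto intro!: divide_right_mono)
      then show ?thesis using elim(1) by linarith
    qed
    have mono: "nodes s n k \<le> nodes s n (Suc k)" for k
    proof -
      have "0 \<le> nodes s n (Suc k) - nodes s n k" unfolding nodes_step[OF elim(2)] using s by auto
      then show ?thesis by simp
    qed
    have "norm (x (nodes s n (n + n)) - chain (\<lambda>k. nodes s n (Suc k) - nodes s n k) (x 0)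
        (\<lambda>k. b (nodes s n (Suc k)) - b (nodes s n k)) (n + n)) \<le> w * (exp (M * nodes s n (n + n)) - 1)"
    proof (rule chain_error[where \<tau>="nodes s n" and x=x and b=b and T=T and \<delta>="\<delta> / 2" and w=w and k="n + n", OF contT _ nodes_0 mono st])
      show "norm (x s - x s') \<le> w" if "s \<in> {0..T}" "s' \<in> {0..T}" "\<bar>s - s'\<bar> \<le> \<delta> / 2" for s s'
        using \<delta>(2)[of s' s] that \<delta>(1) by (auto simp: dist_norm dist_real_def)
      show "nodes s n (n + n) \<le> T" unfolding nodes_end[OF elim(2)] T_def by simp
      show "x r = x 0 - integral {0..r} (\<lambda>u. gU (x u)) + sqrt 2 *\<^sub>R b r" if "0 \<le> r" "r \<le> T" for r
        by (rule eq[OF that(1)])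
    qed
    also have "\<dots> < w * exp (M * T)" unfolding nodes_end[OF elim(2)] T_def using w by simp
    also have "\<dots> = e" by (simp add: w_def)
    finally show ?case unfolding nodes_end[OF elim(2)] T_def by (simp add: norm_minus_commute)
  qed
  then show "\<exists>no. \<forall>n\<ge>no. norm (chain (\<lambda>k. nodes s n (Suc k) - nodes s n k) (x 0)
        (\<lambda>k. b (nodes s n (Suc k)) - b (nodes s n k)) (n + n) - x (1 + s)) < e"
    unfolding T_def by (simp add: eventually_sequentially)
qed

lemma kern_two_phases:
  assumes h1: "\<And>k. k < n \<Longrightarrow> h k = a" and h2: "\<And>k. n \<le> k \<Longrightarrow> h k = b"
  shows "kern h (n + n) \<phi> = (Q a ^^ n) ((Q b ^^ n) \<phi>)"
proof -
  have 1: "kern h k \<phi> = (Q a ^^ k) \<phi>" if "k \<le> n" for k \<phi>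
    using that by (induction k arbitrary: \<phi>) (auto simp: h1 funpow_swap1)
  have 2: "kern h (n + k) \<phi> = kern h n ((Q b ^^ k) \<phi>)" for k \<phi>
    by (induction k arbitrary: \<phi>) (auto simp: h2 funpow_swap1)
  show ?thesis by (simp add: 2 1)
qed

end

text \<open>Independence of \<open>X0\<close> is given relative to the sigma-algebra of the whole
  Brownian path. Every finite intersection of increment events lies in it, so index 0 splits off the
  product formula, and the independence of the increments handles the rest.\<close>

lemma (in prob_space) indep_vars_initial_increments:
  fixes B :: "real \<Rightarrow> 'a \<Rightarrow> 'b::euclidean_space" and X0 :: "'a \<Rightarrow> 'b"
  assumes X0 [measurable]: "X0 \<in> borel_measurable M" and B [measurable]: "\<And>s. B s \<in> borel_measurable M"
    and ind: "indep_set {X0 -` S \<inter> space M | S. S \<in> sets borel}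
        (sigma_sets (space M) (\<Union>s. {B s -` S \<inter> space M | S. S \<in> sets borel}))"
    and inc: "indep_vars (\<lambda>_. borel) (\<lambda>i \<omega>. B (\<tau> (Suc i)) \<omega> - B (\<tau> i) \<omega>) {..<n}"
  shows "indep_vars (\<lambda>_. borel) (\<lambda>i \<omega>. case i of 0 \<Rightarrow> X0 \<omega> | Suc i \<Rightarrow> B (\<tau> (Suc i)) \<omega> - B (\<tau> i) \<omega>) {..n}"
proof -
  define D where "D = (\<lambda>i \<omega>. B (\<tau> (Suc i)) \<omega> - B (\<tau> i) \<omega>)"
  define V where "V = (\<lambda>i \<omega>. case i of 0 \<Rightarrow> X0 \<omega> | Suc i \<Rightarrow> D i \<omega>)"
  define G where "G = (\<Union>s. {B s -` S \<inter> space M | S. S \<in> sets borel})"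
  have G: "G \<subseteq> Pow (space M)" by (auto simp: G_def)
  define \<Sigma> where "\<Sigma> = sigma (space M) G"
  have sets\<Sigma>: "sets \<Sigma> = sigma_sets (space M) G" and space\<Sigma>: "space \<Sigma> = space M"
    using G by (auto simp: \<Sigma>_def sets_measure_of space_measure_of)
  have B\<Sigma> [measurable]: "B s \<in> borel_measurable \<Sigma>" for s
  proof (rule measurableI)
    fix S :: "'b set" assume "S \<in> sets borel"
    then have "B s -` S \<inter> space M \<in> G" by (auto simp: G_def)
    then show "B s -` S \<inter> space \<Sigma> \<in> sets \<Sigma>" by (simp add: sets\<Sigma> space\<Sigma>)
  qed simp
  have D\<Sigma>: "D i \<in> borel_measurable \<Sigma>" for i unfolding D_def by measurable
  have [measurable]: "D i \<in> borel_measurable M" for i unfolding D_def by measurable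
  have rv: "random_variable borel (V i)" for i
    unfolding V_def by (cases i) auto
  define F where "F = (\<lambda>i. {V i -` A \<inter> space M | A. A \<in> sets borel})"
  have "indep_sets F {..n}"
  proof (rule indep_setsI)
    show "F i \<subseteq> events" for i using rv[of i] by (auto simp: F_def)
    fix A J assume J: "J \<noteq> {}" "J \<subseteq> {..n}" "finite J" and A: "\<forall>j\<in>J. A j \<in> F j"
    \<comment> \<open>The nonzero indices, which are then shifted down by one to number the
      increments.\<close>
    define J1 where "J1 = J - {0}"
    define J' where "J' = (\<lambda>j. j - 1) ` J1"
    have J1: "J1 = Suc ` J'" 
    proof -
      have "Suc ` J' = (\<lambda>j. Suc (j - 1)) ` J1" by (simp add: J'_def image_image)
      also have "\<dots> = (\<lambda>j. j) ` J1" by (rule image_cong) (auto simp: J1_def)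
      finally show ?thesis by simp
    qed
    have J': "J' \<subseteq> {..<n}" "finite J'" using J J1 by (auto simp: J1_def J'_def)
    have AS: "\<exists>S\<in>sets borel. A (Suc j) = D j -` S \<inter> space M" if "j \<in> J'" for j
    proof -
      have "Suc j \<in> J" using that J1 by (auto simp: J1_def)
      then have "A (Suc j) \<in> F (Suc j)" using A by blast
      then show ?thesis by (auto simp: F_def V_def)
    qed
    have prod1: "prob (\<Inter>j\<in>J1. A j) = (\<Prod>j\<in>J1. prob (A j))" if "J1 \<noteq> {}"
    proof -
      have ne: "J' \<noteq> {}" using that J1 by auto
      have isD: "indep_sets (\<lambda>i. {D i -` A \<inter> space M |A. A \<in> sets borel}) {..<n}"
        using inc unfolding indep_vars_def2 D_def by auto
      have "prob (\<Inter>j\<in>J'. A (Suc j)) = (\<Prod>j\<in>J'. prob (A (Suc j)))"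
        using AS by (intro indep_setsD[OF isD J'(1) ne J'(2)]) blast
      then show ?thesis unfolding J1 by (simp add: prod.reindex)
    qed
    show "prob (\<Inter>j\<in>J. A j) = (\<Prod>j\<in>J. prob (A j))"
    proof (cases "0 \<in> J")
      case False
      then have "J1 = J" by (auto simp: J1_def)
      then show ?thesis using prod1 J by simp
    next
      case True
      have JJ: "J = insert 0 J1" "0 \<notin> J1" "finite J1" using True J by (auto simp: J1_def)
      have A0: "A 0 \<in> {X0 -` S \<inter> space M | S. S \<in> sets borel}"
      proof -
        have "A 0 \<in> F 0" using A True by blast
        then show ?thesis by (auto simp: F_def V_def)
      qed
      show ?thesis
      proof (cases "J1 = {}")
        case True
        then show ?thesis using JJ by simp
      next
        case False
        have "(\<Inter>j\<in>J1. A j) \<in> sets \<Sigma>"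
        proof (rule sets.finite_INT)
          fix j assume "j \<in> J1"
          then obtain i where i: "j = Suc i" "i \<in> J'" using J1 by auto
          then obtain S where "S \<in> sets borel" "A j = D i -` S \<inter> space M" using AS by blast
          then show "A j \<in> sets \<Sigma>" using measurable_sets[OF D\<Sigma>, of S i] by (simp add: space\<Sigma>)
        qed (use JJ False in auto)
        then have "prob (A 0 \<inter> (\<Inter>j\<in>J1. A j)) = prob (A 0) * prob (\<Inter>j\<in>J1. A j)"
          using A0 by (intro indep_setD[OF ind]) (auto simp: sets\<Sigma> G_def)
        then show ?thesis using prod1[OF False] JJ by simp
      qed
    qed
  qed
  then have "indep_vars (\<lambda>_. borel) V {..n}"
    unfolding indep_vars_def2 F_def using rv by auto
  then show ?thesis unfolding V_def D_def .
qed

section \<open>Law of the Euler chain driven by Brownian increments\<close>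

context langevin
begin

text \<open>Independence makes the joint law a product, so the noise can be integrated at a frozen
  position; \<open>sqrt 2 * sqrt h = sqrt (2 * h)\<close> identifies it with the noise in
  \<open>euler\<close>.\<close>

lemma nn_integral_one_step:
  fixes Y D :: "'w \<Rightarrow> 'a"
  assumes P: "prob_space P" and ind: "prob_space.indep_var P borel Y borel D"
    and D: "distr P borel D = gaussian_vec h" and h: "0 < h" and \<phi>: "unit_lip \<epsilon> L \<phi>" and e: "0 \<le> \<epsilon>"
  shows "(\<integral>\<^sup>+\<omega>. ennreal (\<phi> (Y \<omega> - h *\<^sub>R gU (Y \<omega>) + sqrt 2 *\<^sub>R D \<omega>)) \<partial>P) = (\<integral>\<^sup>+\<omega>. ennreal (Q h \<phi> (Y \<omega>)) \<partial>P)"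
proof -
  interpret P: prob_space P by (rule P)
  have [measurable]: "Y \<in> borel_measurable P" "D \<in> borel_measurable P"
    using ind by (auto dest: P.indep_var_rv1 P.indep_var_rv2)
  have [measurable]: "\<phi> \<in> borel_measurable borel" by (rule unit_lip_measurable[OF \<phi>])
  have [measurable]: "Q h \<phi> \<in> borel_measurable borel"
    using unit_lip_measurable[OF unit_lip_Q[OF \<phi> e]] h by auto
  interpret G: prob_space "gaussian_vec h :: 'a measure" by (rule prob_space_gaussian_vec[OF h])
  have \<phi>0: "0 \<le> \<phi> x" for x using unit_lipD(1)[OF \<phi>, of x] e by linarith
  have inner: "(\<integral>\<^sup>+d. ennreal (\<phi> (y - h *\<^sub>R gU y + sqrt 2 *\<^sub>R d)) \<partial>gaussian_vec h) = ennreal (Q h \<phi> y)" for y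
  proof -
    have "(\<integral>\<^sup>+d. ennreal (\<phi> (y - h *\<^sub>R gU y + sqrt 2 *\<^sub>R d)) \<partial>gaussian_vec h)
        = (\<integral>\<^sup>+z. ennreal (\<phi> (euler h y z)) \<partial>std_gauss)"
      unfolding gaussian_vec_eq_distr[OF h]
      by (subst nn_integral_distr) (auto simp: euler_def real_sqrt_mult)
    also have "\<dots> = ennreal (Q h \<phi> y)"
      unfolding Q_def using unit_lip_integrable_euler[OF \<phi> e] \<phi>0 by (intro nn_integral_eq_integral) auto
    finally show ?thesis .
  qed
  have pair: "distr P borel Y \<Otimes>\<^sub>M gaussian_vec h = distr P (borel \<Otimes>\<^sub>M borel) (\<lambda>\<omega>. (Y \<omega>, D \<omega>))"
    using ind unfolding P.indep_var_distribution_eq D by simp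
  have "(\<integral>\<^sup>+\<omega>. ennreal (\<phi> (Y \<omega> - h *\<^sub>R gU (Y \<omega>) + sqrt 2 *\<^sub>R D \<omega>)) \<partial>P)
      = (\<integral>\<^sup>+p. ennreal (\<phi> (fst p - h *\<^sub>R gU (fst p) + sqrt 2 *\<^sub>R snd p)) \<partial>(distr P borel Y \<Otimes>\<^sub>M gaussian_vec h))"
    unfolding pair by (subst nn_integral_distr) auto
  also have "\<dots> = (\<integral>\<^sup>+y. \<integral>\<^sup>+d. ennreal (\<phi> (y - h *\<^sub>R gU y + sqrt 2 *\<^sub>R d)) \<partial>gaussian_vec h \<partial>distr P borel Y)"
    by (subst G.nn_integral_fst[symmetric]) auto
  also have "\<dots> = (\<integral>\<^sup>+\<omega>. ennreal (Q h \<phi> (Y \<omega>)) \<partial>P)"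
    unfolding inner by (subst nn_integral_distr) auto
  finally show ?thesis .
qed

text \<open>The last increment is independent of everything before it and is integrated out first.
  \<open>\<phi>\<close> and its Lipschitz constant must vary in the induction, because the
  hypothesis is applied to the smoothed function.\<close>

lemma chain_law:
  fixes B :: "real \<Rightarrow> 'w \<Rightarrow> 'a" and X0 :: "'w \<Rightarrow> 'a"
  assumes P: "prob_space P" and BM: "std_BM P B" and X0 [measurable]: "X0 \<in> borel_measurable P"
    and ind: "prob_space.indep_set P {X0 -` S \<inter> space P | S. S \<in> sets borel}
        (sigma_sets (space P) (\<Union>s. {B s -` S \<inter> space P | S. S \<in> sets borel}))"
    and \<tau>: "0 \<le> \<tau> 0" "\<And>i. \<tau> i < \<tau> (Suc i)"
    and \<phi>: "unit_lip \<epsilon> L \<phi>" and e: "0 \<le> \<epsilon>"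
  shows "(\<integral>\<^sup>+\<omega>. ennreal (\<phi> (chain (\<lambda>k. \<tau> (Suc k) - \<tau> k) (X0 \<omega>) (\<lambda>k. B (\<tau> (Suc k)) \<omega> - B (\<tau> k) \<omega>) n)) \<partial>P)
      = (\<integral>\<^sup>+\<omega>. ennreal (kern (\<lambda>k. \<tau> (Suc k) - \<tau> k) n \<phi> (X0 \<omega>)) \<partial>P)"
  using \<phi>
proof (induction n arbitrary: \<phi> L)
  case (Suc n)
  interpret P: prob_space P by (rule P)
  have B [measurable]: "B s \<in> borel_measurable P" for s using BM by (simp add: std_BM_def)
  define h where "h = (\<lambda>k. \<tau> (Suc k) - \<tau> k)"
  have h: "0 < h k" for k using \<tau>(2)[of k] by (simp add: h_def)
  define V where "V = (\<lambda>i \<omega>. case i of 0 \<Rightarrow> X0 \<omega> | Suc i \<Rightarrow> B (\<tau> (Suc i)) \<omega> - B (\<tau> i) \<omega>)"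
  have V: "P.indep_vars (\<lambda>_. borel) V {..Suc n}"
    unfolding V_def using BM \<tau> by (intro P.indep_vars_initial_increments X0 B ind) (auto simp: std_BM_def)
  define Y where "Y = (\<lambda>\<omega>. chain h (X0 \<omega>) (\<lambda>k. B (\<tau> (Suc k)) \<omega> - B (\<tau> k) \<omega>) n)"
  define D where "D = (\<lambda>\<omega>. B (\<tau> (Suc n)) \<omega> - B (\<tau> n) \<omega>)"
  have "P.indep_var borel ((\<lambda>w. chain h (w 0) (\<lambda>i. w (Suc i)) n) \<circ> (\<lambda>\<omega>. restrict (\<lambda>i. V i \<omega>) {..n}))
      borel ((\<lambda>w. w (Suc n)) \<circ> (\<lambda>\<omega>. restrict (\<lambda>i. V i \<omega>) {Suc n}))"
  proof (rule P.indep_var_compose[OF P.indep_var_restrict[OF V]])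
    show "(\<lambda>w. chain h (w 0) (\<lambda>i. w (Suc i)) n) \<in> borel_measurable (Pi\<^sub>M {..n} (\<lambda>_. borel))"
      by (rule chain_measurable) auto
  qed auto
  also have "(\<lambda>w. chain h (w 0) (\<lambda>i. w (Suc i)) n) \<circ> (\<lambda>\<omega>. restrict (\<lambda>i. V i \<omega>) {..n}) = Y"
  proof -
    \<comment> \<open>The chain after \<open>n\<close> steps reads only the first \<open>n\<close>
      increments, so restricting the indices to \<open>{..n}\<close> changes nothing.\<close>
    have cong: "chain h x d k = chain h x d' k" if "\<And>i. i < k \<Longrightarrow> d i = d' i" for x d d' k
      using that by (induction k) auto
    have "chain h (X0 \<omega>) (\<lambda>i. restrict (\<lambda>i. V i \<omega>) {..n} (Suc i)) n
        = chain h (X0 \<omega>) (\<lambda>k. B (\<tau> (Suc k)) \<omega> - B (\<tau> k) \<omega>) n" for \<omega>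
      by (rule cong) (simp add: V_def)
    moreover have "restrict (\<lambda>i. V i \<omega>) {..n} 0 = X0 \<omega>" for \<omega> by (simp add: V_def)
    ultimately show ?thesis unfolding Y_def comp_def by (simp only:)
  qed
  also have "(\<lambda>w. w (Suc n)) \<circ> (\<lambda>\<omega>. restrict (\<lambda>i. V i \<omega>) {Suc n}) = D"
    by (auto simp: D_def V_def fun_eq_iff)
  finally have YD: "P.indep_var borel Y borel D" .
  have \<tau>0: "0 \<le> \<tau> k" for k
  proof (induction k)
    case (Suc k)
    then show ?case using \<tau>(2)[of k] by linarith
  qed (rule \<tau>)
  have Dd: "distr P borel D = gaussian_vec (h n)"
    using BM \<tau> \<tau>0[of n] unfolding std_BM_def D_def h_def by auto
  have "(\<integral>\<^sup>+\<omega>. ennreal (\<phi> (chain h (X0 \<omega>) (\<lambda>k. B (\<tau> (Suc k)) \<omega> - B (\<tau> k) \<omega>) (Suc n))) \<partial>P)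
     = (\<integral>\<^sup>+\<omega>. ennreal (Q (h n) \<phi> (Y \<omega>)) \<partial>P)"
    using nn_integral_one_step[OF P YD Dd h Suc.prems e] by (simp add: Y_def D_def)
  also have "\<dots> = (\<integral>\<^sup>+\<omega>. ennreal (kern h n (Q (h n) \<phi>) (X0 \<omega>)) \<partial>P)"
    using Suc.IH[OF unit_lip_Q[OF Suc.prems e less_imp_le[OF h]]] unfolding Y_def h_def .
  finally show ?case unfolding h_def by simp
qed simp

end

section \<open>Concentration of the diffusion\<close>

context langevin
begin

definition weight :: "real \<Rightarrow> 'a \<Rightarrow> real" where
  "weight t x = exp ((M\<^sup>2 + 3) / 6 * exp (- \<rho> * (t - 1)) * (\<integral>y. (dist x y)\<^sup>2 \<partial>m))"

lemma weight_measurable [measurable]: "weight t \<in> borel_measurable borel"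
  unfolding weight_def by measurable

lemma weight_antimono: "weight t x \<le> weight 1 x" if "1 \<le> t"
proof -
  have "exp (- \<rho> * (t - 1)) \<le> 1" using \<rho> that by simp
  moreover have "0 \<le> (\<integral>y. (dist x y)\<^sup>2 \<partial>m)" by simp
  ultimately have "(M\<^sup>2 + 3) / 6 * exp (- \<rho> * (t - 1)) * (\<integral>y. (dist x y)\<^sup>2 \<partial>m) \<le> (M\<^sup>2 + 3) / 6 * 1 * (\<integral>y. (dist x y)\<^sup>2 \<partial>m)"
    by (intro mult_right_mono mult_left_mono) auto
  then show ?thesis by (simp add: weight_def)
qed

text \<open>Under any coupling with a Dirac mass the first coordinate is almost surely
  \<open>x\<close>, so all couplings have the same cost and the infimum runs over a
  constant.\<close>

lemma W2sq_return:
  "enn2real (W2sq (return borel x) m) = (\<integral>y. (dist x y)\<^sup>2 \<partial>m)"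
proof -
  define D where "D = (\<integral>\<^sup>+y. ennreal ((dist x y)\<^sup>2) \<partial>m)"
  have D: "D = ennreal (\<integral>y. (dist x y)\<^sup>2 \<partial>m)"
    unfolding D_def using dist_sq_integrable by (intro nn_integral_eq_integral) auto
  have eq: "(\<integral>\<^sup>+p. ennreal ((dist (fst p) (snd p))\<^sup>2) \<partial>\<pi>) = D" if \<pi>: "\<pi> \<in> couplings (return borel x) m" for \<pi>
  proof -
    have sets: "sets \<pi> = sets (borel \<Otimes>\<^sub>M borel)"
      using \<pi> unfolding couplings_def by (auto cong: sets_pair_measure_cong)
    have [measurable]: "fst \<in> measurable \<pi> borel" "snd \<in> measurable \<pi> borel"
      using measurable_fst[of borel borel] measurable_snd[of borel borel]
      unfolding measurable_cong_sets[OF sets refl] by auto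
    have fst: "distr \<pi> (return borel x) fst = return borel x" using \<pi> unfolding couplings_def by blast
    have "AE y in distr \<pi> (return borel x) fst. y = x" unfolding fst by (simp add: AE_return)
    moreover have "distr \<pi> (return borel x) fst = distr \<pi> borel fst" by (rule distr_cong) auto
    ultimately have "AE p in \<pi>. fst p = x" by (simp add: AE_distr_iff)
    then have "(\<integral>\<^sup>+p. ennreal ((dist (fst p) (snd p))\<^sup>2) \<partial>\<pi>) = (\<integral>\<^sup>+p. ennreal ((dist x (snd p))\<^sup>2) \<partial>\<pi>)"
      by (intro nn_integral_cong_AE) auto
    also have "\<dots> = (\<integral>\<^sup>+y. ennreal ((dist x y)\<^sup>2) \<partial>distr \<pi> borel snd)"
      by (subst nn_integral_distr) auto
    also have "distr \<pi> borel snd = distr \<pi> m snd" by (rule distr_cong) auto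
    also have "distr \<pi> m snd = m" using \<pi> unfolding couplings_def by auto
    finally show ?thesis by (simp add: D_def)
  qed
  \<comment> \<open>A coupling has to be exhibited, since an infimum over the empty set would be
    infinite.\<close>
  have ne: "distr m (return borel x \<Otimes>\<^sub>M m) (\<lambda>y. (x, y)) \<in> couplings (return borel x) m"
  proof -
    have [measurable]: "(\<lambda>y. (x, y)) \<in> measurable m (return borel x \<Otimes>\<^sub>M m)" by measurable
    have "distr (distr m (return borel x \<Otimes>\<^sub>M m) (\<lambda>y. (x, y))) (return borel x) fst = return borel x"
    proof -
      have "distr (distr m (return borel x \<Otimes>\<^sub>M m) (\<lambda>y. (x, y))) (return borel x) fst = distr m (return borel x) (\<lambda>_. x)"
        by (subst distr_distr[OF measurable_fst]) (auto simp: comp_def)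
      also have "\<dots> = distr m borel (\<lambda>_. x)" by (rule distr_cong) auto
      also have "\<dots> = return borel x" by simp
      finally show ?thesis .
    qed
    moreover have "distr (distr m (return borel x \<Otimes>\<^sub>M m) (\<lambda>y. (x, y))) m snd = m"
      by (subst distr_distr[OF measurable_snd]) (auto simp: comp_def distr_id2)
    moreover have "prob_space (distr m (return borel x \<Otimes>\<^sub>M m) (\<lambda>y. (x, y)))" by (rule prob_space_distr) measurable
    ultimately show ?thesis unfolding couplings_def by auto
  qed
  have "W2sq (return borel x) m = (INF \<pi>\<in>couplings (return borel x) m. D)"
    unfolding W2sq_def using eq by (intro INF_cong) auto
  also have "\<dots> = D" using ne by (intro cINF_const) auto
  finally show ?thesis by (simp add: D)
qed

context
  fixes P :: "'w measure" and B X :: "real \<Rightarrow> 'w \<Rightarrow> 'a"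
  assumes P: "prob_space P" and BM: "std_BM P B"
    and X: "\<And>s. 0 \<le> s \<Longrightarrow> X s \<in> borel_measurable P"
    and ind: "prob_space.indep_set P {X 0 -` S \<inter> space P | S. S \<in> sets borel}
           (sigma_sets (space P) (\<Union>s. {B s -` S \<inter> space P | S. S \<in> sets borel}))"
    and sde: "AE \<omega> in P. continuous_on {0..} (\<lambda>s. X s \<omega>) \<and>
           (\<forall>s\<ge>0. X s \<omega> = X 0 \<omega> - integral {0..s} (\<lambda>u. gU (X u \<omega>)) + sqrt 2 *\<^sub>R B s \<omega>)"
begin

text \<open>Bounded convergence along the paths carries the kernel bound over to \<open>X t\<close>.
  The strict inequality \<open>t > 1\<close> makes the second phase of the grid
  nondegenerate.\<close>

lemma expectation_bound_after_one:
  assumes \<phi>: "unit_lip \<epsilon> L \<phi>" and e: "0 < \<epsilon>" and t: "1 < t"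
    and c: "(\<integral>\<^sup>+x. ennreal (weight t x) \<partial>distr P borel (X 0)) \<le> ennreal c" "0 \<le> c"
  shows "(\<integral>\<omega>. \<phi> (X t \<omega>) \<partial>P) \<le> c * sqrt (\<integral>x. (\<phi> x)\<^sup>2 \<partial>m)"
proof -
  interpret P: prob_space P by (rule P)
  define s where "s = t - 1"
  have s: "0 < s" "1 + s = t" using t by (auto simp: s_def)
  have [measurable]: "X 0 \<in> borel_measurable P" "X t \<in> borel_measurable P" using X t by auto
  have [measurable]: "B s \<in> borel_measurable P" for s using BM by (simp add: std_BM_def)
  have [measurable]: "\<phi> \<in> borel_measurable borel" by (rule unit_lip_measurable[OF \<phi>])
  have cont\<phi>: "continuous_on UNIV \<phi>" by (rule lipschitz_on_continuous_on[OF unit_lipD(3)[OF \<phi>]])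
  have \<phi>b: "\<bar>\<phi> x\<bar> \<le> 1" "0 \<le> \<phi> x" for x using unit_lip_abs_le[OF \<phi>, of x] unit_lipD(1)[OF \<phi>, of x] e by auto
  define Y where "Y = (\<lambda>n \<omega>. chain (\<lambda>k. nodes s n (Suc k) - nodes s n k) (X 0 \<omega>)
      (\<lambda>k. B (nodes s n (Suc k)) \<omega> - B (nodes s n k) \<omega>) (n + n))"
  have [measurable]: "Y n \<in> borel_measurable P" for n
    unfolding Y_def by (rule chain_measurable) measurable
  have lim: "(\<lambda>n. \<integral>\<omega>. \<phi> (Y n \<omega>) \<partial>P) \<longlonglongrightarrow> (\<integral>\<omega>. \<phi> (X t \<omega>) \<partial>P)"
  proof (rule integral_dominated_convergence[where w="\<lambda>_. 1"])
    show "AE \<omega> in P. (\<lambda>n. \<phi> (Y n \<omega>)) \<longlonglongrightarrow> \<phi> (X t \<omega>)"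
      using sde
    proof eventually_elim
      case (elim \<omega>)
      have "(\<lambda>n. Y n \<omega>) \<longlonglongrightarrow> X (1 + s) \<omega>"
        unfolding Y_def by (rule chain_converges[OF s(1), of "\<lambda>s. X s \<omega>" "\<lambda>s. B s \<omega>"]) (use elim in blast)+
      then show ?case
        unfolding s(2) by (intro continuous_on_tendsto_compose[OF cont\<phi>]) auto
    qed
  qed (use \<phi>b in auto)
  obtain K where K: "K \<longlonglongrightarrow> sqrt (\<integral>x. (\<phi> x)\<^sup>2 \<partial>m)" "\<And>n. 0 \<le> K n"
    "\<forall>\<^sub>F n in sequentially. \<forall>x. (Q (1 / real n) ^^ n) ((Q (s / real n) ^^ n) \<phi>) x
       \<le> exp ((M\<^sup>2 + 3) / 6 * exp (- \<rho> * s) * (\<integral>y. (dist x y)\<^sup>2 \<partial>m)) * K n"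
    using semigroup_bound[OF \<phi> e s(1)] by blast
  have "\<forall>\<^sub>F n in sequentially. (\<integral>\<omega>. \<phi> (Y n \<omega>) \<partial>P) \<le> c * K n"
    using K(3) eventually_gt_at_top[of 0]
  proof eventually_elim
    case (elim n)
    have step: "nodes s n k < nodes s n (Suc k)" for k
    proof -
      have "0 < nodes s n (Suc k) - nodes s n k" unfolding nodes_step[OF elim(2)] using s elim by auto
      then show ?thesis by simp
    qed
    have kern: "kern (\<lambda>k. nodes s n (Suc k) - nodes s n k) (n + n) \<phi> = (Q (1 / real n) ^^ n) ((Q (s / real n) ^^ n) \<phi>)"
      by (rule kern_two_phases) (simp_all add: nodes_step[OF elim(2)])
    have "ennreal (\<integral>\<omega>. \<phi> (Y n \<omega>) \<partial>P) = (\<integral>\<^sup>+\<omega>. ennreal (\<phi> (Y n \<omega>)) \<partial>P)"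
      using \<phi>b by (intro nn_integral_eq_integral[symmetric] P.integrable_bounded[where C=1]) auto
    also have "\<dots> = (\<integral>\<^sup>+\<omega>. ennreal ((Q (1 / real n) ^^ n) ((Q (s / real n) ^^ n) \<phi>) (X 0 \<omega>)) \<partial>P)"
      unfolding Y_def kern[symmetric]
      by (rule chain_law[where \<tau>="nodes s n" and P=P and B=B and \<phi>=\<phi> and \<epsilon>=\<epsilon> and L=L, OF P BM _ ind _ step \<phi>])
         (use e in \<open>auto simp: nodes_0\<close>)
    also have "\<dots> \<le> (\<integral>\<^sup>+\<omega>. ennreal (weight t (X 0 \<omega>)) * ennreal (K n) \<partial>P)"
      using elim(1) K(2)[of n] unfolding weight_def s_def
      by (intro nn_integral_mono) (simp add: ennreal_mult'[symmetric] ennreal_leI)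
    also have "\<dots> = (\<integral>\<^sup>+x. ennreal (weight t x) \<partial>distr P borel (X 0)) * ennreal (K n)"
      by (simp add: nn_integral_multc nn_integral_distr)
    also have "\<dots> \<le> ennreal c * ennreal (K n)" by (intro mult_right_mono c) simp
    also have "\<dots> = ennreal (c * K n)" using c(2) by (simp add: ennreal_mult')
    finally show ?case using c(2) K(2)[of n] by (subst (asm) ennreal_le_iff) auto
  qed
  moreover have "(\<lambda>n. c * K n) \<longlonglongrightarrow> c * sqrt (\<integral>x. (\<phi> x)\<^sup>2 \<partial>m)" by (intro tendsto_intros K)
  ultimately show ?thesis using lim by (intro tendsto_le[OF sequentially_bot]) auto
qed

text \<open>At \<open>t = 1\<close> the second phase has length zero, so the bound is taken from
  times decreasing to 1 by path continuity. The weight is largest at \<open>t = 1\<close>, hence the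
  same constant \<open>c\<close> serves all of these times.\<close>

lemma expectation_bound:
  assumes \<phi>: "unit_lip \<epsilon> L \<phi>" and e: "0 < \<epsilon>" and t: "1 \<le> t"
    and c: "(\<integral>\<^sup>+x. ennreal (weight t x) \<partial>distr P borel (X 0)) \<le> ennreal c" "0 \<le> c"
  shows "(\<integral>\<omega>. \<phi> (X t \<omega>) \<partial>P) \<le> c * sqrt (\<integral>x. (\<phi> x)\<^sup>2 \<partial>m)"
proof (cases "t = 1")
  case False
  then show ?thesis using expectation_bound_after_one[OF \<phi> e _ c] t by simp
next
  case True
  interpret P: prob_space P by (rule P)
  define ts where "ts = (\<lambda>n. 1 + 1 / real (Suc n))"
  have ts: "1 < ts n" for n by (simp add: ts_def)
  have [measurable]: "X (ts n) \<in> borel_measurable P" "X 1 \<in> borel_measurable P" for n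
    using ts[of n] by (auto intro!: X)
  have [measurable]: "\<phi> \<in> borel_measurable borel" by (rule unit_lip_measurable[OF \<phi>])
  have cont\<phi>: "continuous_on UNIV \<phi>" by (rule lipschitz_on_continuous_on[OF unit_lipD(3)[OF \<phi>]])
  have \<phi>b: "\<bar>\<phi> x\<bar> \<le> 1" for x using unit_lip_abs_le[OF \<phi>, of x] e by auto
  have "(\<lambda>n. \<integral>\<omega>. \<phi> (X (ts n) \<omega>) \<partial>P) \<longlonglongrightarrow> (\<integral>\<omega>. \<phi> (X 1 \<omega>) \<partial>P)"
  proof (rule integral_dominated_convergence[where w="\<lambda>_. 1"])
    show "AE \<omega> in P. (\<lambda>n. \<phi> (X (ts n) \<omega>)) \<longlonglongrightarrow> \<phi> (X 1 \<omega>)"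
      using sde
    proof eventually_elim
      case (elim \<omega>)
      have "ts \<longlonglongrightarrow> 1 + 0"
        unfolding ts_def by (intro tendsto_intros LIMSEQ_Suc[OF lim_1_over_n])
      then have "(\<lambda>n. X (ts n) \<omega>) \<longlonglongrightarrow> X 1 \<omega>"
      proof (intro continuous_on_tendsto_compose[of "{0..}" "\<lambda>s. X s \<omega>"])
        show "continuous_on {0..} (\<lambda>s. X s \<omega>)" using elim by (rule conjunct1)
        have "ts n \<in> {0..}" for n using ts[of n] by simp
        then show "\<forall>\<^sub>F n in sequentially. ts n \<in> {0..}" by simp
      qed auto
      then show ?case
        by (intro continuous_on_tendsto_compose[OF cont\<phi>]) auto
    qed
  qed (use \<phi>b in auto)
  moreover have "(\<integral>\<omega>. \<phi> (X (ts n) \<omega>) \<partial>P) \<le> c * sqrt (\<integral>x. (\<phi> x)\<^sup>2 \<partial>m)" for n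
  proof (rule expectation_bound_after_one[OF \<phi> e _ _ c(2)])
    have "(\<integral>\<^sup>+x. ennreal (weight (ts n) x) \<partial>distr P borel (X 0)) \<le> (\<integral>\<^sup>+x. ennreal (weight 1 x) \<partial>distr P borel (X 0))"
      by (intro nn_integral_mono ennreal_leI weight_antimono less_imp_le[OF ts])
    then show "(\<integral>\<^sup>+x. ennreal (weight (ts n) x) \<partial>distr P borel (X 0)) \<le> ennreal c"
      using c(1) True by (auto intro: order.trans)
  qed (rule ts)
  ultimately show ?thesis unfolding True by (intro LIMSEQ_le_const2) auto
qed

lemma tail_bound:
  assumes t: "1 \<le> t" and r: "0 \<le> r" and lip: "1-lipschitz_on UNIV f"
  shows "emeasure P {\<omega> \<in> space P. r \<le> f (X t \<omega>) - (\<integral>x. f x \<partial>m)}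
    \<le> (\<integral>\<^sup>+x. ennreal (weight t x) \<partial>distr P borel (X 0)) * ennreal (exp (- \<rho> * r\<^sup>2 / 4))"
proof (cases "(\<integral>\<^sup>+x. ennreal (weight t x) \<partial>distr P borel (X 0)) = \<infinity>")
  case True
  then show ?thesis by (simp add: ennreal_top_mult)
next
  case False
  interpret P: prob_space P by (rule P)
  obtain c where c: "(\<integral>\<^sup>+x. ennreal (weight t x) \<partial>distr P borel (X 0)) = ennreal c" "0 \<le> c"
    using False by (cases "\<integral>\<^sup>+x. ennreal (weight t x) \<partial>distr P borel (X 0)") auto
  define a where "a = (\<integral>x. f x \<partial>m)"
  have [measurable]: "X t \<in> borel_measurable P" using X t by auto
  have [measurable]: "f \<in> borel_measurable borel"
    using lipschitz_on_continuous_on[OF lip] by (rule borel_measurable_continuous_onI)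
  define A where "A = {\<omega> \<in> space P. r \<le> f (X t \<omega>) - a}"
  have A [measurable]: "A \<in> sets P" unfolding A_def by measurable
  define g where "g = (\<lambda>\<epsilon>. sqrt (\<epsilon>\<^sup>2 + exp (- \<rho> * (max 0 (r - \<epsilon>))\<^sup>2 / 2)))"
  have main: "P.prob A \<le> c * g \<epsilon>" if e: "0 < \<epsilon>" "\<epsilon> < 1" for \<epsilon>
  proof -
    \<comment> \<open>A ramp of slope \<open>1 / \<epsilon>\<close> that equals 1 on the deviation
      event and has reached its floor once \<open>f x - a < r - \<epsilon>\<close>. The floor
      \<open>\<epsilon>\<close> supplies the positive lower bound required of test
      functions.\<close>
    define \<phi> where "\<phi> = (\<lambda>x. max \<epsilon> (min 1 (1 + (f x - a - r) / \<epsilon>)))"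
    have \<phi>: "unit_lip \<epsilon> (1 / \<epsilon>) \<phi>"
      unfolding unit_lip_def
    proof (intro conjI allI)
      show "\<epsilon> \<le> \<phi> x" "\<phi> x \<le> 1" for x using e by (auto simp: \<phi>_def)
      show "(1 / \<epsilon>)-lipschitz_on UNIV \<phi>"
      proof (rule lipschitz_onI)
        have clip: "\<bar>max \<epsilon> (min 1 u) - max \<epsilon> (min 1 v)\<bar> \<le> \<bar>u - v\<bar>" for u v :: real
          by (auto simp: max_def min_def)
        fix x y
        have "\<bar>\<phi> x - \<phi> y\<bar> \<le> \<bar>(1 + (f x - a - r) / \<epsilon>) - (1 + (f y - a - r) / \<epsilon>)\<bar>"
          unfolding \<phi>_def by (rule clip)
        also have "\<dots> = \<bar>f x - f y\<bar> / \<epsilon>" using e by (simp add: diff_divide_distrib[symmetric])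
        also have "\<dots> \<le> dist x y / \<epsilon>"
          using lipschitz_onD[OF lip, of x y] e by (intro divide_right_mono) (auto simp: dist_real_def)
        finally show "dist (\<phi> x) (\<phi> y) \<le> 1 / \<epsilon> * dist x y" by (simp add: dist_real_def)
      qed (use e in simp)
    qed
    have [measurable]: "\<phi> \<in> borel_measurable borel" by (rule unit_lip_measurable[OF \<phi>])
    have \<phi>b: "\<bar>\<phi> x\<bar> \<le> 1" for x using unit_lip_abs_le[OF \<phi>, of x] e by auto
    have "P.prob A = (\<integral>\<omega>. indicator A \<omega> \<partial>P)" by simp
    also have "\<dots> \<le> (\<integral>\<omega>. \<phi> (X t \<omega>) \<partial>P)"
    proof (rule integral_mono)
      show "integrable P (\<lambda>\<omega>. \<phi> (X t \<omega>))" using \<phi>b by (intro P.integrable_bounded[where C=1]) auto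
      show "indicator A \<omega> \<le> \<phi> (X t \<omega>)" for \<omega>
        using e by (auto simp: indicator_def A_def \<phi>_def)
    qed (simp add: less_top[symmetric])
    also have "\<dots> \<le> c * sqrt (\<integral>x. (\<phi> x)\<^sup>2 \<partial>m)"
      using c by (intro expectation_bound[OF \<phi> e(1) t]) auto
    also have "\<dots> \<le> c * g \<epsilon>"
    proof (intro mult_left_mono c)
      define S where "S = {x. max 0 (r - \<epsilon>) \<le> f x - a}"
      \<comment> \<open>For \<open>r < \<epsilon>\<close> the level \<open>r - \<epsilon>\<close> is
        negative, so \<open>S\<close> need not contain the set where the ramp exceeds its floor. The
        whole space does, and the claimed bound on its mass is then
        \<open>exp 0 = 1\<close>.\<close>
      define S' where "S' = (if r \<ge> \<epsilon> then S else UNIV)"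
      have S' [measurable]: "S' \<in> sets borel" unfolding S'_def S_def by auto
      have pS: "prob S' \<le> exp (- \<rho> * (max 0 (r - \<epsilon>))\<^sup>2 / 2)"
      proof (cases "r \<ge> \<epsilon>")
        case True
        then show ?thesis
          using concentration[OF lip, of "max 0 (r - \<epsilon>)"] unfolding S'_def S_def a_def by (simp only: if_True)
      qed (simp add: S'_def)
      have "(\<integral>x. (\<phi> x)\<^sup>2 \<partial>m) \<le> (\<integral>x. \<epsilon>\<^sup>2 + indicator S' x \<partial>m)"
      proof (rule integral_mono)
        show "integrable m (\<lambda>x. (\<phi> x)\<^sup>2)"
          using \<phi>b by (intro integrable_bounded[where C=1]) (auto simp: power_le_one abs_square_le_1)
        show "integrable m (\<lambda>x. \<epsilon>\<^sup>2 + indicator S' x)"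
          by (auto simp: less_top[symmetric])
        show "(\<phi> x)\<^sup>2 \<le> \<epsilon>\<^sup>2 + indicator S' x" for x
        proof (cases "x \<in> S'")
          case True
          then show ?thesis using \<phi>b[of x] by (simp add: abs_square_le_1 add_increasing)
        next
          case False
          then have "r \<ge> \<epsilon>" "f x - a < r - \<epsilon>" by (auto simp: S'_def S_def split: if_splits)
          then have "1 + (f x - a - r) / \<epsilon> \<le> 0" using e by (simp add: field_simps)
          then have "\<phi> x = \<epsilon>" using e by (simp add: \<phi>_def)
          then show ?thesis by simp
        qed
      qed
      also have "\<dots> = \<epsilon>\<^sup>2 + prob S'" by (simp add: less_top[symmetric])
      also have "\<dots> \<le> \<epsilon>\<^sup>2 + exp (- \<rho> * (max 0 (r - \<epsilon>))\<^sup>2 / 2)" using pS by simp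
      finally show "sqrt (\<integral>x. (\<phi> x)\<^sup>2 \<partial>m) \<le> g \<epsilon>" by (simp add: g_def)
    qed
    finally show ?thesis .
  qed
  have "(g \<longlongrightarrow> sqrt (0\<^sup>2 + exp (- \<rho> * (max 0 (r - 0))\<^sup>2 / 2))) (at_right 0)"
    unfolding g_def by (intro tendsto_intros) auto
  also have "sqrt (0\<^sup>2 + exp (- \<rho> * (max 0 (r - 0))\<^sup>2 / 2)) = exp (- \<rho> * r\<^sup>2 / 4)"
    using r by (intro real_sqrt_unique) (auto simp: exp_double[symmetric])
  finally have "((\<lambda>\<epsilon>. c * g \<epsilon>) \<longlongrightarrow> c * exp (- \<rho> * r\<^sup>2 / 4)) (at_right 0)" by (intro tendsto_intros)
  moreover have "\<forall>\<^sub>F \<epsilon> in at_right 0. P.prob A \<le> c * g \<epsilon>"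
    using eventually_at_right_real[of 0 1] by (rule eventually_mono) (use main in auto)
  ultimately have "P.prob A \<le> c * exp (- \<rho> * r\<^sup>2 / 4)"
    by (rule tendsto_lowerbound) simp
  then have "emeasure P A \<le> ennreal (c * exp (- \<rho> * r\<^sup>2 / 4))"
    by (simp add: P.emeasure_eq_measure ennreal_leI)
  also have "\<dots> = ennreal c * ennreal (exp (- \<rho> * r\<^sup>2 / 4))" using c(2) by (simp add: ennreal_mult')
  finally show ?thesis unfolding c(1) A_def a_def .
qed

end

end

theorem theorem2:
  fixes U :: "'a::euclidean_space \<Rightarrow> real" and gU :: "'a \<Rightarrow> 'a" and HU :: "'a \<Rightarrow> 'a \<Rightarrow>\<^sub>L 'a"
    and P :: "'w measure" and B X :: "real \<Rightarrow> 'w \<Rightarrow> 'a" and m0 :: "'a measure"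
    and \<rho> M t r :: real and f :: "'a \<Rightarrow> real"
  assumes "M > 0" and "\<rho> > 0"
    and "\<forall>x. (U has_derivative (\<lambda>v. gU x \<bullet> v)) (at x)"
    and "\<forall>x. (gU has_derivative blinfun_apply (HU x)) (at x)"
    and "continuous_on UNIV HU"
    and "\<forall>x. norm (HU x) \<le> M"
    and "prob_space (gibbs U)"
    and "log_sobolev \<rho> (gibbs U)"
    and "prob_space P" and "std_BM P B"
    and "\<forall>s\<ge>0. X s \<in> borel_measurable P"
    and "distr P borel (X 0) = m0"
    and "prob_space.indep_set P
           {X 0 -` S \<inter> space P | S. S \<in> sets borel}
           (sigma_sets (space P) (\<Union>s. {B s -` S \<inter> space P | S. S \<in> sets borel}))"
    and "AE \<omega> in P. continuous_on {0..} (\<lambda>s. X s \<omega>) \<and>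
           (\<forall>s\<ge>0. X s \<omega> = X 0 \<omega> - integral {0..s} (\<lambda>u. gU (X u \<omega>)) + sqrt 2 *\<^sub>R B s \<omega>)"
    and "t \<ge> 1" and "r \<ge> 0" and "1-lipschitz_on UNIV f"
  shows "emeasure P {\<omega>\<in>space P. f (X t \<omega>) - (\<integral>x. f x \<partial>gibbs U) \<ge> r}
    \<le> (\<integral>\<^sup>+x. ennreal (exp ((M\<^sup>2 + 3) / 6 * exp (- \<rho> * (t - 1))
                 * enn2real (W2sq (return borel x) (gibbs U)))) \<partial>m0)
       * ennreal (exp (- \<rho> * r\<^sup>2 / 4))"
proof -
  interpret langevin U gU HU M \<rho>
    by (rule langevin.intro) (use assms(1-8) in blast)+
  have w: "weight t = (\<lambda>x. exp ((M\<^sup>2 + 3) / 6 * exp (- \<rho> * (t - 1)) * enn2real (W2sq (return borel x) (gibbs U))))"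
    unfolding weight_def W2sq_return ..
  have "emeasure P {\<omega> \<in> space P. r \<le> f (X t \<omega>) - (\<integral>x. f x \<partial>gibbs U)}
      \<le> (\<integral>\<^sup>+x. ennreal (weight t x) \<partial>distr P borel (X 0)) * ennreal (exp (- \<rho> * r\<^sup>2 / 4))"
    by (rule tail_bound[OF assms(9,10) _ assms(13,14) assms(15,16,17)]) (use assms(11) in blast)
  then show ?thesis
    unfolding assms(12) w .
qed

end
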